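(* Let $F=(f_1,\ldots,f_n)\in\mathrm{End}(\mathbb{C}^n,O)$ be such that $dF_O$ is non-diagonalizable and $\mathrm{sp}(dF_O)=\{1\}$. Assume that $dF_O$ is in Jordan canonical form, with $\rho\ge1$ blocks of lengths $\mu_1\ge\cdots\ge\mu_\rho\ge1$. Assume moreover that $\mu_1>\mu_2$ (a condition considered satisfied if $\rho=1$) and that $a_{11}^{\mu_1}\neq0$, where $a_{11}^j$ denotes the coefficient of $(z_1)^2$ in the power series expansion of $f_j$ at $O$. Then $F$ admits a parabolic curve $\varphi$ tangent to $e_1$. Furthermore, if $z^o\in\varphi(\Delta)$ and $z^k=F^k(z^o)$, then, as $k\to+\infty$: - if $1\le j\le\mu_1$, $$z^k_j=(-1)^{\mu_1+j-1}\,\frac{2\mu_1-1}{a_{11}^{\mu_1}}\binom{2\mu_1-2}{\mu_1-1}\frac{(\mu_1+j-2)!}{k^{\mu_1+j-1}}+o\left(\frac{1}{k^{\mu_1+j-1}}\right);$$ - if $2\le l\le\rho$ and $1\le j-\nu_l\le\mu_l<\mu_1-1$, $$z^k_j=o\left(\frac{1}{k^{\mu_1+j-\nu_l}}\right);$$ - if $2\le l\le\rho$ and $1\le j-\nu_l\le\mu_l=\mu_1-1$, $$z^k_j=(-1)^{\mu_1+j-\nu_l}\,\frac{a_{11}^{\mu_l+\nu_l}(2\mu_1-1)(\mu_l+j-\nu_l)}{(a_{11}^{\mu_1})^2}\binom{2\mu_1-2}{\mu_1-1}\frac{(\mu_1+j-\nu_l-2)!}{k^{\mu_1+j-\nu_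l}}+o\left(\frac{1}{k^{\mu_1+j-\nu_l}}\right).$$
   Context: $\mathrm{End}(\mathbb{C}^n,O)$ is the set of germs at the origin $O$ of holomorphic self-maps of $\mathbb{C}^n$ fixing $O$; $\mathrm{sp}$ denotes the spectrum; $e_1$ is the first vector of the canonical basis of $\mathbb{C}^n$; $F^k$ is the $k$-th iterate. $\nu_1=0$ and $\nu_l=\nu_{l-1}+\mu_{l-1}$ for $2\le l\le\rho$. "$dF_O$ in Jordan canonical form" (with all eigenvalues $1$) means that the linear part of $f_j$ is $z_j+z_{j+1}$ if $\nu_l+1\le j<\nu_l+\mu_l$, and $z_j$ if $j=\nu_l+\mu_l$. Let $\Delta=\{\zeta\in\mathbb{C}: |\zeta-1|<1\}$. A holomorphic curve at the origin is a holomorphic injective map $\varphi\colon\Delta\to\mathbb{C}^n\setminus\{O\}$ that extends continuously to $0\in\partial\Delta$ with $\varphi(0)=O$. It is $F$-invariant if $F(\varphi(\Delta))\subseteq\varphi(\Delta)$; it is stable if it is $F$-invariant and, with $D=\varphi(\Delta)$, $(F|_D)^k\to O$ uniformly on compact subsets of $D$. A parabolic curve for $F$ is a stable holomorphic curve at the origin. It is tangent to $v\in\mathbb{C}^n\setminus\{O\}$ if $[\varphi(\zeta)]\to[v]$ in $\mathbb{P}^{n-1}(\mathbb{C})$ as $\zeta\to0$. *)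

theory Defs
  imports "HOL-Analysis.Analysis" "HOL-Library.Landau_Symbols"
begin

text \<open>Coefficients are indexed by multi-indices \<open>\<alpha> :: 'n \<Rightarrow> nat\<close>. The sum is unconditional.\<close>

definition has_power_series_at ::
    "(complex^'n \<Rightarrow> complex) \<Rightarrow> (('n::finite \<Rightarrow> nat) \<Rightarrow> complex) \<Rightarrow> complex^'n \<Rightarrow> bool" where
  "has_power_series_at f c p \<longleftrightarrow>
     (\<exists>r>0. \<forall>z\<in>ball p r.
        ((\<lambda>\<alpha>. c \<alpha> * (\<Prod>i\<in>UNIV. (z $ i - p $ i) ^ \<alpha> i)) has_sum f z) UNIV)"

text \<open>The coefficients of a convergent power series are determined by its sum, so the choice
  below is unique whenever an expansion exists.\<close>

definition power_series_coeff ::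
    "(complex^'n \<Rightarrow> complex) \<Rightarrow> complex^'n \<Rightarrow> ('n::finite \<Rightarrow> nat) \<Rightarrow> complex" where
  "power_series_coeff f p = (SOME c. has_power_series_at f c p)"

definition holomorphic_map_on ::
    "(complex^'n::finite \<Rightarrow> complex^'m) \<Rightarrow> (complex^'n) set \<Rightarrow> bool" where
  "holomorphic_map_on F U \<longleftrightarrow>
     open U \<and> (\<forall>p\<in>U. \<forall>i. \<exists>c. has_power_series_at (\<lambda>z. F z $ i) c p)"

definition eigenvalues :: "complex^'n^'n::finite \<Rightarrow> complex set" where
  "eigenvalues A = {c. \<exists>v. v \<noteq> 0 \<and> A *v v = c *s v}"

definition diagonalizable :: "complex^'n^'n::finite \<Rightarrow> bool" where
  "diagonalizable A \<longleftrightarrow>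
     (\<exists>P :: complex^'n^'n. invertible P \<and> (\<forall>i j. i \<noteq> j \<longrightarrow> (matrix_inv P ** A ** P) $ i $ j = 0))"

definition block_offset :: "(nat \<Rightarrow> nat) \<Rightarrow> nat \<Rightarrow> nat" where
  "block_offset \<mu> l = (\<Sum>i\<in>{1..<l}. \<mu> i)"

text \<open>The enumeration \<open>ix\<close> of the index type by \<open>1, \<dots>, n\<close> fixes the order of the coordinates.\<close>

definition unipotent_jordan_form ::
    "(nat \<Rightarrow> 'n::finite) \<Rightarrow> nat \<Rightarrow> (nat \<Rightarrow> nat) \<Rightarrow> complex^'n^'n \<Rightarrow> bool" where
  "unipotent_jordan_form ix \<rho> \<mu> A \<longleftrightarrow>
     (\<forall>l\<in>{1..\<rho>}. \<forall>z.
        (\<forall>j\<in>{block_offset \<mu> l + 1..<block_offset \<mu> l + \<mu> l}.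
           (A *v z) $ ix j = z $ ix j + z $ ix (j + 1)) \<and>
        (A *v z) $ ix (block_offset \<mu> l + \<mu> l) = z $ ix (block_offset \<mu> l + \<mu> l))"

definition proj_point :: "complex^'n::finite \<Rightarrow> (complex^'n) set" where
  "proj_point z = {c *s z | c. c \<noteq> 0}"

text \<open>The quotient topology along \<open>proj_point\<close> from the nonzero vectors.\<close>

definition projective_space :: "(complex^'n::finite) set topology" where
  "projective_space = topology (\<lambda>W. W \<subseteq> proj_point ` (- {0}) \<and> open {z. z \<noteq> 0 \<and> proj_point z \<in> W})"

lemma openin_projective_space:
  fixes W :: "(complex^'n::finite) set set"
  shows "openin projective_space W \<longleftrightarrow>
     W \<subseteq> proj_point ` (- {0}) \<and> open {z. z \<noteq> 0 \<and> proj_point z \<in> W}"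
proof -
  define L where
    "L = (\<lambda>W. W \<subseteq> proj_point ` (- {0}) \<and> open {z::complex^'n. z \<noteq> 0 \<and> proj_point z \<in> W})"
  have "L (S \<inter> T)" if "L S" "L T" for S T
  proof -
    have "{z. z \<noteq> 0 \<and> proj_point z \<in> S \<inter> T} =
          {z. z \<noteq> 0 \<and> proj_point z \<in> S} \<inter> {z. z \<noteq> 0 \<and> proj_point z \<in> T}" by auto
    then show ?thesis using that by (auto simp: L_def intro: open_Int)
  qed
  moreover have "L (\<Union>\<K>)" if *: "\<forall>K\<in>\<K>. L K" for \<K>
  proof -
    have "\<Union>\<K> \<subseteq> proj_point ` (- {0})"
      by (rule Union_least) (use * in \<open>simp add: L_def\<close>)
    moreover have "{z. z \<noteq> 0 \<and> proj_point z \<in> \<Union>\<K>} = (\<Union>K\<in>\<K>. {z. z \<noteq> 0 \<and> proj_point z \<in> K})"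
      by blast
    moreover have "open (\<Union>K\<in>\<K>. {z. z \<noteq> 0 \<and> proj_point z \<in> K})"
      by (rule open_UN) (use * in \<open>simp add: L_def\<close>)
    ultimately show ?thesis unfolding L_def by (simp only:)
  qed
  ultimately have "istopology L" unfolding istopology_def by blast
  then have "openin (topology L) W \<longleftrightarrow> L W" by (simp add: topology_inverse')
  then show ?thesis unfolding projective_space_def L_def .
qed

abbreviation Delta :: "complex set" ("\<Delta>") where
  "\<Delta> \<equiv> ball 1 1"

definition holomorphic_curve_at_origin :: "(complex \<Rightarrow> complex^'n::finite) \<Rightarrow> bool" where
  "holomorphic_curve_at_origin \<phi> \<longleftrightarrow>
     (\<forall>i. (\<lambda>\<zeta>. \<phi> \<zeta> $ i) holomorphic_on \<Delta>) \<and> inj_on \<phi> \<Delta> \<and> 0 \<notin> \<phi> ` \<Delta> \<and>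
     (\<phi> \<longlongrightarrow> 0) (at 0 within \<Delta>)"

text \<open>\<open>U\<close> is the domain of a representative \<open>F\<close> of a germ; outside \<open>U\<close> the values of the total
  function \<open>F\<close> have no meaning, so curves are required to lie in \<open>U\<close>.\<close>

definition invariant_curve ::
    "(complex^'n::finite) set \<Rightarrow> (complex^'n \<Rightarrow> complex^'n) \<Rightarrow> (complex \<Rightarrow> complex^'n) \<Rightarrow> bool" where
  "invariant_curve U F \<phi> \<longleftrightarrow> \<phi> ` \<Delta> \<subseteq> U \<and> F ` (\<phi> ` \<Delta>) \<subseteq> \<phi> ` \<Delta>"

definition stable_curve ::
    "(complex^'n::finite) set \<Rightarrow> (complex^'n \<Rightarrow> complex^'n) \<Rightarrow> (complex \<Rightarrow> complex^'n) \<Rightarrow> bool" where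
  "stable_curve U F \<phi> \<longleftrightarrow> invariant_curve U F \<phi> \<and>
     (\<forall>K. compact K \<and> K \<subseteq> \<phi> ` \<Delta> \<longrightarrow> uniform_limit K (\<lambda>k. F ^^ k) (\<lambda>_. 0) sequentially)"

definition parabolic_curve ::
    "(complex^'n::finite) set \<Rightarrow> (complex^'n \<Rightarrow> complex^'n) \<Rightarrow> (complex \<Rightarrow> complex^'n) \<Rightarrow> bool" where
  "parabolic_curve U F \<phi> \<longleftrightarrow> holomorphic_curve_at_origin \<phi> \<and> stable_curve U F \<phi>"

definition curve_tangent_to :: "(complex \<Rightarrow> complex^'n::finite) \<Rightarrow> complex^'n \<Rightarrow> bool" where
  "curve_tangent_to \<phi> v \<longleftrightarrow> v \<noteq> 0 \<and>
     limitin projective_space (\<lambda>\<zeta>. proj_point (\<phi> \<zeta>)) (proj_point v) (at 0 within \<Delta>)"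

end

theory Submission
  imports Defs "HOL-Complex_Analysis.Cauchy_Integral_Formula" "HOL-Real_Asymp.Real_Asymp"
begin

text \<open>
  The curve is the image of a solution of \<open>\<phi> (t + 1) = F (\<phi> t)\<close> on a half-strip
  \<open>Re t > R\<close>, \<open>\<bar>Im t\<bar> < 2\<close>. In the coordinate \<open>t\<close> the map \<open>F\<close> is the translation by \<open>1\<close>, so
  invariance is automatic, the orbit of \<open>\<phi> t\<close> is \<open>\<phi> (t + k)\<close>, and stability, tangency and the
  asymptotic expansions all become statements about \<open>\<phi>\<close> as \<open>Re t \<rightarrow> \<infinity>\<close>.

  \<^emph>\<open>The leading term.\<close> Let \<open>m\<close> be the length of the first block and \<open>a\<close> the coefficient of the square
  of the first coordinate in its last row. If differences are replaced by derivatives, the block says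
  that each coordinate is the derivative of the preceding one and that the \<open>m\<close>-th derivative of the
  first coordinate is \<open>a\<close> times its square; this has the solution \<open>C0 t\<^sup>-\<^sup>m\<close>. Coordinate \<open>j\<close> of
  the first block thus has size \<open>t\<^sup>-\<^sup>(\<^sup>m\<^sup>+\<^sup>j\<^sup>-\<^sup>1\<^sup>)\<close>. Every other block has length at most \<open>m - 1\<close> and
  is driven by the square of the first coordinate, of size \<open>t\<^sup>-\<^sup>2\<^sup>m\<close>, so its \<open>p\<close>-th coordinate is
  \<open>O(t\<^sup>-\<^sup>(\<^sup>m\<^sup>+\<^sup>p\<^sup>))\<close>, and even \<open>o\<close> of that unless the length is exactly \<open>m - 1\<close>. Giving a
  coordinate the depth \<open>d = j - 1\<close> in the first block and \<open>d = p\<close> in the others, one looks for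
  \<open>\<phi>\<^sub>i \<sim> C\<^sub>i t\<^sup>-\<^sup>(\<^sup>m\<^sup>+\<^sup>d\<^sup>)\<close>. The nonlinear part of \<open>F\<close> enters only through the fact
  that the substitution \<open>z\<^sub>i = x\<^sup>(\<^sup>m\<^sup>+\<^sup>d\<^sup>) y\<^sub>i\<close> turns it into \<open>x\<^sup>2\<^sup>m (a\<^sub>i y\<^sub>1\<^sup>2 + x H\<^sub>i(x, y))\<close> with
  \<open>H\<^sub>i\<close> Lipschitz (lemma \<open>quasi_homogeneous_expansion\<close>).

  \<^emph>\<open>The correction.\<close> An approximate solution is improved by iterating the sum operator that inverts
  the difference operator (lemma \<open>difference_equation_solution\<close>). The linearised equation, \<open>m\<close>-th
  derivative of \<open>v\<close> equal to \<open>2 a C0 t\<^sup>-\<^sup>m v\<close>, has the solution \<open>t\<^sup>-\<^sup>m\<^sup>-\<^sup>1\<close>, which is the derivative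
  of the leading term and reflects the freedom to translate \<open>t\<close>. The iteration is therefore a
  contraction only for errors smaller than \<open>t\<^sup>-\<^sup>m\<^sup>-\<^sup>1\<close> (lemma \<open>contracting_weights\<close>), and the
  approximation must be correct to one order beyond the leading one. At that order the resonance
  produces a logarithm, which is absorbed by replacing \<open>t\<close> with \<open>u = t + \<alpha> Ln t\<close>; the constant
  \<open>\<alpha>\<close> is the one for which the equations of the next coefficients are solvable (lemma
  \<open>second_order_coefficients\<close>). The residual is then small enough (lemma \<open>residual_bigo\<close>).

  \<^emph>\<open>Injectivity.\<close> If \<open>\<phi> s = \<phi> t\<close>, then \<open>\<phi> (s + k) = \<phi> (t + k)\<close> for all \<open>k\<close>. The quotient of the first
  two coordinates of the first block is \<open>c u + c' + o(1)\<close> with \<open>c \<noteq> 0\<close>, so \<open>u (t + k) - u (s + k)\<close>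
  tends to \<open>0\<close>; but it tends to \<open>t - s\<close>.

  \<^emph>\<open>The disc.\<close> The map \<open>\<zeta> \<mapsto> R + 1 - Ln \<zeta>\<close> carries \<open>\<Delta>\<close> injectively into the half-strip and \<open>\<zeta> \<rightarrow> 0\<close> to
  \<open>Re t \<rightarrow> \<infinity>\<close>, and its image is stable under \<open>t \<mapsto> t + 1\<close>, because \<open>\<Delta>\<close> contains \<open>\<zeta> / e\<close> with \<open>\<zeta>\<close>.
\<close>

section \<open>Power series in several variables\<close>

lemma norm_le_sum_component_cart:
  fixes z :: "complex^'n::finite"
  shows "norm z \<le> (\<Sum>i\<in>UNIV. norm (z $ i))"
  unfolding norm_vec_def by (rule L2_set_le_sum) simp

text \<open>The coefficients are summed at the point all of whose coordinates are \<open>r\<close>; for complex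
  numbers unconditional convergence there is absolute convergence, which makes the polydisc of
  radius \<open>r\<close> the natural domain for all later estimates.\<close>

lemma power_series_abs_summable:
  fixes f :: "complex^'n::finite \<Rightarrow> complex"
  assumes "has_power_series_at f c 0"
  obtains r where "0 < r" "(\<lambda>\<alpha>. norm (c \<alpha>) * r ^ sum \<alpha> UNIV) summable_on UNIV"
    and "\<forall>z. (\<forall>i. norm (z $ i) \<le> r) \<longrightarrow> ((\<lambda>\<alpha>. c \<alpha> * (\<Prod>i\<in>UNIV. z $ i ^ \<alpha> i)) has_sum f z) UNIV"
proof -
  obtain R where R: "R > 0"
    "\<And>z. z \<in> ball 0 R \<Longrightarrow> ((\<lambda>\<alpha>. c \<alpha> * (\<Prod>i\<in>UNIV. z $ i ^ \<alpha> i)) has_sum f z) UNIV"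
    using assms by (auto simp: has_power_series_at_def)
  define r where "r = R / (2 * CARD('n))"
  have small: "z \<in> ball 0 R" if "\<And>i. norm (z $ i) \<le> r" for z :: "complex^'n"
  proof -
    have "norm z \<le> (\<Sum>i\<in>(UNIV::'n set). r)"
      using norm_le_sum_component_cart sum_mono[OF that] order_trans by fastforce
    also have "\<dots> = R / 2" by (simp add: r_def)
    finally show ?thesis using R(1) by simp
  qed
  have "r > 0" using R(1) by (simp add: r_def)
  then have "((\<lambda>\<alpha>. c \<alpha> * (\<Prod>i\<in>UNIV. (\<chi> j. of_real r) $ i ^ \<alpha> i)) has_sum f (\<chi> j. of_real r)) UNIV"
    by (intro R(2) small) simp
  then have "(\<lambda>\<alpha>. c \<alpha> * (\<Prod>i\<in>(UNIV::'n set). of_real r ^ \<alpha> i)) summable_on UNIV"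
    using summable_on_def by fastforce
  then have "(\<lambda>\<alpha>. norm (c \<alpha> * (\<Prod>i\<in>(UNIV::'n set). of_real r ^ \<alpha> i))) summable_on UNIV"
    unfolding summable_on_iff_abs_summable_on_complex .
  then have "(\<lambda>\<alpha>. norm (c \<alpha>) * r ^ sum \<alpha> UNIV) summable_on UNIV"
    using \<open>r > 0\<close> by (simp add: norm_mult norm_power prod_norm[symmetric] power_sum)
  then show ?thesis using that[OF \<open>r > 0\<close>] R(2) small by blast
qed

text \<open>The partial sums are holomorphic in \<open>t\<close> and converge uniformly by the M-test; this reduces the
  composition with a curve to a limit in one complex variable.\<close>

lemma holomorphic_power_series_comp:
  fixes f :: "complex^'n::finite \<Rightarrow> complex"
  assumes sm: "(\<lambda>\<alpha>. norm (c \<alpha>) * r ^ sum \<alpha> UNIV) summable_on UNIV"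
    and f: "\<And>z. (\<And>i. norm (z $ i) \<le> r) \<Longrightarrow> ((\<lambda>\<alpha>. c \<alpha> * (\<Prod>i\<in>UNIV. z $ i ^ \<alpha> i)) has_sum f z) UNIV"
    and V: "open V" and hol: "\<And>i. (\<lambda>t. \<phi> t $ i) holomorphic_on V"
    and small: "\<And>t i. t \<in> V \<Longrightarrow> norm (\<phi> t $ i) \<le> r"
  shows "(\<lambda>t. f (\<phi> t)) holomorphic_on V"
proof -
  let ?S = "\<lambda>X t. \<Sum>\<alpha>\<in>X. c \<alpha> * (\<Prod>i\<in>UNIV. \<phi> t $ i ^ \<alpha> i)"
  have lim: "uniform_limit V ?S (\<lambda>t. f (\<phi> t)) (finite_subsets_at_top UNIV)"
  proof (rule Weierstrass_m_test_general'[OF _ _ sm])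
    fix \<alpha> t assume "t \<in> V"
    have "(\<Prod>i\<in>UNIV. norm (\<phi> t $ i) ^ \<alpha> i) \<le> (\<Prod>i\<in>UNIV. r ^ \<alpha> i)"
      using small[OF \<open>t \<in> V\<close>] by (intro prod_mono conjI power_mono) auto
    then show "norm (c \<alpha> * (\<Prod>i\<in>UNIV. \<phi> t $ i ^ \<alpha> i)) \<le> norm (c \<alpha>) * r ^ sum \<alpha> UNIV"
      by (simp add: norm_mult norm_power prod_norm[symmetric] power_sum mult_left_mono)
  next
    fix t assume "t \<in> V"
    then show "((\<lambda>\<alpha>. c \<alpha> * (\<Prod>i\<in>UNIV. \<phi> t $ i ^ \<alpha> i)) has_sum f (\<phi> t)) UNIV"
      by (intro f small)
  qed
  have S_hol: "?S X holomorphic_on V" for X by (intro holomorphic_intros hol)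
  show ?thesis
    unfolding holomorphic_on_def
  proof
    fix x assume "x \<in> V"
    then obtain e where e: "0 < e" "cball x e \<subseteq> V" using V open_contains_cball by blast
    have "uniform_limit (cball x e) ?S (\<lambda>t. f (\<phi> t)) (finite_subsets_at_top UNIV)"
      using lim e(2) uniform_limit_on_subset by blast
    moreover have "?S X holomorphic_on cball x e" for X
      using S_hol e(2) holomorphic_on_subset by blast
    then have "\<forall>\<^sub>F X in finite_subsets_at_top UNIV.
        continuous_on (cball x e) (?S X) \<and> ?S X holomorphic_on ball x e"
      using holomorphic_on_imp_continuous_on holomorphic_on_subset[OF _ ball_subset_cball]
      by (intro always_eventually) blast
    ultimately have "(\<lambda>t. f (\<phi> t)) holomorphic_on ball x e"
      using holomorphic_uniform_limit[of x e ?S "finite_subsets_at_top UNIV" "\<lambda>t. f (\<phi> t)"] by auto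
    then show "(\<lambda>t. f (\<phi> t)) field_differentiable at x within V"
      using holomorphic_on_imp_differentiable_at[of _ "ball x e" x] e(1) field_differentiable_at_within by auto
  qed
qed

abbreviation unit_index :: "'n \<Rightarrow> 'n \<Rightarrow> nat" where
  "unit_index j \<equiv> (\<lambda>_. 0)(j := 1)"

lemma prod_power_unit_index:
  fixes z :: "'n::finite \<Rightarrow> complex"
  shows "(\<Prod>i\<in>UNIV. z i ^ ((\<lambda>_. 0)(j := k)) i) = z j ^ k"
proof -
  have "(\<Prod>i\<in>UNIV. z i ^ ((\<lambda>_. 0)(j := k)) i) = (\<Prod>i\<in>UNIV. if i = j then z i ^ k else 1)"
    by (intro prod.cong) auto
  also have "\<dots> = z j ^ k" by simp
  finally show ?thesis .
qed

lemma sum_multi_index_eq_1_iff: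
  fixes \<alpha> :: "'n::finite \<Rightarrow> nat"
  shows "sum \<alpha> UNIV = 1 \<longleftrightarrow> \<alpha> \<in> range unit_index"
proof
  assume "sum \<alpha> UNIV = 1"
  then obtain j where "\<alpha> j = 1" "\<forall>i. i \<noteq> j \<longrightarrow> \<alpha> i = 0"
    using sum_eq_1_iff[of UNIV \<alpha>] by auto
  then have "\<alpha> = unit_index j" by auto
  then show "\<alpha> \<in> range unit_index" by blast
qed (auto simp: sum.delta' fun_upd_def)

lemma power_series_split_degree_2:
  fixes f :: "complex^'n::finite \<Rightarrow> complex"
  assumes "((\<lambda>\<alpha>. c \<alpha> * (\<Prod>i\<in>UNIV. z $ i ^ \<alpha> i)) has_sum f z) UNIV"
  shows "((\<lambda>\<alpha>. c \<alpha> * (\<Prod>i\<in>UNIV. z $ i ^ \<alpha> i)) has_sum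
      (f z - c (\<lambda>_. 0) - (\<Sum>j\<in>UNIV. c (unit_index j) * z $ j))) {\<alpha>. 2 \<le> sum \<alpha> UNIV}"
proof -
  let ?g = "\<lambda>\<alpha>. c \<alpha> * (\<Prod>i\<in>UNIV. z $ i ^ \<alpha> i)"
  let ?A = "insert (\<lambda>_. 0) (range unit_index) :: ('n \<Rightarrow> nat) set"
  have inj: "inj (unit_index :: 'n \<Rightarrow> 'n \<Rightarrow> nat)"
    by (rule injI) (metis fun_upd_apply zero_neq_one)
  have "(?g has_sum sum ?g ?A) ?A" by (intro has_sum_finite) auto
  from has_sum_Diff[OF assms this]
  have "(?g has_sum (f z - sum ?g ?A)) (UNIV - ?A)" by simp
  moreover have "(\<lambda>_. 0) \<notin> range (unit_index :: 'n \<Rightarrow> 'n \<Rightarrow> nat)"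
    by (metis (no_types, lifting) fun_upd_same imageE zero_neq_one)
  then have "sum ?g ?A = c (\<lambda>_. 0) + (\<Sum>j\<in>UNIV. c (unit_index j) * z $ j)"
    using sum.reindex[OF inj, of ?g] by (simp only: o_def prod_power_unit_index) simp
  moreover have "UNIV - ?A = {\<alpha>. 2 \<le> sum \<alpha> UNIV}"
  proof -
    have "\<alpha> \<notin> ?A \<longleftrightarrow> 2 \<le> sum \<alpha> UNIV" for \<alpha>
    proof -
      have "sum \<alpha> UNIV = 0 \<longleftrightarrow> \<alpha> = (\<lambda>_. 0)" by (auto simp: fun_eq_iff)
      moreover have "2 \<le> sum \<alpha> UNIV \<longleftrightarrow> sum \<alpha> UNIV \<noteq> 0 \<and> sum \<alpha> UNIV \<noteq> 1" by linarith
      ultimately show ?thesis using sum_multi_index_eq_1_iff[of \<alpha>] by blast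
    qed
    then show ?thesis by blast
  qed
  ultimately show ?thesis by (simp add: diff_diff_eq)
qed

text \<open>The terms of degree at least two are \<open>O(\<bar>z\<bar>\<^sup>2)\<close>, so the linear terms form a derivative at the
  origin, and the derivative is unique.\<close>

lemma power_series_linear_part:
  fixes f :: "complex^'n::finite \<Rightarrow> complex"
  assumes r: "0 < r" and sm: "(\<lambda>\<alpha>. norm (c \<alpha>) * r ^ sum \<alpha> UNIV) summable_on UNIV"
    and f: "\<And>z. (\<And>i. norm (z $ i) \<le> r) \<Longrightarrow> ((\<lambda>\<alpha>. c \<alpha> * (\<Prod>i\<in>UNIV. z $ i ^ \<alpha> i)) has_sum f z) UNIV"
    and der: "(f has_derivative L) (at 0)"
  shows "c (\<lambda>_. 0) = f 0" and "(\<Sum>j\<in>UNIV. c (unit_index j) * z $ j) = L z"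
proof -
  define l where "l z = (\<Sum>j\<in>UNIV. c (unit_index j) * z $ j)" for z
  define M where "M = (\<Sum>\<^sub>\<infinity>\<alpha>. norm (c \<alpha>) * r ^ sum \<alpha> UNIV)"
  have bound: "norm (f z - c (\<lambda>_. 0) - l z) \<le> M / r\<^sup>2 * (norm z)\<^sup>2" if "norm z \<le> r" for z
  proof -
    have zi: "norm (z $ i) \<le> norm z" for i by (rule Finite_Cartesian_Product.norm_nth_le)
    have "norm (f z - c (\<lambda>_. 0) - l z) \<le> (norm z / r)\<^sup>2 * infsum (\<lambda>\<alpha>. norm (c \<alpha>) * r ^ sum \<alpha> UNIV) {\<alpha>. 2 \<le> sum \<alpha> UNIV}"
    proof (rule norm_infsum_le)
      show "((\<lambda>\<alpha>. c \<alpha> * (\<Prod>i\<in>UNIV. z $ i ^ \<alpha> i)) has_sum (f z - c (\<lambda>_. 0) - l z)) {\<alpha>. 2 \<le> sum \<alpha> UNIV}"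
        unfolding l_def by (rule power_series_split_degree_2[OF f]) (use zi that order_trans in blast)
      show "((\<lambda>\<alpha>. (norm z / r)\<^sup>2 * (norm (c \<alpha>) * r ^ sum \<alpha> UNIV)) has_sum
          ((norm z / r)\<^sup>2 * infsum (\<lambda>\<alpha>. norm (c \<alpha>) * r ^ sum \<alpha> UNIV) {\<alpha>. 2 \<le> sum \<alpha> UNIV})) {\<alpha>. 2 \<le> sum \<alpha> UNIV}"
        by (intro has_sum_cmult_right has_sum_infsum summable_on_subset_banach[OF sm]) simp
      fix \<alpha> :: "'n \<Rightarrow> nat" assume \<alpha>: "\<alpha> \<in> {\<alpha>. 2 \<le> sum \<alpha> UNIV}"
      have "(\<Prod>i\<in>UNIV. norm (z $ i) ^ \<alpha> i) \<le> (\<Prod>i\<in>UNIV. norm z ^ \<alpha> i)"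
        using zi by (intro prod_mono conjI power_mono) auto
      also have "\<dots> = (norm z / r) ^ sum \<alpha> UNIV * r ^ sum \<alpha> UNIV"
        using r by (simp add: power_sum[symmetric] power_divide)
      also have "\<dots> \<le> (norm z / r)\<^sup>2 * r ^ sum \<alpha> UNIV"
        using r that \<alpha> by (intro mult_right_mono power_decreasing) auto
      finally have "(\<Prod>i\<in>UNIV. norm (z $ i) ^ \<alpha> i) \<le> (norm z / r)\<^sup>2 * r ^ sum \<alpha> UNIV" .
      from mult_left_mono[OF this norm_ge_zero[of "c \<alpha>"]]
      show "norm (c \<alpha> * (\<Prod>i\<in>UNIV. z $ i ^ \<alpha> i)) \<le> (norm z / r)\<^sup>2 * (norm (c \<alpha>) * r ^ sum \<alpha> UNIV)"
        by (simp add: norm_mult norm_power prod_norm[symmetric] mult_ac)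
    qed
    also have "\<dots> \<le> (norm z / r)\<^sup>2 * M"
      unfolding M_def using r by (intro mult_left_mono infsum_mono_neutral summable_on_subset_banach[OF sm] sm) auto
    finally show ?thesis by (simp add: power_divide mult.commute)
  qed
  show c0: "c (\<lambda>_. 0) = f 0" using bound[of 0] r by (simp add: l_def)
  have "linear l"
    by (rule linearI) (auto simp: l_def algebra_simps sum.distrib scaleR_sum_right)
  have "(f has_derivative l) (at 0)"
  proof (rule has_derivativeI_sandwich[of r])
    show "bounded_linear l" using \<open>linear l\<close> by (simp add: linear_conv_bounded_linear)
    show "norm (f y - f 0 - l (y - 0)) / norm (y - 0) \<le> M / r\<^sup>2 * norm y"
      if "y \<noteq> 0" "dist y 0 < r" for y
      using bound[of y] that c0 r by (simp add: field_simps power2_eq_square)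
    show "((\<lambda>y. M / r\<^sup>2 * norm y) \<longlongrightarrow> 0) (at 0)"
      by (rule tendsto_eq_rhs, (rule tendsto_intros)+) simp
  qed (use r in auto)
  then show "(\<Sum>j\<in>UNIV. c (unit_index j) * z $ j) = L z"
    using has_derivative_unique[OF der] l_def by metis
qed

lemma has_sum_minus:
  fixes f g :: "'a \<Rightarrow> complex"
  assumes "(f has_sum a) A" "(g has_sum b) A"
  shows "((\<lambda>x. f x - g x) has_sum (a - b)) A"
  using has_sum_add[OF assms(1) has_sum_uminusI[OF assms(2)]] by simp

text \<open>On the disc of radius one half the Lipschitz constant \<open>k / 2\<^sup>k\<^sup>-\<^sup>1\<close> of the \<open>k\<close>-th power is at most
  one, uniformly in \<open>k\<close>; this is why all estimates keep a factor two of room.\<close>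

lemma power_diff_le_on_half_disc:
  fixes a b :: complex
  assumes "norm a \<le> 1 / 2" "norm b \<le> 1 / 2"
  shows "norm (a ^ k - b ^ k) \<le> norm (a - b)"
proof (induction k)
  case (Suc k)
  show ?case
  proof (cases "k = 0")
    case False
    have "norm (b ^ k) \<le> (1 / 2) ^ k" unfolding norm_power by (intro power_mono assms) simp
    also have "\<dots> \<le> (1 / 2) ^ 1" using False by (intro power_decreasing) auto
    finally have "norm (a * (a ^ k - b ^ k)) + norm ((a - b) * b ^ k)
        \<le> 1 / 2 * norm (a - b) + norm (a - b) * (1 / 2)"
      unfolding norm_mult by (intro add_mono mult_mono Suc.IH assms) auto
    moreover have "a ^ Suc k - b ^ Suc k = a * (a ^ k - b ^ k) + (a - b) * b ^ k"
      by (simp add: algebra_simps)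
    ultimately show ?thesis using norm_triangle_ineq order_trans by fastforce
  qed simp
qed simp

lemma monomial_diff_le:
  fixes y y' :: "'n::finite \<Rightarrow> complex"
  assumes "0 < Y" "\<And>j. norm (y j) \<le> Y" "\<And>j. norm (y' j) \<le> Y"
  shows "norm ((\<Prod>j\<in>UNIV. y j ^ \<alpha> j) - (\<Prod>j\<in>UNIV. y' j ^ \<alpha> j))
      \<le> (2 * Y) ^ sum \<alpha> UNIV * ((\<Sum>j\<in>UNIV. norm (y j - y' j)) / (2 * Y))"
proof -
  define v where "v y j = y j / of_real (2 * Y)" for y :: "'n \<Rightarrow> complex" and j
  have v: "norm (v y j) \<le> 1 / 2" "norm (v y' j) \<le> 1 / 2" for j
    using assms by (auto simp: v_def norm_divide norm_mult)
  have le1: "norm (v y j ^ \<alpha> j) \<le> 1" "norm (v y' j ^ \<alpha> j) \<le> 1" for j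
    unfolding norm_power using v[of j] by (auto intro!: power_le_one)
  have scale: "(\<Prod>j\<in>UNIV. y j ^ \<alpha> j) = of_real (2 * Y) ^ sum \<alpha> UNIV * (\<Prod>j\<in>UNIV. v y j ^ \<alpha> j)"
    for y :: "'n \<Rightarrow> complex"
    using assms(1) by (simp add: v_def power_divide prod_dividef power_sum)
  have "norm ((\<Prod>j\<in>UNIV. v y j ^ \<alpha> j) - (\<Prod>j\<in>UNIV. v y' j ^ \<alpha> j))
      \<le> (\<Sum>j\<in>UNIV. norm (v y j ^ \<alpha> j - v y' j ^ \<alpha> j))"
    using le1 by (intro norm_prod_diff)
  also have "\<dots> \<le> (\<Sum>j\<in>UNIV. norm (v y j - v y' j))"
    by (intro sum_mono power_diff_le_on_half_disc v)
  also have "\<dots> = (\<Sum>j\<in>UNIV. norm (y j - y' j)) / (2 * Y)"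
    using assms(1)
    by (simp add: v_def diff_divide_distrib[symmetric] norm_divide norm_mult sum_divide_distrib)
  finally have le: "norm ((\<Prod>j\<in>UNIV. v y j ^ \<alpha> j) - (\<Prod>j\<in>UNIV. v y' j ^ \<alpha> j))
      \<le> (\<Sum>j\<in>UNIV. norm (y j - y' j)) / (2 * Y)" .
  have "norm ((\<Prod>j\<in>UNIV. y j ^ \<alpha> j) - (\<Prod>j\<in>UNIV. y' j ^ \<alpha> j))
      = norm (of_real (2 * Y) ^ sum \<alpha> UNIV * ((\<Prod>j\<in>UNIV. v y j ^ \<alpha> j) - (\<Prod>j\<in>UNIV. v y' j ^ \<alpha> j)))"
    by (simp only: scale[of y] scale[of y'] right_diff_distrib)
  also have "\<dots> = (2 * Y) ^ sum \<alpha> UNIV * norm ((\<Prod>j\<in>UNIV. v y j ^ \<alpha> j) - (\<Prod>j\<in>UNIV. v y' j ^ \<alpha> j))"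
    using assms(1) by (simp add: norm_mult norm_power)
  also have "\<dots> \<le> (2 * Y) ^ sum \<alpha> UNIV * ((\<Sum>j\<in>UNIV. norm (y j - y' j)) / (2 * Y))"
    using assms(1) by (intro mult_left_mono le) auto
  finally show ?thesis .
qed

text \<open>The two estimates used of a remainder: it is Lipschitz in \<open>y\<close>, and at \<open>x = 0\<close> it is approached
  linearly in \<open>x\<close>.\<close>

definition lipschitz_remainder ::
    "real \<Rightarrow> real \<Rightarrow> real \<Rightarrow> (complex \<Rightarrow> ('n::finite \<Rightarrow> complex) \<Rightarrow> complex) \<Rightarrow> bool" where
  "lipschitz_remainder x0 Y K H \<longleftrightarrow>
     (\<forall>x y y'. norm x \<le> x0 \<and> (\<forall>j. norm (y j) \<le> Y) \<and> (\<forall>j. norm (y' j) \<le> Y) \<longrightarrow>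
        norm (H x y - H x y') \<le> K * (\<Sum>j\<in>UNIV. norm (y j - y' j)) \<and>
        norm (H x y - H 0 y) \<le> K * norm x)"

text \<open>With weights \<open>w\<close> that are at least \<open>m\<close>, and larger than \<open>m\<close> off the index \<open>i\<close>, a monomial of degree
  at least two has weight at least \<open>2 m + 1\<close>, with the only exception of the square of the \<open>i\<close>-th
  coordinate: either it has degree at least three, or it contains another coordinate. Hence
  \<open>x\<^sup>2\<^sup>m\<^sup>+\<^sup>1\<close> can be factored out of the rest of the series, and the quotient \<open>H\<close> is still a convergent
  series in \<open>(x, y)\<close>.\<close>

lemma quasi_homogeneous_remainder:
  fixes c :: "('n::finite \<Rightarrow> nat) \<Rightarrow> complex" and w :: "'n \<Rightarrow> nat"
  assumes r: "0 < r" and sm: "(\<lambda>\<alpha>. norm (c \<alpha>) * r ^ sum \<alpha> UNIV) summable_on UNIV"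
    and m: "1 \<le> m" and w: "w i = m" "\<And>j. j \<noteq> i \<Longrightarrow> m < w j" and Y: "0 < Y"
  defines "Rest \<equiv> {\<alpha>. 2 \<le> sum \<alpha> UNIV \<and> \<alpha> \<noteq> (\<lambda>_. 0)(i := 2)}"
  obtains x0 K H where "0 < x0" "0 \<le> K"
    and "\<forall>(x :: complex) y j. norm x \<le> x0 \<and> norm y \<le> Y \<longrightarrow> norm (x ^ w j * y) \<le> r"
    and "\<forall>x y. norm x \<le> x0 \<and> (\<forall>j. norm (y j) \<le> Y) \<longrightarrow>
        ((\<lambda>\<alpha>. c \<alpha> * (\<Prod>j\<in>UNIV. (x ^ w j * y j) ^ \<alpha> j)) has_sum x ^ (2 * m + 1) * H x y) Rest"
    and "lipschitz_remainder x0 Y K H"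
proof -
  \<comment> \<open>All weights are at least \<open>1\<close>, so \<open>x0 \<le> 1\<close> and \<open>x0 * (2 * Y) \<le> r\<close> keep the doubled polydisc
      inside the domain of convergence.\<close>
  define x0 where "x0 = min 1 (r / (2 * Y))"
  have x0: "0 < x0" "x0 \<le> 1" using r Y by (auto simp: x0_def)
  have x0Y: "x0 ^ k * (2 * Y) \<le> r" if "1 \<le> k" for k
  proof -
    have "x0 ^ k \<le> x0 ^ 1" using x0 that by (intro power_decreasing) auto
    then have "x0 ^ k \<le> r / (2 * Y)" by (simp add: x0_def)
    then show ?thesis using Y by (simp add: field_simps)
  qed
  have wm: "m \<le> w j" for j using w by (cases "j = i") (auto intro: less_imp_le)
  define wt where "wt \<alpha> = (\<Sum>j\<in>UNIV. \<alpha> j * w j)" for \<alpha> :: "'n \<Rightarrow> nat"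
  define e where "e \<alpha> = wt \<alpha> - (2 * m + 1)" for \<alpha>
  have wt_ge: "m * sum \<alpha> UNIV \<le> wt \<alpha>" for \<alpha>
    unfolding wt_def sum_distrib_left by (intro sum_mono) (use wm in \<open>auto simp: mult.commute\<close>)
  have wt_Rest: "2 * m + 1 \<le> wt \<alpha>" if "\<alpha> \<in> Rest" for \<alpha>
  proof (cases "\<exists>j. j \<noteq> i \<and> \<alpha> j \<noteq> 0")
    case True
    then obtain j where j: "j \<noteq> i" "\<alpha> j \<noteq> 0" by blast
    have "m * sum \<alpha> UNIV < wt \<alpha>"
      unfolding wt_def sum_distrib_left
    proof (rule sum_strict_mono_ex1)
      show "\<forall>k\<in>UNIV. m * \<alpha> k \<le> \<alpha> k * w k" using wm by (auto simp: mult.commute)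
      show "\<exists>k\<in>UNIV. m * \<alpha> k < \<alpha> k * w k"
        using w(2)[OF j(1)] j(2) by (intro bexI[of _ j]) (auto simp: mult.commute)
    qed auto
    moreover have "m * 2 \<le> m * sum \<alpha> UNIV" using that by (intro mult_left_mono) (auto simp: Rest_def)
    ultimately show ?thesis by linarith
  next
    case False
    then have \<alpha>: "\<alpha> = (\<lambda>_. 0)(i := \<alpha> i)" by (intro ext) auto
    have "sum \<alpha> UNIV = (\<Sum>j\<in>UNIV. if j = i then \<alpha> i else 0)" using False by (intro sum.cong) auto
    then have s: "sum \<alpha> UNIV = \<alpha> i" by simp
    have "\<alpha> i \<noteq> 2" using \<alpha> that by (auto simp: Rest_def)
    then have "3 \<le> sum \<alpha> UNIV" using that s by (auto simp: Rest_def)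
    then have "m * 3 \<le> m * sum \<alpha> UNIV" by (intro mult_left_mono) auto
    then show ?thesis using wt_ge[of \<alpha>] m by linarith
  qed
  define A where "A \<alpha> = norm (c \<alpha>) * x0 ^ e \<alpha> * (2 * Y) ^ sum \<alpha> UNIV" for \<alpha>
  have A_nonneg: "0 \<le> A \<alpha>" for \<alpha> using x0 Y by (simp add: A_def)
  have A_sm: "A summable_on Rest"
  proof (rule summable_on_comparison_test)
    show "(\<lambda>\<alpha>. norm (c \<alpha>) * r ^ sum \<alpha> UNIV * (1 / x0 ^ (2 * m + 1))) summable_on Rest"
      by (intro summable_on_cmult_left summable_on_subset_banach[OF sm]) simp
    fix \<alpha> assume \<alpha>: "\<alpha> \<in> Rest"
    have "x0 ^ wt \<alpha> * (2 * Y) ^ sum \<alpha> UNIV \<le> x0 ^ (m * sum \<alpha> UNIV) * (2 * Y) ^ sum \<alpha> UNIV"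
      using x0 Y wt_ge by (intro mult_right_mono power_decreasing) auto
    also have "\<dots> = (x0 ^ m * (2 * Y)) ^ sum \<alpha> UNIV" by (simp add: power_mult power_mult_distrib)
    also have "\<dots> \<le> r ^ sum \<alpha> UNIV" using x0Y[OF m] x0 Y by (intro power_mono) auto
    finally have le: "x0 ^ wt \<alpha> * (2 * Y) ^ sum \<alpha> UNIV \<le> r ^ sum \<alpha> UNIV" .
    have "x0 ^ e \<alpha> = x0 ^ wt \<alpha> * (1 / x0 ^ (2 * m + 1))"
      using x0 wt_Rest[OF \<alpha>] by (simp add: e_def power_diff)
    then have A: "A \<alpha> = norm (c \<alpha>) / x0 ^ (2 * m + 1) * (x0 ^ wt \<alpha> * (2 * Y) ^ sum \<alpha> UNIV)"
      by (simp add: A_def)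
    have "A \<alpha> \<le> norm (c \<alpha>) / x0 ^ (2 * m + 1) * r ^ sum \<alpha> UNIV"
      unfolding A using x0 by (intro mult_left_mono le) auto
    then show "A \<alpha> \<le> norm (c \<alpha>) * r ^ sum \<alpha> UNIV * (1 / x0 ^ (2 * m + 1))"
      by simp
  qed (rule A_nonneg)
  define S where "S = infsum A Rest"
  have S: "(A has_sum S) Rest" unfolding S_def using A_sm by (rule has_sum_infsum)
  have S_nonneg: "0 \<le> S" unfolding S_def by (rule infsum_nonneg) (rule A_nonneg)
  define t where "t x y \<alpha> = c \<alpha> * (x ^ e \<alpha> * (\<Prod>j\<in>UNIV. y j ^ \<alpha> j))" for x y \<alpha>
  define H where "H x y = infsum (t x y) Rest" for x y
  have y_le: "norm (\<Prod>j\<in>UNIV. y j ^ \<alpha> j) \<le> (2 * Y) ^ sum \<alpha> UNIV" if "\<And>j. norm (y j) \<le> Y" for y :: "'n \<Rightarrow> complex" and \<alpha>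
  proof -
    have "norm (y j) \<le> 2 * Y" for j using that[of j] Y by linarith
    then have "(\<Prod>j\<in>UNIV. norm (y j) ^ \<alpha> j) \<le> (\<Prod>j\<in>UNIV. (2 * Y) ^ \<alpha> j)"
      by (intro prod_mono conjI power_mono) auto
    then show ?thesis by (simp add: norm_power prod_norm[symmetric] power_sum)
  qed
  have x_le: "norm (x ^ k) \<le> x0 ^ k" if "norm x \<le> x0" for x :: complex and k
    unfolding norm_power using that by (intro power_mono) auto
  have H: "(t x y has_sum H x y) Rest" if "norm x \<le> x0" "\<And>j. norm (y j) \<le> Y" for x y
    unfolding H_def
  proof (rule has_sum_infsum)
    have "norm (t x y \<alpha>) \<le> A \<alpha>" for \<alpha>
      unfolding t_def A_def norm_mult mult.assoc
      by (intro mult_left_mono mult_mono x_le y_le that) (use x0 in auto)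
    then have "(\<lambda>\<alpha>. norm (t x y \<alpha>)) summable_on Rest"
      by (intro summable_on_comparison_test[OF A_sm]) auto
    then show "t x y summable_on Rest" by (rule abs_summable_summable)
  qed
  show ?thesis
  proof (rule that[of x0 "S / (2 * Y) + S / x0" H])
    show "0 < x0" by fact
    show "0 \<le> S / (2 * Y) + S / x0" using S_nonneg Y x0 by simp
    have "norm (x ^ w j * y) \<le> r" if "norm x \<le> x0" "norm y \<le> Y" for x y :: complex and j
    proof -
      have "norm (x ^ w j * y) \<le> x0 ^ w j * (2 * Y)"
        unfolding norm_mult using that x_le[OF that(1)] Y x0 by (intro mult_mono) auto
      then show ?thesis using x0Y[of "w j"] wm[of j] m by linarith
    qed
    then show "\<forall>(x :: complex) y j. norm x \<le> x0 \<and> norm y \<le> Y \<longrightarrow> norm (x ^ w j * y) \<le> r"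
      by blast
    have "((\<lambda>\<alpha>. c \<alpha> * (\<Prod>j\<in>UNIV. (x ^ w j * y j) ^ \<alpha> j)) has_sum x ^ (2 * m + 1) * H x y) Rest"
      if "norm x \<le> x0" "\<And>j. norm (y j) \<le> Y" for x y
    proof -
      have "((\<lambda>\<alpha>. x ^ (2 * m + 1) * t x y \<alpha>) has_sum x ^ (2 * m + 1) * H x y) Rest"
        using H[OF that] by (rule has_sum_cmult_right)
      moreover have "x ^ (2 * m + 1) * t x y \<alpha> = c \<alpha> * (\<Prod>j\<in>UNIV. (x ^ w j * y j) ^ \<alpha> j)"
        if "\<alpha> \<in> Rest" for \<alpha>
      proof -
        have "x ^ (2 * m + 1) * x ^ e \<alpha> = x ^ wt \<alpha>"
          unfolding power_add[symmetric] e_def using wt_Rest[OF that] by simp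
        also have "\<dots> = (\<Prod>j\<in>UNIV. (x ^ w j) ^ \<alpha> j)"
          by (simp add: wt_def power_sum power_mult[symmetric] mult.commute)
        finally show ?thesis
          by (simp add: t_def power_mult_distrib prod.distrib mult_ac)
      qed
      ultimately show ?thesis by (subst (asm) has_sum_cong) auto
    qed
    then show "\<forall>x y. norm x \<le> x0 \<and> (\<forall>j. norm (y j) \<le> Y) \<longrightarrow>
        ((\<lambda>\<alpha>. c \<alpha> * (\<Prod>j\<in>UNIV. (x ^ w j * y j) ^ \<alpha> j)) has_sum x ^ (2 * m + 1) * H x y) Rest"
      by blast
    have lip: "norm (H x y - H x y') \<le> (S / (2 * Y) + S / x0) * (\<Sum>j\<in>UNIV. norm (y j - y' j))"
      if x: "norm x \<le> x0" and y: "\<And>j. norm (y j) \<le> Y" and y': "\<And>j. norm (y' j) \<le> Y" for x y y'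
    proof -
      let ?s = "(\<Sum>j\<in>UNIV. norm (y j - y' j)) / (2 * Y)"
      have "norm (H x y - H x y') \<le> ?s * S"
      proof (rule norm_infsum_le)
        show "((\<lambda>\<alpha>. t x y \<alpha> - t x y' \<alpha>) has_sum (H x y - H x y')) Rest"
          by (intro has_sum_minus H x y y')
        show "((\<lambda>\<alpha>. ?s * A \<alpha>) has_sum (?s * S)) Rest" using S by (rule has_sum_cmult_right)
        fix \<alpha>
        have "norm (t x y \<alpha> - t x y' \<alpha>)
            = norm (c \<alpha>) * (norm (x ^ e \<alpha>) * norm ((\<Prod>j\<in>UNIV. y j ^ \<alpha> j) - (\<Prod>j\<in>UNIV. y' j ^ \<alpha> j)))"
          by (simp add: t_def right_diff_distrib[symmetric] norm_mult)
        also have "\<dots> \<le> norm (c \<alpha>) * (x0 ^ e \<alpha> * ((2 * Y) ^ sum \<alpha> UNIV * ?s))"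
          using monomial_diff_le[OF Y y y'] x0
          by (intro mult_left_mono mult_mono x_le x) auto
        also have "\<dots> = ?s * A \<alpha>" by (simp add: A_def)
        finally show "norm (t x y \<alpha> - t x y' \<alpha>) \<le> ?s * A \<alpha>" .
      qed
      also have "\<dots> = S / (2 * Y) * (\<Sum>j\<in>UNIV. norm (y j - y' j))" by simp
      also have "\<dots> \<le> (S / (2 * Y) + S / x0) * (\<Sum>j\<in>UNIV. norm (y j - y' j))"
        using S_nonneg x0 by (intro mult_right_mono sum_nonneg) auto
      finally show ?thesis .
    qed
    have at0: "norm (H x y - H 0 y) \<le> (S / (2 * Y) + S / x0) * norm x"
      if x: "norm x \<le> x0" and y: "\<And>j. norm (y j) \<le> Y" for x y
    proof -
      have "norm (H x y - H 0 y) \<le> norm x / x0 * S"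
      proof (rule norm_infsum_le)
        show "((\<lambda>\<alpha>. t x y \<alpha> - t 0 y \<alpha>) has_sum (H x y - H 0 y)) Rest"
          using x0 by (intro has_sum_minus H x y) auto
        show "((\<lambda>\<alpha>. norm x / x0 * A \<alpha>) has_sum (norm x / x0 * S)) Rest"
          using S by (rule has_sum_cmult_right)
        fix \<alpha>
        have "norm (x ^ e \<alpha> - 0 ^ e \<alpha>) \<le> norm x / x0 * x0 ^ e \<alpha>"
        proof (cases "e \<alpha>")
          case (Suc k)
          then show ?thesis using mult_left_mono[OF x_le[OF x, of k], of "norm x"] x0
            by (simp add: norm_mult)
        qed (use x0 in simp)
        then have "norm (t x y \<alpha> - t 0 y \<alpha>)
            \<le> norm (c \<alpha>) * ((norm x / x0 * x0 ^ e \<alpha>) * (2 * Y) ^ sum \<alpha> UNIV)"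
          unfolding t_def right_diff_distrib[symmetric] left_diff_distrib[symmetric] norm_mult
          by (intro mult_left_mono mult_mono y_le y) (use x0 in auto)
        also have "\<dots> = norm x / x0 * A \<alpha>" by (simp add: A_def)
        finally show "norm (t x y \<alpha> - t 0 y \<alpha>) \<le> norm x / x0 * A \<alpha>" .
      qed
      also have "\<dots> = S / x0 * norm x" by simp
      also have "\<dots> \<le> (S / (2 * Y) + S / x0) * norm x"
        using S_nonneg Y by (intro mult_right_mono) auto
      finally show ?thesis .
    qed
    show "lipschitz_remainder x0 Y (S / (2 * Y) + S / x0) H"
      unfolding lipschitz_remainder_def using lip at0 by blast
  qed
qed

text \<open>In the weighted coordinates the nonlinear part is governed by the single coefficient of the square
  of the \<open>i\<close>-th coordinate.\<close>

lemma quasi_homogeneous_expansion: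
  fixes f :: "complex^'n::finite \<Rightarrow> complex" and w :: "'n \<Rightarrow> nat"
  assumes c: "has_power_series_at f c 0" and der: "(f has_derivative L) (at 0)" and f0: "f 0 = 0"
    and m: "1 \<le> m" and w: "w i = m" "\<And>j. j \<noteq> i \<Longrightarrow> m < w j" and Y: "0 < Y"
  obtains x0 K H where "0 < x0" "0 \<le> K"
    and "\<forall>x y. norm x \<le> x0 \<and> (\<forall>j. norm (y j) \<le> Y) \<longrightarrow>
        f (\<chi> j. x ^ w j * y j) = L (\<chi> j. x ^ w j * y j)
          + x ^ (2 * m) * (c ((\<lambda>_. 0)(i := 2)) * (y i)\<^sup>2 + x * H x y)"
    and "lipschitz_remainder x0 Y K H"
proof -
  obtain r where r: "0 < r" "(\<lambda>\<alpha>. norm (c \<alpha>) * r ^ sum \<alpha> UNIV) summable_on UNIV"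
    and r': "\<forall>z. (\<forall>i. norm (z $ i) \<le> r) \<longrightarrow> ((\<lambda>\<alpha>. c \<alpha> * (\<Prod>i\<in>UNIV. z $ i ^ \<alpha> i)) has_sum f z) UNIV"
    by (rule power_series_abs_summable[OF c]) (rule that; assumption)
  have r3: "((\<lambda>\<alpha>. c \<alpha> * (\<Prod>i\<in>UNIV. z $ i ^ \<alpha> i)) has_sum f z) UNIV"
    if "\<And>i. norm (z $ i) \<le> r" for z
    by (rule r'[rule_format]) (rule that)
  obtain x0 K H where xKH: "0 < x0" "0 \<le> K"
    "\<forall>(x :: complex) y j. norm x \<le> x0 \<and> norm y \<le> Y \<longrightarrow> norm (x ^ w j * y) \<le> r"
    "\<forall>x y. norm x \<le> x0 \<and> (\<forall>j. norm (y j) \<le> Y) \<longrightarrow>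
        ((\<lambda>\<alpha>. c \<alpha> * (\<Prod>j\<in>UNIV. (x ^ w j * y j) ^ \<alpha> j)) has_sum x ^ (2 * m + 1) * H x y)
          {\<alpha>. 2 \<le> sum \<alpha> UNIV \<and> \<alpha> \<noteq> (\<lambda>_. 0)(i := 2)}"
    "lipschitz_remainder x0 Y K H"
    by (rule quasi_homogeneous_remainder[where c = c and w = w and i = i, OF r(1,2) m w Y])
      (assumption, (rule that; assumption))
  show thesis
  proof (rule that[OF xKH(1,2) _ xKH(5)], intro allI impI)
    fix x :: complex and y :: "'n \<Rightarrow> complex"
    assume xy: "norm x \<le> x0 \<and> (\<forall>j. norm (y j) \<le> Y)"
    let ?z = "\<chi> j. x ^ w j * y j" and ?\<alpha> = "(\<lambda>_. 0)(i := 2 :: nat)"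
    let ?g = "\<lambda>\<alpha>. c \<alpha> * (\<Prod>i\<in>UNIV. ?z $ i ^ \<alpha> i)"
    have fz: "(?g has_sum f ?z) UNIV"
    proof (rule r3)
      show "norm (?z $ i) \<le> r" for i using xKH(3)[rule_format, of x "y i" i] xy by simp
    qed
    have "(?g has_sum (f ?z - L ?z)) {\<alpha>. 2 \<le> sum \<alpha> UNIV}"
      using power_series_split_degree_2[where c = c and f = f and z = ?z, OF fz]
        power_series_linear_part(1)[where c = c and f = f, OF r r3 der]
        power_series_linear_part(2)[where c = c and f = f and z = ?z, OF r r3 der] f0 by simp
    moreover have "{\<alpha>. 2 \<le> sum \<alpha> UNIV} = insert ?\<alpha> {\<alpha>. 2 \<le> sum \<alpha> UNIV \<and> \<alpha> \<noteq> ?\<alpha>}"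
    proof -
      have "sum ?\<alpha> UNIV = 2" by (simp add: fun_upd_def)
      then show ?thesis by (intro set_eqI) (case_tac "x = ?\<alpha>"; simp)
    qed
    ultimately have s1: "(?g has_sum (f ?z - L ?z)) (insert ?\<alpha> {\<alpha>. 2 \<le> sum \<alpha> UNIV \<and> \<alpha> \<noteq> ?\<alpha>})"
      by simp
    have s2: "(?g has_sum (?g ?\<alpha> + x ^ (2 * m + 1) * H x y))
        (insert ?\<alpha> {\<alpha>. 2 \<le> sum \<alpha> UNIV \<and> \<alpha> \<noteq> ?\<alpha>})"
    proof (rule has_sum_insert)
      show "(?g has_sum x ^ (2 * m + 1) * H x y) {\<alpha>. 2 \<le> sum \<alpha> UNIV \<and> \<alpha> \<noteq> ?\<alpha>}"
        using xKH(4)[rule_format, OF xy] by simp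
    qed simp
    have "f ?z - L ?z = ?g ?\<alpha> + x ^ (2 * m + 1) * H x y"
      by (rule has_sum_unique[OF s1 s2])
    also have "?g ?\<alpha> = c ?\<alpha> * (x ^ m * y i)\<^sup>2"
      using w(1) by (simp only: prod_power_unit_index) simp
    also have "(x ^ m * y i)\<^sup>2 = x ^ (2 * m) * (y i)\<^sup>2"
      by (simp only: power_mult_distrib power_mult[symmetric] mult.commute[of m 2])
    also have "a * (x ^ (2 * m) * b) + x ^ (2 * m + 1) * h = x ^ (2 * m) * (a * b + x * h)" for a b h
      by (simp add: algebra_simps)
    finally have "f ?z - L ?z = x ^ (2 * m) * (c ?\<alpha> * (y i)\<^sup>2 + x * H x y)" .
    then show "f ?z = L ?z + x ^ (2 * m) * (c ?\<alpha> * (y i)\<^sup>2 + x * H x y)"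
      by (simp only: diff_eq_eq add.commute)
  qed
qed

section \<open>A difference equation solved by contraction\<close>

text \<open>The decrements of a null sequence add up exactly to its first term, so no constant is lost; the
  contraction below has none to spare.\<close>

lemma telescoping_bound:
  fixes h :: "nat \<Rightarrow> complex" and f :: "nat \<Rightarrow> real"
  assumes "f \<longlonglongrightarrow> 0" and "\<And>k. norm (h k) \<le> D * (f k - f (Suc k))"
  shows "summable h" and "norm (suminf h) \<le> D * f 0"
proof -
  have s: "(\<lambda>k. D * (f k - f (Suc k))) sums (D * f 0)"
    using sums_mult[OF telescope_sums'[OF assms(1)], of D] by simp
  show "summable h"
    by (rule summable_comparison_test'[OF sums_summable[OF s], of 0]) (use assms(2) in auto)
  have "norm (suminf h) \<le> (\<Sum>k. D * (f k - f (Suc k)))"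
    by (rule norm_suminf_le) (use assms(2) s in \<open>auto simp: sums_iff\<close>)
  also have "\<dots> = D * f 0" using s by (simp add: sums_iff)
  finally show "norm (suminf h) \<le> D * f 0" .
qed

lemma telescoping_tail_bound:
  fixes h :: "nat \<Rightarrow> complex" and f :: "nat \<Rightarrow> real"
  assumes "f \<longlonglongrightarrow> 0" and "\<And>k. norm (h k) \<le> D * (f k - f (Suc k))"
  shows "norm (suminf h - (\<Sum>k<N. h k)) \<le> D * f N"
proof -
  have "suminf h - (\<Sum>k<N. h k) = (\<Sum>k. h (k + N))"
    using suminf_minus_initial_segment[OF telescoping_bound(1)[OF assms], of N] by simp
  also have "norm \<dots> \<le> D * f (0 + N)"
    by (rule telescoping_bound(2)[of "\<lambda>k. f (k + N)"]) (use assms LIMSEQ_ignore_initial_segment in auto)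
  finally show ?thesis by simp
qed

lemma holomorphic_uniform_limit_on:
  assumes "open V" "\<And>n. f n holomorphic_on V" "uniform_limit V f g sequentially"
  shows "g holomorphic_on V"
proof (rule holomorphic_uniform_sequence[OF assms(1,2)])
  fix x assume "x \<in> V"
  then obtain d where "d > 0" "cball x d \<subseteq> V" using assms(1) open_contains_cball by blast
  then show "\<exists>d>0. cball x d \<subseteq> V \<and> uniform_limit (cball x d) f g sequentially"
    using assms(3) uniform_limit_on_subset by blast
qed

text \<open>Solutions of \<open>\<phi> (t + 1) = F (\<phi> t)\<close> near \<open>\<psi>\<close> are the fixed points of
  \<open>(T \<phi>) t = \<psi> t - (\<Sum>k. h \<phi> (t + k))\<close>, where \<open>h \<phi> t\<close> is the difference of the increments
  \<open>F (\<phi> t) - \<phi> t\<close> and \<open>\<psi> (t + 1) - \<psi> t\<close>. Both hypotheses on the increments are measured against the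
  decrement of the weight \<open>\<omega>\<close>, so that the sums telescope: \<open>T\<close> preserves the neighbourhood of \<open>\<psi>\<close> of
  radius \<open>\<omega>\<close> and contracts it by the factor \<open>\<theta>\<close>.\<close>

lemma difference_equation_solution:
  fixes F :: "complex^'n::finite \<Rightarrow> complex^'n" and \<psi> :: "complex \<Rightarrow> complex^'n"
    and \<omega> :: "complex \<Rightarrow> 'n \<Rightarrow> real"
  assumes V: "open V" "\<And>t. t \<in> V \<Longrightarrow> t + 1 \<in> V"
    and \<theta>: "0 \<le> \<theta>" "\<theta> < 1"
    and hol: "\<And>i. (\<lambda>t. \<psi> t $ i) holomorphic_on V"
    and \<omega>0: "\<And>i. uniform_limit V (\<lambda>k t. \<omega> (t + of_nat k) i) (\<lambda>_. 0) sequentially"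
    and \<omega>B: "\<And>i. bdd_above ((\<lambda>t. \<omega> t i) ` V)"
    and F_hol: "\<And>\<phi> i. \<lbrakk>\<And>j. (\<lambda>t. \<phi> t $ j) holomorphic_on V;
        \<And>t j. t \<in> V \<Longrightarrow> norm (\<phi> t $ j - \<psi> t $ j) \<le> \<omega> t j\<rbrakk> \<Longrightarrow> (\<lambda>t. F (\<phi> t) $ i) holomorphic_on V"
    and lip: "\<And>t z w D i. \<lbrakk>t \<in> V; \<And>j. norm (z $ j - \<psi> t $ j) \<le> \<omega> t j;
        \<And>j. norm (w $ j - \<psi> t $ j) \<le> \<omega> t j; \<And>j. norm (z $ j - w $ j) \<le> D * \<omega> t j\<rbrakk> \<Longrightarrow>
        norm ((F z - z) $ i - (F w - w) $ i) \<le> \<theta> * D * (\<omega> t i - \<omega> (t + 1) i)"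
    and res: "\<And>t i. t \<in> V \<Longrightarrow>
        norm (F (\<psi> t) $ i - \<psi> (t + 1) $ i) \<le> (1 - \<theta>) * (\<omega> t i - \<omega> (t + 1) i)"
  obtains \<phi> where "\<And>i. (\<lambda>t. \<phi> t $ i) holomorphic_on V"
    and "\<And>t i. t \<in> V \<Longrightarrow> norm (\<phi> t $ i - \<psi> t $ i) \<le> \<omega> t i"
    and "\<And>t. t \<in> V \<Longrightarrow> \<phi> (t + 1) = F (\<phi> t)"
proof -
  have Vn: "t + of_nat k \<in> V" if "t \<in> V" for t k
  proof (induction k)
    case (Suc k)
    then have "t + of_nat k + 1 \<in> V" by (rule V)
    then show ?case by (simp add: add_ac)
  qed (use that in simp)
  have lim: "(\<lambda>k. \<omega> (t + of_nat k) i) \<longlonglongrightarrow> 0" if "t \<in> V" for t i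
    using tendsto_uniform_limitI[OF \<omega>0 that] by simp
  have dec: "\<omega> (t + 1) i \<le> \<omega> t i" if "t \<in> V" for t i
  proof -
    have "0 \<le> (1 - \<theta>) * (\<omega> t i - \<omega> (t + 1) i)" using order_trans[OF norm_ge_zero res[OF that]] .
    then show ?thesis using \<theta> by (simp add: zero_le_mult_iff)
  qed
  have nonneg: "0 \<le> \<omega> t i" if "t \<in> V" for t i
  proof (rule decseq_ge[OF _ lim[OF that], of i 0, simplified])
    show "decseq (\<lambda>k. \<omega> (t + of_nat k) i)"
      by (rule decseq_SucI) (use dec[OF Vn[OF that]] in \<open>simp add: add_ac\<close>)
  qed
  define box where "box \<phi> \<longleftrightarrow> (\<forall>i. (\<lambda>t. \<phi> t $ i) holomorphic_on V) \<and>
      (\<forall>t\<in>V. \<forall>i. norm (\<phi> t $ i - \<psi> t $ i) \<le> \<omega> t i)" for \<phi> :: "complex \<Rightarrow> complex^'n"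
  define h where "h \<phi> t i = (F (\<phi> t) - \<phi> t) $ i - (\<psi> (t + 1) - \<psi> t) $ i" for \<phi> t i
  define T where "T \<phi> = (\<lambda>t. \<chi> i. \<psi> t $ i - (\<Sum>k. h \<phi> (t + of_nat k) i))" for \<phi>
  have h_bound: "norm (h \<phi> (t + of_nat k) i)
      \<le> 1 * (\<omega> (t + of_nat k) i - \<omega> (t + of_nat (Suc k)) i)" if "box \<phi>" "t \<in> V" for \<phi> t k i
  proof -
    let ?s = "t + of_nat k"
    have s: "?s \<in> V" using Vn that by blast
    have "norm ((F (\<phi> ?s) - \<phi> ?s) $ i - (F (\<psi> ?s) - \<psi> ?s) $ i) \<le> \<theta> * 1 * (\<omega> ?s i - \<omega> (?s + 1) i)"
      by (rule lip[OF s]) (use that s nonneg in \<open>auto simp: box_def\<close>)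
    moreover have "h \<phi> ?s i = ((F (\<phi> ?s) - \<phi> ?s) $ i - (F (\<psi> ?s) - \<psi> ?s) $ i)
        + (F (\<psi> ?s) $ i - \<psi> (?s + 1) $ i)" by (simp add: h_def)
    ultimately have "norm (h \<phi> ?s i) \<le> \<theta> * 1 * (\<omega> ?s i - \<omega> (?s + 1) i)
        + (1 - \<theta>) * (\<omega> ?s i - \<omega> (?s + 1) i)"
      using norm_triangle_le[OF add_mono[OF _ res[OF s]]] by metis
    also have "\<dots> = 1 * (\<omega> ?s i - \<omega> (?s + 1) i)" by (simp add: algebra_simps)
    finally show ?thesis by (simp add: add_ac)
  qed
  have T_eq: "T \<phi> (t + 1) $ i - T \<phi> t $ i = (F (\<phi> t) - \<phi> t) $ i" if "box \<phi>" "t \<in> V" for \<phi> t i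
  proof -
    have "summable (\<lambda>k. h \<phi> (t + of_nat k) i)"
      by (rule telescoping_bound(1)[OF lim h_bound]) (use that in auto)
    from suminf_split_head[OF this]
    have "(\<Sum>k. h \<phi> (t + 1 + of_nat k) i) = (\<Sum>k. h \<phi> (t + of_nat k) i) - h \<phi> t i"
      by (simp add: add_ac)
    then show ?thesis by (simp add: T_def h_def)
  qed
  have T_box: "box (T \<phi>)" if "box \<phi>" for \<phi>
    unfolding box_def
  proof (intro conjI allI ballI)
    fix t i assume t: "t \<in> V"
    have "norm (\<Sum>k. h \<phi> (t + of_nat k) i) \<le> 1 * \<omega> (t + of_nat 0) i"
      by (rule telescoping_bound(2)[OF lim h_bound]) (use that t in auto)
    then show "norm (T \<phi> t $ i - \<psi> t $ i) \<le> \<omega> t i" by (simp add: T_def)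
  next
    fix i
    have F\<phi>: "(\<lambda>t. F (\<phi> t) $ i) holomorphic_on V"
      by (rule F_hol) (use that in \<open>auto simp: box_def\<close>)
    have shift: "(\<lambda>t. g (t + of_nat k)) holomorphic_on V" if "g holomorphic_on V" for g and k
      by (rule holomorphic_on_compose_gen[OF _ that, of "\<lambda>t. t + of_nat k" V, unfolded o_def])
        (use Vn in \<open>auto intro!: holomorphic_intros\<close>)
    have h_hol: "(\<lambda>t. h \<phi> t i) holomorphic_on V"
      unfolding h_def vector_minus_component
      using F\<phi> hol shift[OF hol, of 1] that by (auto intro!: holomorphic_intros simp: box_def)
    have "(\<lambda>t. \<Sum>k. h \<phi> (t + of_nat k) i) holomorphic_on V"
    proof (rule holomorphic_uniform_limit_on[OF V(1)])
      show "(\<lambda>t. \<Sum>k<n. h \<phi> (t + of_nat k) i) holomorphic_on V" for n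
        by (intro holomorphic_intros shift[OF h_hol])
      show "uniform_limit V (\<lambda>n t. \<Sum>k<n. h \<phi> (t + of_nat k) i)
          (\<lambda>t. \<Sum>k. h \<phi> (t + of_nat k) i) sequentially"
      proof (rule uniform_limitI)
        fix e :: real assume "e > 0"
        from uniform_limitD[OF \<omega>0[of i] this]
        show "\<forall>\<^sub>F n in sequentially. \<forall>t\<in>V. dist (\<Sum>k<n. h \<phi> (t + of_nat k) i)
            (\<Sum>k. h \<phi> (t + of_nat k) i) < e"
        proof eventually_elim
          case (elim n)
          show ?case
          proof
            fix t assume t: "t \<in> V"
            have "dist (\<Sum>k<n. h \<phi> (t + of_nat k) i) (\<Sum>k. h \<phi> (t + of_nat k) i)
                = norm ((\<Sum>k. h \<phi> (t + of_nat k) i) - (\<Sum>k<n. h \<phi> (t + of_nat k) i))"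
              by (simp add: dist_norm norm_minus_commute)
            also have "\<dots> \<le> 1 * \<omega> (t + of_nat n) i"
              by (rule telescoping_tail_bound[OF lim h_bound]) (use that t in auto)
            also have "\<dots> < e" using bspec[OF elim t] by (simp add: dist_norm)
            finally show "dist (\<Sum>k<n. h \<phi> (t + of_nat k) i) (\<Sum>k. h \<phi> (t + of_nat k) i) < e" .
          qed
        qed
      qed
    qed
    then show "(\<lambda>t. T \<phi> t $ i) holomorphic_on V"
      unfolding T_def by (auto intro!: holomorphic_intros hol)
  qed
  have T_lip: "norm (T \<phi> t $ i - T \<phi>' t $ i) \<le> \<theta> * D * \<omega> t i"
    if "box \<phi>" "box \<phi>'" "t \<in> V" "\<And>t j. t \<in> V \<Longrightarrow> norm (\<phi> t $ j - \<phi>' t $ j) \<le> D * \<omega> t j" for \<phi> \<phi>' t i D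
  proof -
    have sm: "summable (\<lambda>k. h \<phi> (t + of_nat k) i)" "summable (\<lambda>k. h \<phi>' (t + of_nat k) i)"
      by (rule telescoping_bound(1)[OF lim h_bound]; use that in auto)+
    have "norm (\<Sum>k. h \<phi> (t + of_nat k) i - h \<phi>' (t + of_nat k) i) \<le> \<theta> * D * \<omega> (t + of_nat 0) i"
    proof (rule telescoping_bound(2)[OF lim[OF that(3)]])
      fix k
      have "t + of_nat k \<in> V" using Vn that by blast
      from lip[OF this, of "\<phi> (t + of_nat k)" "\<phi>' (t + of_nat k)" D i]
      show "norm (h \<phi> (t + of_nat k) i - h \<phi>' (t + of_nat k) i)
          \<le> \<theta> * D * (\<omega> (t + of_nat k) i - \<omega> (t + of_nat (Suc k)) i)"
        using that \<open>t + of_nat k \<in> V\<close> by (auto simp: box_def h_def algebra_simps)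
    qed
    also have "(\<Sum>k. h \<phi> (t + of_nat k) i - h \<phi>' (t + of_nat k) i)
        = (\<Sum>k. h \<phi> (t + of_nat k) i) - (\<Sum>k. h \<phi>' (t + of_nat k) i)"
      using suminf_diff[OF sm] by simp
    finally show ?thesis by (simp add: T_def norm_minus_commute)
  qed
  define \<Phi> where "\<Phi> k = (T ^^ k) \<psi>" for k
  have \<Phi>_Suc: "\<Phi> (Suc k) = T (\<Phi> k)" for k by (simp add: \<Phi>_def)
  have \<Phi>_box: "box (\<Phi> k)" for k
    by (induction k) (use T_box nonneg hol in \<open>auto simp: \<Phi>_Suc\<close>, auto simp: \<Phi>_def box_def)
  have step: "norm (\<Phi> (Suc k) t $ i - \<Phi> k t $ i) \<le> \<theta> ^ k * \<omega> t i" if "t \<in> V" for k t i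
    using that
  proof (induction k arbitrary: t i)
    case 0
    then show ?case using T_box[of \<psi>] \<Phi>_box[of 0] by (auto simp: \<Phi>_def box_def)
  next
    case (Suc k)
    then show ?case
      using T_lip[OF \<Phi>_box[of "Suc k"] \<Phi>_box[of k] Suc.prems, of "\<theta> ^ k" i] by (simp add: \<Phi>_Suc)
  qed
  define \<phi> where "\<phi> t = (\<chi> i. \<psi> t $ i + (\<Sum>k. \<Phi> (Suc k) t $ i - \<Phi> k t $ i))" for t
  have close: "norm (\<phi> t $ i - \<Phi> n t $ i) \<le> \<omega> t i / (1 - \<theta>) * \<theta> ^ n" if t: "t \<in> V" for t i n
  proof -
    have "\<phi> t $ i - \<Phi> n t $ i = (\<Sum>k. \<Phi> (Suc k) t $ i - \<Phi> k t $ i) - (\<Sum>k<n. \<Phi> (Suc k) t $ i - \<Phi> k t $ i)"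
      unfolding sum_lessThan_telescope[of "\<lambda>k. \<Phi> k t $ i"] by (simp add: \<phi>_def, simp add: \<Phi>_def)
    also have "norm \<dots> \<le> \<omega> t i / (1 - \<theta>) * \<theta> ^ n"
    proof (rule telescoping_tail_bound)
      show "(\<lambda>n. \<theta> ^ n) \<longlonglongrightarrow> 0" using \<theta> by (intro LIMSEQ_realpow_zero) auto
      fix k
      have "\<omega> t i / (1 - \<theta>) * (\<theta> ^ k - \<theta> ^ Suc k) = \<theta> ^ k * \<omega> t i"
        using \<theta> by (simp add: field_simps)
      then show "norm (\<Phi> (Suc k) t $ i - \<Phi> k t $ i) \<le> \<omega> t i / (1 - \<theta>) * (\<theta> ^ k - \<theta> ^ Suc k)"
        using step[OF t, of k i] by simp
    qed
    finally show ?thesis .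
  qed
  have pow0: "(\<lambda>n. c * \<theta> ^ n) \<longlonglongrightarrow> 0" for c
    using LIMSEQ_realpow_zero[OF \<theta>] by (rule tendsto_mult_right_zero)
  have \<phi>_lim: "(\<lambda>n. \<Phi> n t $ i) \<longlonglongrightarrow> \<phi> t $ i" if "t \<in> V" for t i
  proof (rule Lim_null[THEN iffD2], rule Lim_null_comparison[OF _ pow0])
    show "\<forall>\<^sub>F n in sequentially. norm (\<Phi> n t $ i - \<phi> t $ i) \<le> \<omega> t i / (1 - \<theta>) * \<theta> ^ n"
      using close[OF that] by (auto simp: norm_minus_commute)
  qed
  have \<phi>_box: "box \<phi>"
    unfolding box_def
  proof (intro conjI allI ballI)
    fix t i assume t: "t \<in> V"
    show "norm (\<phi> t $ i - \<psi> t $ i) \<le> \<omega> t i"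
      by (rule Lim_bounded[where M = 0, OF tendsto_norm[OF tendsto_diff[OF \<phi>_lim[OF t] tendsto_const]]])
        (use \<Phi>_box t in \<open>auto simp: box_def\<close>)
  next
    fix i
    obtain W where W: "\<And>t. t \<in> V \<Longrightarrow> \<omega> t i \<le> W" using \<omega>B[of i] by (auto simp: bdd_above_def)
    show "(\<lambda>t. \<phi> t $ i) holomorphic_on V"
    proof (rule holomorphic_uniform_limit_on[OF V(1)])
      show "(\<lambda>t. \<Phi> n t $ i) holomorphic_on V" for n using \<Phi>_box by (auto simp: box_def)
      show "uniform_limit V (\<lambda>n t. \<Phi> n t $ i) (\<lambda>t. \<phi> t $ i) sequentially"
      proof (rule uniform_limitI)
        fix e :: real assume "e > 0"
        from order_tendstoD(2)[OF pow0[of "W / (1 - \<theta>)"] this]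
        show "\<forall>\<^sub>F n in sequentially. \<forall>t\<in>V. dist (\<Phi> n t $ i) (\<phi> t $ i) < e"
        proof eventually_elim
          case (elim n)
          show ?case
          proof
            fix t assume t: "t \<in> V"
            have "dist (\<Phi> n t $ i) (\<phi> t $ i) \<le> \<omega> t i / (1 - \<theta>) * \<theta> ^ n"
              using close[OF t] by (simp add: dist_norm norm_minus_commute)
            also have "\<dots> \<le> W / (1 - \<theta>) * \<theta> ^ n"
              using W[OF t] \<theta> by (intro mult_right_mono divide_right_mono) auto
            finally show "dist (\<Phi> n t $ i) (\<phi> t $ i) < e" using elim by simp
          qed
        qed
      qed
    qed
  qed
  have fix_pt: "T \<phi> t $ i = \<phi> t $ i" if t: "t \<in> V" for t i
  proof (rule LIMSEQ_unique)
    show "(\<lambda>n. \<Phi> (Suc n) t $ i) \<longlonglongrightarrow> \<phi> t $ i" using \<phi>_lim[OF t] by (rule LIMSEQ_Suc)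
    show "(\<lambda>n. \<Phi> (Suc n) t $ i) \<longlonglongrightarrow> T \<phi> t $ i"
    proof (rule Lim_null[THEN iffD2], rule Lim_null_comparison[OF always_eventually pow0], rule allI)
      fix n
      have "norm (T \<phi> t $ i - T (\<Phi> n) t $ i) \<le> \<theta> * (\<theta> ^ n / (1 - \<theta>)) * \<omega> t i"
        by (rule T_lip[OF \<phi>_box \<Phi>_box t]) (use close in \<open>simp add: field_simps\<close>)
      then show "norm (\<Phi> (Suc n) t $ i - T \<phi> t $ i) \<le> \<theta> * \<omega> t i / (1 - \<theta>) * \<theta> ^ n"
        by (simp add: \<Phi>_Suc norm_minus_commute field_simps)
    qed
  qed
  show ?thesis
  proof (rule that)
    show "\<phi> (t + 1) = F (\<phi> t)" if "t \<in> V" for t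
    proof (rule vec_eq_iff[THEN iffD2], rule allI)
      fix i
      show "\<phi> (t + 1) $ i = F (\<phi> t) $ i"
        using T_eq[OF \<phi>_box that, of i] fix_pt[OF that, of i] fix_pt[OF V(2)[OF that], of i] by simp
    qed
  qed (use \<phi>_box in \<open>auto simp: box_def\<close>)
qed

section \<open>Asymptotics in half-strips\<close>

text \<open>The filter of \<open>Re t \<rightarrow> \<infinity>\<close> in a strip. In a strip \<open>t\<close> and \<open>Re t\<close> are asymptotically equal, so that the
  complex estimates have the same constants as the real ones.\<close>

definition strip_at_top :: "complex filter" where
  "strip_at_top = inf (filtercomap Re at_top) (principal {t. \<bar>Im t\<bar> < 2})"

lemma eventually_strip_at_top:
  "eventually P strip_at_top \<longleftrightarrow> (\<exists>R. \<forall>t. R \<le> Re t \<and> \<bar>Im t\<bar> < 2 \<longrightarrow> P t)"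
  unfolding strip_at_top_def eventually_inf_principal eventually_filtercomap_at_top_linorder
  by auto

lemma filterlim_Re_strip: "filterlim Re at_top strip_at_top"
  unfolding strip_at_top_def by (rule filterlim_mono[OF filterlim_filtercomap order.refl inf_le1])

lemma eventually_strip_Re_ge: "eventually (\<lambda>t. R \<le> Re t \<and> \<bar>Im t\<bar> < 2) strip_at_top"
  unfolding eventually_strip_at_top by blast

lemma filterlim_norm_strip: "filterlim (norm :: complex \<Rightarrow> real) at_top strip_at_top"
  by (rule filterlim_at_top_mono[OF filterlim_Re_strip]) (simp add: complex_Re_le_cmod)

lemma filterlim_strip_at_top_iff:
  "filterlim f strip_at_top F \<longleftrightarrow> filterlim (\<lambda>x. Re (f x)) at_top F \<and> (\<forall>\<^sub>F x in F. \<bar>Im (f x)\<bar> < 2)"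
  unfolding strip_at_top_def filterlim_inf filterlim_principal
  by (simp add: filterlim_filtercomap_iff o_def)

lemma filterlim_add_nat_strip:
  assumes "\<bar>Im t\<bar> < 2"
  shows "filterlim (\<lambda>k. t + of_nat k) strip_at_top sequentially"
  unfolding filterlim_strip_at_top_iff
  using assms filterlim_tendsto_add_at_top[OF tendsto_const filterlim_real_sequentially, of "Re t"]
  by simp

lemma tendsto_0_bigo:
  fixes f :: "_ \<Rightarrow> 'b::real_normed_field"
  assumes "f \<in> O[F](g)" "(g \<longlongrightarrow> 0) F"
  shows "(f \<longlongrightarrow> 0) F"
proof -
  obtain c where "\<forall>\<^sub>F x in F. norm (f x) \<le> c * norm (g x)" using assms(1) by (rule landau_o.bigE)
  moreover have "((\<lambda>x. c * norm (g x)) \<longlongrightarrow> 0) F"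
    using tendsto_mult_right_zero[OF tendsto_norm_zero[OF assms(2)]] .
  ultimately show ?thesis by (rule Lim_null_comparison)
qed

lemma bigo_1_if_tendsto:
  fixes f :: "_ \<Rightarrow> 'b::real_normed_field"
  assumes "(f \<longlongrightarrow> c) F"
  shows "f \<in> O[F](\<lambda>_. 1)"
proof (rule landau_o.bigI)
  show "norm c + 1 > 0" by (simp add: add_nonneg_pos)
  have "\<forall>\<^sub>F x in F. norm (f x) < norm c + 1"
    using order_tendstoD(2)[OF tendsto_norm[OF assms]] by simp
  then show "\<forall>\<^sub>F x in F. norm (f x) \<le> (norm c + 1) * norm (1 :: 'b)"
    by eventually_elim simp
qed

text \<open>A convenient scale between \<open>1\<close> and \<open>Ln t / t\<close>: errors with a logarithm are absorbed into it.\<close>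

definition sqrt_decay :: "complex \<Rightarrow> complex" where
  "sqrt_decay t = of_real (Re t powr (- 1 / 2))"

lemma tendsto_sqrt_decay: "(sqrt_decay \<longlongrightarrow> 0) strip_at_top"
proof -
  have "((\<lambda>s::real. s powr (- 1 / 2)) \<longlongrightarrow> 0) at_top" by real_asymp
  from tendsto_of_real[OF filterlim_compose[OF this filterlim_Re_strip]]
  show ?thesis unfolding sqrt_decay_def by simp
qed

lemma Ln_diff_eq:
  assumes "0 < Re a" "0 < Re b"
  shows "Ln (a / b) = Ln a - Ln b"
proof (rule Ln_unique)
  have "a \<noteq> 0" "b \<noteq> 0" using assms by auto
  then show "exp (Ln a - Ln b) = a / b" by (simp add: exp_diff)
  show "- pi < Im (Ln a - Ln b)" "Im (Ln a - Ln b) \<le> pi"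
    using Re_Ln_pos_lt_imp[OF assms(1)] Re_Ln_pos_lt_imp[OF assms(2)] by (auto simp: abs_less_iff)
qed

lemma norm_Ln_le_ln_norm:
  assumes "z \<noteq> 0"
  shows "norm (Ln z) \<le> \<bar>ln (norm z)\<bar> + pi"
proof -
  have "norm (Ln z) \<le> \<bar>Re (Ln z)\<bar> + \<bar>Im (Ln z)\<bar>" by (rule cmod_le)
  moreover have "\<bar>Im (Ln z)\<bar> \<le> pi"
    using mpi_less_Im_Ln[OF assms] Im_Ln_le_pi[OF assms] by (simp add: abs_le_iff)
  ultimately show ?thesis using assms by simp
qed

text \<open>The argument of \<open>Ln\<close> is bounded, so only the real logarithm of the modulus counts.\<close>

lemma Ln_over_self_bigo: "(\<lambda>t. Ln t / t) \<in> O[strip_at_top](sqrt_decay)"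
proof (rule bigoI[of _ 1])
  have "\<forall>\<^sub>F s::real in at_top. (\<bar>ln s\<bar> + pi) / s \<le> s powr (- 1 / 2)" by real_asymp
  from eventually_compose_filterlim[OF this filterlim_norm_strip] eventually_strip_Re_ge[of 1]
  show "\<forall>\<^sub>F t in strip_at_top. norm (Ln t / t) \<le> 1 * norm (sqrt_decay t)"
  proof eventually_elim
    case (elim t)
    then have "t \<noteq> 0" by auto
    have "norm (Ln t / t) \<le> (\<bar>ln (norm t)\<bar> + pi) / norm t"
      using norm_Ln_le_ln_norm[OF \<open>t \<noteq> 0\<close>] by (simp add: norm_divide divide_right_mono)
    also have "\<dots> \<le> norm t powr (- 1 / 2)" using elim by simp
    also have "\<dots> \<le> Re t powr (- 1 / 2)"
      using elim complex_Re_le_cmod[of t] by (intro powr_mono2') auto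
    finally show ?case by (simp add: sqrt_decay_def)
  qed
qed

lemma tendsto_self_over_Re: "((\<lambda>t. t / of_real (Re t)) \<longlongrightarrow> 1) strip_at_top"
proof -
  have "((\<lambda>t. norm (t / of_real (Re t) - 1)) \<longlongrightarrow> 0) strip_at_top"
  proof (rule tendsto_sandwich[OF _ _ tendsto_const])
    have "((\<lambda>s::real. 2 / s) \<longlongrightarrow> 0) at_top" by real_asymp
    from filterlim_compose[OF this filterlim_Re_strip]
    show "((\<lambda>t. 2 / Re t) \<longlongrightarrow> 0) strip_at_top" .
    show "\<forall>\<^sub>F t in strip_at_top. norm (t / of_real (Re t) - 1) \<le> 2 / Re t"
      using eventually_strip_Re_ge[of 1]
    proof eventually_elim
      case (elim t)
      then have "t / of_real (Re t) - 1 = \<i> * of_real (Im t) / of_real (Re t)"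
        by (auto simp: field_simps complex_eq_iff)
      then show ?case using elim by (simp add: norm_divide norm_mult divide_right_mono)
    qed
  qed auto
  then show ?thesis by (simp add: tendsto_norm_zero_iff Lim_null[symmetric])
qed

text \<open>The corrected time in which the curve has an expansion without logarithms.\<close>

definition log_time :: "complex \<Rightarrow> complex \<Rightarrow> complex" where
  "log_time \<alpha> t = t + \<alpha> * Ln t"

lemma log_time_over_self: "((\<lambda>t. log_time \<alpha> t / t) \<longlongrightarrow> 1) strip_at_top"
proof -
  have "((\<lambda>t. Ln t / t) \<longlongrightarrow> 0) strip_at_top"
    by (rule tendsto_0_bigo[OF Ln_over_self_bigo tendsto_sqrt_decay])
  then have "((\<lambda>t. 1 + \<alpha> * (Ln t / t)) \<longlongrightarrow> 1 + \<alpha> * 0) strip_at_top"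
    by (intro tendsto_intros)
  moreover have "\<forall>\<^sub>F t in strip_at_top. 1 + \<alpha> * (Ln t / t) = log_time \<alpha> t / t"
    using eventually_strip_Re_ge[of 1] by eventually_elim (auto simp: log_time_def add_divide_distrib)
  ultimately show ?thesis using Lim_transform_eventually by fastforce
qed

lemma log_time_over_Re: "((\<lambda>t. log_time \<alpha> t / of_real (Re t)) \<longlongrightarrow> 1) strip_at_top"
proof -
  have "((\<lambda>t. log_time \<alpha> t / t * (t / of_real (Re t))) \<longlongrightarrow> 1 * 1) strip_at_top"
    by (intro tendsto_mult log_time_over_self tendsto_self_over_Re)
  moreover have "\<forall>\<^sub>F t in strip_at_top. log_time \<alpha> t / t * (t / of_real (Re t)) = log_time \<alpha> t / of_real (Re t)"
    using eventually_strip_Re_ge[of 1] by eventually_elim auto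
  ultimately show ?thesis using Lim_transform_eventually by fastforce
qed

lemma eventually_log_time_nonzero: "\<forall>\<^sub>F t in strip_at_top. log_time \<alpha> t \<noteq> 0"
  using tendsto_imp_eventually_ne[OF log_time_over_self[of \<alpha>] one_neq_zero] by eventually_elim auto

definition small_time :: "complex \<Rightarrow> complex \<Rightarrow> complex" where
  "small_time \<alpha> t = 1 / log_time \<alpha> t"

lemma small_time_times_Re: "((\<lambda>t. small_time \<alpha> t * of_real (Re t)) \<longlongrightarrow> 1) strip_at_top"
  using tendsto_inverse[OF log_time_over_Re[of \<alpha>]] by (simp add: small_time_def field_simps)

lemma small_time_bigo_sqrt_decay: "small_time \<alpha> \<in> O[strip_at_top](sqrt_decay)"
proof -
  have "(\<lambda>t. small_time \<alpha> t * of_real (Re t) * sqrt_decay t) \<in> O[strip_at_top](\<lambda>t. 1 * sqrt_decay t)"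
    by (intro landau_o.big.mult bigo_1_if_tendsto[OF small_time_times_Re]) simp
  moreover have "small_time \<alpha> \<in> O[strip_at_top](\<lambda>t. small_time \<alpha> t * of_real (Re t) * sqrt_decay t)"
  proof (rule bigoI[of _ 1])
    show "\<forall>\<^sub>F t in strip_at_top. norm (small_time \<alpha> t) \<le> 1 * norm (small_time \<alpha> t * of_real (Re t) * sqrt_decay t)"
      using eventually_strip_Re_ge[of 1]
    proof eventually_elim
      case (elim t)
      have "Re t * Re t powr (- 1 / 2) = Re t powr (1 / 2)"
        using elim powr_add[of "Re t" 1 "- 1 / 2"] by simp
      also have "\<dots> \<ge> 1" using elim by (intro ge_one_powr_ge_zero) auto
      finally have "1 \<le> Re t * Re t powr (- 1 / 2)" .
      from mult_left_mono[OF this norm_ge_zero[of "small_time \<alpha> t"]] elim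
      show ?case by (simp add: norm_mult sqrt_decay_def mult.assoc)
    qed
  qed
  ultimately show ?thesis using landau_o.big_trans by fastforce
qed

lemma tendsto_small_time: "(small_time \<alpha> \<longlongrightarrow> 0) strip_at_top"
  by (rule tendsto_0_bigo[OF small_time_bigo_sqrt_decay tendsto_sqrt_decay])

lemma inverse_self_minus_small_time:
  "(\<lambda>t. 1 / t - small_time \<alpha> t) \<in> O[strip_at_top](\<lambda>t. small_time \<alpha> t * sqrt_decay t)"
proof -
  have "(\<lambda>t. Ln t / t * small_time \<alpha> t) \<in> O[strip_at_top](\<lambda>t. small_time \<alpha> t * sqrt_decay t)"
    using landau_o.big.mult[OF Ln_over_self_bigo landau_o.big_refl[of "small_time \<alpha>"]]
    by (simp add: mult_ac)
  from landau_o.big.mult[OF bigo_1_if_tendsto[OF tendsto_const[of \<alpha>]] this]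
  have "(\<lambda>t. \<alpha> * (Ln t / t * small_time \<alpha> t)) \<in> O[strip_at_top](\<lambda>t. small_time \<alpha> t * sqrt_decay t)"
    by (simp only: mult_1)
  moreover have "\<forall>\<^sub>F t in strip_at_top. \<alpha> * (Ln t / t * small_time \<alpha> t) = 1 / t - small_time \<alpha> t"
    using eventually_strip_Re_ge[of 1] eventually_log_time_nonzero[of \<alpha>]
    by eventually_elim (auto simp: small_time_def log_time_def divide_simps)
  ultimately show ?thesis by (rule landau_o.big.in_cong[THEN iffD1, rotated])
qed

lemma inverse_self_bigo_small_time: "(\<lambda>t. 1 / t) \<in> O[strip_at_top](small_time \<alpha>)"
proof -
  have "(\<lambda>t. log_time \<alpha> t / t * small_time \<alpha> t) \<in> O[strip_at_top](\<lambda>t. 1 * small_time \<alpha> t)"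
    by (intro landau_o.big.mult bigo_1_if_tendsto[OF log_time_over_self]) simp
  then have "(\<lambda>t. log_time \<alpha> t / t * small_time \<alpha> t) \<in> O[strip_at_top](small_time \<alpha>)"
    by (simp only: mult_1)
  moreover have "\<forall>\<^sub>F t in strip_at_top. log_time \<alpha> t / t * small_time \<alpha> t = 1 / t"
    using eventually_log_time_nonzero[of \<alpha>] by eventually_elim (auto simp: small_time_def)
  ultimately show ?thesis by (rule landau_o.big.in_cong[THEN iffD1, rotated])
qed

lemma Ln_step:
  "(\<lambda>t. Ln (t + 1) - Ln t - 1 / t) \<in> O[strip_at_top](\<lambda>t. small_time \<alpha> t * sqrt_decay t)"
proof -
  have "(\<lambda>t. Ln (t + 1) - Ln t - 1 / t) \<in> O[strip_at_top](\<lambda>t. 1 / t * (1 / t))"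
  proof (rule bigoI[of _ 2])
    show "\<forall>\<^sub>F t in strip_at_top. norm (Ln (t + 1) - Ln t - 1 / t) \<le> 2 * norm (1 / t * (1 / t))"
      using eventually_strip_Re_ge[of 2]
    proof eventually_elim
      case (elim t)
      have "2 \<le> norm t" using elim complex_Re_le_cmod[of t] by linarith
      then have "t \<noteq> 0" and half: "norm (1 / t) \<le> 1 / 2"
        using frac_le[of 1 1 2 "norm t"] by (auto simp: norm_divide)
      have "Ln (t + 1) - Ln t = Ln (1 + 1 / t)"
        using Ln_diff_eq[of "t + 1" t] elim \<open>t \<noteq> 0\<close> by (simp add: add_divide_distrib add.commute)
      then have "norm (Ln (t + 1) - Ln t - 1 / t) \<le> norm (1 / t) ^ 2 / (1 - norm (1 / t))"
        using Ln_approx_linear[of "1 / t"] half by simp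
      also have "\<dots> \<le> norm (1 / t) ^ 2 / (1 / 2)"
        using half by (intro divide_left_mono) auto
      finally show ?case by (simp add: norm_mult norm_divide power2_eq_square)
    qed
  qed
  also have "(\<lambda>t. 1 / t * (1 / t)) \<in> O[strip_at_top](\<lambda>t. small_time \<alpha> t * sqrt_decay t)"
    by (intro landau_o.big.mult inverse_self_bigo_small_time
        landau_o.big_trans[OF inverse_self_bigo_small_time small_time_bigo_sqrt_decay])
  finally show ?thesis .
qed

text \<open>One step adds \<open>1 + \<alpha> / u\<close> to the corrected time, up to smaller terms; the coefficient \<open>\<alpha>\<close> enters
  the expansion of the curve through this step alone.\<close>

lemma log_time_step:
  "(\<lambda>t. log_time \<alpha> (t + 1) - log_time \<alpha> t - 1 - \<alpha> * small_time \<alpha> t)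
     \<in> O[strip_at_top](\<lambda>t. small_time \<alpha> t * sqrt_decay t)"
proof -
  have "(\<lambda>t. \<alpha> * ((Ln (t + 1) - Ln t - 1 / t) + (1 / t - small_time \<alpha> t)))
      \<in> O[strip_at_top](\<lambda>t. small_time \<alpha> t * sqrt_decay t)"
    using sum_in_bigo(1)[OF Ln_step inverse_self_minus_small_time] by simp
  then show ?thesis by (simp add: log_time_def algebra_simps)
qed

text \<open>The logarithms cancel in the limit; this separates points in the proof of injectivity.\<close>

lemma log_time_difference:
  assumes "\<bar>Im s\<bar> < 2" "\<bar>Im t\<bar> < 2"
  shows "(\<lambda>k. log_time \<alpha> (t + of_nat k) - log_time \<alpha> (s + of_nat k)) \<longlonglongrightarrow> t - s"
proof -
  note ls = filterlim_add_nat_strip[OF assms(1)] and lt = filterlim_add_nat_strip[OF assms(2)]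
  have "((\<lambda>s. 1 / s) \<longlongrightarrow> 0) strip_at_top"
    using tendsto_0_bigo[OF inverse_self_bigo_small_time[of 0] tendsto_small_time] .
  from filterlim_compose[OF this ls]
  have "(\<lambda>k. 1 + (t - s) * (1 / (s + of_nat k))) \<longlonglongrightarrow> 1 + (t - s) * 0"
    by (intro tendsto_add tendsto_mult tendsto_const)
  moreover have "1 + (t - s) * 0 \<notin> \<real>\<^sub>\<le>\<^sub>0" by simp
  ultimately have "(\<lambda>k. Ln (1 + (t - s) * (1 / (s + of_nat k)))) \<longlonglongrightarrow> Ln (1 + (t - s) * 0)"
    by (rule tendsto_Ln)
  then have L: "(\<lambda>k. Ln (1 + (t - s) * (1 / (s + of_nat k)))) \<longlonglongrightarrow> 0"
    by simp
  have "\<forall>\<^sub>F k in sequentially. Ln (1 + (t - s) * (1 / (s + of_nat k))) = Ln (t + of_nat k) - Ln (s + of_nat k)"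
    using eventually_compose_filterlim[OF eventually_strip_Re_ge[of 1] ls]
      eventually_compose_filterlim[OF eventually_strip_Re_ge[of 1] lt]
  proof eventually_elim
    case (elim k)
    then have "s + of_nat k \<noteq> 0" by (auto simp: complex_eq_iff)
    then have "(t + of_nat k) / (s + of_nat k) = 1 + (t - s) * (1 / (s + of_nat k))"
      by (simp add: divide_simps)
    then show ?case using Ln_diff_eq[of "t + of_nat k" "s + of_nat k"] elim by simp
  qed
  from Lim_transform_eventually[OF L this]
  have "(\<lambda>k. (t - s) + \<alpha> * (Ln (t + of_nat k) - Ln (s + of_nat k))) \<longlonglongrightarrow> (t - s) + \<alpha> * 0"
    by (intro tendsto_intros)
  then show ?thesis by (simp add: log_time_def algebra_simps)
qed

lemma inverse_power_taylor_2:
  "\<exists>K. \<forall>w::complex. norm w \<le> 1 / 2 \<longrightarrow>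
     norm (inverse (1 + w) ^ p - (1 - of_nat p * w + of_nat (p * (p + 1)) / 2 * w\<^sup>2)) \<le> K * norm w ^ 3"
proof (induction p)
  case 0
  show ?case by (intro exI[of _ 0]) simp
next
  case (Suc p)
  then obtain K where K: "norm (inverse (1 + w) ^ p - (1 - of_nat p * w + of_nat (p * (p + 1)) / 2 * w\<^sup>2))
      \<le> K * norm w ^ 3" if "norm w \<le> 1 / 2" for w :: complex by blast
  let ?q = "of_nat ((p + 1) * (p + 2)) / 2 :: complex"
  show ?case
  proof (intro exI[of _ "2 * K + 2 * norm ?q"] allI impI)
    fix w :: complex assume w: "norm w \<le> 1 / 2"
    have "1 / 2 \<le> norm (1 + w)" using norm_triangle_ineq2[of 1 "- w"] w by simp
    then have inv: "norm (inverse (1 + w)) \<le> 2" and nz: "1 + w \<noteq> 0"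
      using le_imp_inverse_le[of "1 / 2" "norm (1 + w)"] by (auto simp: norm_inverse)
    let ?T = "\<lambda>p. 1 - of_nat p * w + of_nat (p * (p + 1)) / 2 * w\<^sup>2"
    have "(1 + w) * ?T (Suc p) = ?T p + ?q * w ^ 3"
      by (simp add: field_simps power2_eq_square power3_eq_cube)
    moreover have "?T (Suc p) = inverse (1 + w) * ((1 + w) * ?T (Suc p))"
      by (simp only: mult.assoc[symmetric] left_inverse[OF nz] mult_1)
    ultimately have "?T (Suc p) = inverse (1 + w) * (?T p + ?q * w ^ 3)" by simp
    then have "inverse (1 + w) ^ Suc p - ?T (Suc p)
        = inverse (1 + w) * ((inverse (1 + w) ^ p - ?T p) - ?q * w ^ 3)"
      by (simp only: power_Suc) (simp add: algebra_simps)
    also have "norm \<dots> \<le> 2 * (K * norm w ^ 3 + norm ?q * norm w ^ 3)"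
      unfolding norm_mult
      by (intro mult_mono inv order_trans[OF norm_triangle_ineq4] add_mono K w) (auto simp: norm_mult norm_power)
    finally show "norm (inverse (1 + w) ^ Suc p - ?T (Suc p)) \<le> (2 * K + 2 * norm ?q) * norm w ^ 3"
      by (simp add: algebra_simps)
  qed
qed

text \<open>If \<open>1 + v\<close> is the quotient of the corrected times after and before a step, then \<open>x\<close> is divided by
  \<open>1 + v\<close>, and \<open>v = x + \<alpha> x\<^sup>2\<close> up to smaller terms. Insert this into the second order expansion of
  \<open>(1 + v)\<^sup>-\<^sup>p\<close>.\<close>

lemma small_time_power_step:
  fixes p :: nat
  shows "(\<lambda>t. small_time \<alpha> (t + 1) ^ p - small_time \<alpha> t ^ p + of_nat p * small_time \<alpha> t ^ (p + 1)
       + (of_nat p * \<alpha> - of_nat (p * (p + 1)) / 2) * small_time \<alpha> t ^ (p + 2))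
     \<in> O[strip_at_top](\<lambda>t. small_time \<alpha> t ^ (p + 2) * sqrt_decay t)"
proof -
  let ?x = "small_time \<alpha>"
  define v where "v t = (log_time \<alpha> (t + 1) - log_time \<alpha> t) * ?x t" for t
  have v1: "(\<lambda>t. v t - ?x t - \<alpha> * ?x t ^ 2) \<in> O[strip_at_top](\<lambda>t. ?x t ^ 2 * sqrt_decay t)"
    using landau_o.big.mult[OF log_time_step[of \<alpha>] landau_o.big_refl[of ?x]]
    by (simp add: v_def algebra_simps power2_eq_square)
  have x2E: "(\<lambda>t. ?x t ^ 2 * sqrt_decay t) \<in> O[strip_at_top](\<lambda>t. ?x t * sqrt_decay t)"
    using landau_o.big.mult[OF bigo_1_if_tendsto[OF tendsto_small_time] landau_o.big_refl[of "\<lambda>t. ?x t * sqrt_decay t"]]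
    by (simp add: power2_eq_square mult_ac)
  have x2: "(\<lambda>t. \<alpha> * ?x t ^ 2) \<in> O[strip_at_top](\<lambda>t. ?x t * sqrt_decay t)"
    using landau_o.big.mult[OF landau_o.big_refl[of ?x] small_time_bigo_sqrt_decay]
    by (simp add: power2_eq_square)
  have vx: "(\<lambda>t. v t - ?x t) \<in> O[strip_at_top](\<lambda>t. ?x t * sqrt_decay t)"
    using sum_in_bigo(1)[OF landau_o.big_trans[OF v1 x2E] x2] by simp
  have xE: "(\<lambda>t. ?x t * sqrt_decay t) \<in> O[strip_at_top](?x)"
    using landau_o.big.mult[OF landau_o.big_refl[of ?x] bigo_1_if_tendsto[OF tendsto_sqrt_decay]] by simp
  have v: "v \<in> O[strip_at_top](?x)"
    using sum_in_bigo(1)[OF landau_o.big_trans[OF vx xE] landau_o.big_refl[of ?x]] by simp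
  have vpx: "(\<lambda>t. v t + ?x t) \<in> O[strip_at_top](?x)"
    using sum_in_bigo(1)[OF v landau_o.big_refl[of ?x]] by simp
  have v2: "(\<lambda>t. v t ^ 2 - ?x t ^ 2) \<in> O[strip_at_top](\<lambda>t. ?x t ^ 2 * sqrt_decay t)"
    using landau_o.big.mult[OF vx vpx] by (simp add: power2_eq_square algebra_simps)
  have v3: "(\<lambda>t. v t ^ 3) \<in> O[strip_at_top](\<lambda>t. ?x t ^ 2 * sqrt_decay t)"
    using landau_o.big.mult[OF landau_o.big.mult[OF v v] landau_o.big_trans[OF v small_time_bigo_sqrt_decay]]
    by (simp add: power2_eq_square power3_eq_cube)
  have v0: "(v \<longlongrightarrow> 0) strip_at_top" using v tendsto_small_time by (rule tendsto_0_bigo)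
  obtain K where K: "norm (inverse (1 + w) ^ p - (1 - of_nat p * w + of_nat (p * (p + 1)) / 2 * w\<^sup>2))
      \<le> K * norm w ^ 3" if "norm w \<le> 1 / 2" for w :: complex
    using inverse_power_taylor_2[of p] by blast
  let ?R = "\<lambda>t. inverse (1 + v t) ^ p - (1 - of_nat p * v t + of_nat (p * (p + 1)) / 2 * (v t)\<^sup>2)"
  have "?R \<in> O[strip_at_top](\<lambda>t. v t ^ 3)"
  proof (rule bigoI[of _ K])
    have "\<forall>\<^sub>F t in strip_at_top. norm (v t) < 1 / 2"
      using order_tendstoD(2)[OF tendsto_norm[OF v0], of "1 / 2"] by simp
    then show "\<forall>\<^sub>F t in strip_at_top. norm (?R t) \<le> K * norm (v t ^ 3)"
      by eventually_elim (use K in \<open>simp add: norm_power\<close>)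
  qed
  then have R: "?R \<in> O[strip_at_top](\<lambda>t. ?x t ^ 2 * sqrt_decay t)" using v3 landau_o.big_trans by blast
  have a: "(\<lambda>t. of_nat p * (v t - ?x t - \<alpha> * ?x t ^ 2)) \<in> O[strip_at_top](\<lambda>t. ?x t ^ 2 * sqrt_decay t)"
    using v1 by (cases "p = 0") auto
  have b: "(\<lambda>t. of_nat (p * (p + 1)) / 2 * (v t ^ 2 - ?x t ^ 2)) \<in> O[strip_at_top](\<lambda>t. ?x t ^ 2 * sqrt_decay t)"
    using v2 by (cases "p = 0") (auto simp del: of_nat_mult)
  have "(\<lambda>t. ?R t - of_nat p * (v t - ?x t - \<alpha> * ?x t ^ 2) + of_nat (p * (p + 1)) / 2 * (v t ^ 2 - ?x t ^ 2))
      \<in> O[strip_at_top](\<lambda>t. ?x t ^ 2 * sqrt_decay t)"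
    by (rule sum_in_bigo(1)[OF sum_in_bigo(2)[OF R a] b])
  then have "(\<lambda>t. ?x t ^ p * (?R t - of_nat p * (v t - ?x t - \<alpha> * ?x t ^ 2)
      + of_nat (p * (p + 1)) / 2 * (v t ^ 2 - ?x t ^ 2)))
      \<in> O[strip_at_top](\<lambda>t. ?x t ^ p * (?x t ^ 2 * sqrt_decay t))"
    by (intro landau_o.big.mult landau_o.big_refl)
  also have "(\<lambda>t. ?x t ^ p * (?x t ^ 2 * sqrt_decay t)) = (\<lambda>t. ?x t ^ (p + 2) * sqrt_decay t)"
    by (simp add: power_add mult_ac power2_eq_square)
  finally have main: "(\<lambda>t. ?x t ^ p * (?R t - of_nat p * (v t - ?x t - \<alpha> * ?x t ^ 2)
      + of_nat (p * (p + 1)) / 2 * (v t ^ 2 - ?x t ^ 2)))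
      \<in> O[strip_at_top](\<lambda>t. ?x t ^ (p + 2) * sqrt_decay t)" .
  moreover have "\<forall>\<^sub>F t in strip_at_top. ?x t ^ p * (?R t - of_nat p * (v t - ?x t - \<alpha> * ?x t ^ 2)
      + of_nat (p * (p + 1)) / 2 * (v t ^ 2 - ?x t ^ 2)) =
      ?x (t + 1) ^ p - ?x t ^ p + of_nat p * ?x t ^ (p + 1)
       + (of_nat p * \<alpha> - of_nat (p * (p + 1)) / 2) * ?x t ^ (p + 2)"
    using eventually_log_time_nonzero[of \<alpha>]
  proof eventually_elim
    case (elim t)
    have "1 + v t = log_time \<alpha> (t + 1) * ?x t"
      using elim by (simp add: v_def small_time_def field_simps)
    then have "?x (t + 1) = ?x t * inverse (1 + v t)"
      using elim by (simp add: small_time_def field_simps)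
    then have "?x (t + 1) ^ p = ?x t ^ p * inverse (1 + v t) ^ p" by (simp add: power_mult_distrib)
    then show ?case by (simp add: algebra_simps power2_eq_square)
  qed
  ultimately show ?thesis by (rule landau_o.big.in_cong[THEN iffD1, rotated])
qed

definition right_strip :: "real \<Rightarrow> complex set" where
  "right_strip R = {t. R < Re t \<and> \<bar>Im t\<bar> < 2}"

lemma open_right_strip: "open (right_strip R)"
  unfolding right_strip_def by (intro open_Collect_conj open_Collect_less continuous_intros)

lemma right_strip_add_1: "t \<in> right_strip R \<Longrightarrow> t + 1 \<in> right_strip R"
  by (simp add: right_strip_def)

lemma right_strip_add_nat: "t \<in> right_strip R \<Longrightarrow> t + of_nat k \<in> right_strip R"
  by (simp add: right_strip_def)

lemma filterlim_right_strip:
  "t \<in> right_strip R \<Longrightarrow> filterlim (\<lambda>k. t + of_nat k) strip_at_top sequentially"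
  by (rule filterlim_add_nat_strip) (simp add: right_strip_def)

lemma eventually_right_strip: "\<forall>\<^sub>F t in strip_at_top. t \<in> right_strip R"
  unfolding eventually_strip_at_top right_strip_def by (intro exI[of _ "R + 1"]) auto

lemma eventually_strip_obtain:
  assumes "eventually P strip_at_top"
  obtains R where "R0 \<le> R" "\<And>t. t \<in> right_strip R \<Longrightarrow> P t"
proof -
  obtain R1 where R1: "\<And>t. R1 \<le> Re t \<Longrightarrow> \<bar>Im t\<bar> < 2 \<Longrightarrow> P t"
    using assms unfolding eventually_strip_at_top by blast
  show ?thesis
    by (rule that[of "max R0 R1"]) (auto simp: right_strip_def intro!: R1)
qed

section \<open>Coefficients and weights along Jordan chains\<close>

text \<open>The combinatorial data of a nilpotent matrix in Jordan form: \<open>nxt\<close> moves down a block,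
  \<open>ends\<close> are the last indices of the blocks, and \<open>last_of\<close> gives the end of the block of an index.
  The depth \<open>d\<close> is the expected order of decay of a coordinate relative to the first one; it reaches
  \<open>m - 1\<close> at the end of the block of \<open>i1\<close>. The number \<open>a i\<close> is the coefficient of the square of
  coordinate \<open>i1\<close> in row \<open>i\<close>.\<close>

locale jordan_chains =
  fixes m :: nat and d :: "'n::finite \<Rightarrow> nat" and nxt :: "'n \<Rightarrow> 'n" and ends :: "'n set"
    and last_of :: "'n \<Rightarrow> 'n" and i1 :: 'n and a :: "'n \<Rightarrow> complex"
  assumes m: "2 \<le> m"
    and d_i1: "d i1 = 0" and d_pos: "i \<noteq> i1 \<Longrightarrow> 0 < d i" and d_less: "d i < m"
    and d_nxt: "i \<notin> ends \<Longrightarrow> d (nxt i) = d i + 1"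
    and last_nxt: "i \<notin> ends \<Longrightarrow> last_of (nxt i) = last_of i"
    and last_end: "i \<in> ends \<Longrightarrow> last_of i = i"
    and top: "d (last_of i1) = m - 1" and a_nonzero: "a (last_of i1) \<noteq> 0"
begin

lemma deepest_in_ends: "d i = m - 1 \<Longrightarrow> i \<in> ends"
  using d_nxt[of i] d_less[of "nxt i"] m by fastforce

lemma i1_not_end: "i1 \<notin> ends"
  using last_end[of i1] top d_i1 m by auto

text \<open>The coefficient for which \<open>C0 t\<^sup>-\<^sup>m\<close> has \<open>m\<close>-th derivative \<open>a (C0 t\<^sup>-\<^sup>m)\<^sup>2\<close>.\<close>

definition C0 :: complex where
  "C0 = (-1) ^ m * fact (2 * m - 1) / (fact (m - 1) * a (last_of i1))"

text \<open>The coefficients of \<open>t\<^sup>-\<^sup>(\<^sup>m\<^sup>+\<^sup>d\<^sup>)\<close> obtained by integrating \<open>b C0\<^sup>2 t\<^sup>-\<^sup>2\<^sup>m\<close> upwards from the end of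
  the block, where \<open>b\<close> is the value of \<open>a\<close> there; a block whose end has smaller depth is not reached at this order.\<close>

definition C :: "'n \<Rightarrow> complex" where
  "C i = (if d (last_of i) = m - 1
          then a (last_of i) * C0\<^sup>2 * (-1) ^ (m - d i) * fact (m + d i - 1) / fact (2 * m - 1) else 0)"

lemma C0_nonzero: "C0 \<noteq> 0"
  using a_nonzero by (simp add: C0_def)

lemma C_i1: "C i1 = C0"
proof -
  have "a (last_of i1) * C0 * (-1) ^ m * fact (m - 1) = (fact (2 * m - 1) :: complex) * ((-1) ^ m * (-1) ^ m)"
    using a_nonzero by (simp add: C0_def field_simps)
  also have "\<dots> = fact (2 * m - 1)" by (simp add: power_add[symmetric])
  finally have X: "a (last_of i1) * C0 * (-1) ^ m * fact (m - 1) = fact (2 * m - 1)" .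
  have "a (last_of i1) * C0\<^sup>2 * (-1) ^ m * fact (m - 1)
      = C0 * (a (last_of i1) * C0 * (-1) ^ m * fact (m - 1))" by (simp add: power2_eq_square)
  also have "\<dots> = C0 * fact (2 * m - 1)" by (simp only: X)
  finally have "a (last_of i1) * C0\<^sup>2 * (-1) ^ m * fact (m - 1) = C0 * fact (2 * m - 1)" .
  then show ?thesis using top d_i1 by (simp add: C_def)
qed

text \<open>Comparison of the terms of order \<open>t\<^sup>-\<^sup>(\<^sup>m\<^sup>+\<^sup>d\<^sup>+\<^sup>1\<^sup>)\<close> in the equation of the curve.\<close>

lemma C_recursion:
  "of_nat (m + d i) * C i = - (if i \<in> ends then 0 else C (nxt i)) - (if d i = m - 1 then a i * C0\<^sup>2 else 0)"
proof (cases "i \<in> ends")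
  case True
  show ?thesis
  proof (cases "d i = m - 1")
    case d: True
    define p :: complex where "p = of_nat (2 * m - 1)"
    have p: "p \<noteq> 0" using m unfolding p_def of_nat_eq_0_iff by linarith
    have "m + d i = 2 * m - 1" "m + d i - 1 = 2 * m - 2" "m - d i = 1" using d m by auto
    moreover have "fact (2 * m - 1) = p * fact (2 * m - 2)"
    proof -
      have e: "2 * m - 1 - 1 = 2 * m - 2" by simp
      show ?thesis unfolding p_def by (rule fact_reduce[of "2 * m - 1", unfolded e]) (use m in simp)
    qed
    ultimately have "of_nat (m + d i) * C i = p * (a i * C0\<^sup>2 * (-1) * fact (2 * m - 2) / (p * fact (2 * m - 2)))"
      using d by (simp add: C_def last_end[OF True] p_def)
    also have "\<dots> = - a i * C0\<^sup>2" using p by simp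
    finally show ?thesis using True d by simp
  next
    case False
    then show ?thesis using True by (simp add: C_def last_end)
  qed
next
  case False
  have "d i < m - 1" using deepest_in_ends[of i] d_less[of i] False by fastforce
  moreover have "fact (m + d i) = of_nat (m + d i) * (fact (m + d i - 1) :: complex)"
    using fact_reduce[of "m + d i"] m by simp
  moreover have "(-1) ^ (m - d i) = - ((-1) ^ (m - Suc (d i)) :: complex)"
    using calculation(1) by (simp add: Suc_diff_Suc[symmetric, of "d i" m])
  ultimately show ?thesis using False by (simp add: C_def d_nxt last_nxt)
qed

text \<open>Solve from the ends of the blocks upwards: the depth increases along \<open>nxt\<close> and is bounded.\<close>

lemma backward_recursion:
  fixes h p :: "'n \<Rightarrow> complex"
  assumes "\<And>i. p i \<noteq> 0"
  shows "\<exists>B. \<forall>i. p i * B i = h i - (if i \<in> ends then 0 else B (nxt i))"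
proof -
  have "\<exists>B. \<forall>i. m \<le> d i + k \<longrightarrow> p i * B i = h i - (if i \<in> ends then 0 else B (nxt i))" for k
  proof (induction k)
    case 0
    show ?case using d_less by (metis add.right_neutral not_le)
  next
    case (Suc k)
    then obtain B where B: "m \<le> d i + k \<Longrightarrow> p i * B i = h i - (if i \<in> ends then 0 else B (nxt i))" for i
      by blast
    let ?B = "\<lambda>i. if m \<le> d i + k then B i else (h i - (if i \<in> ends then 0 else B (nxt i))) / p i"
    have "p i * ?B i = h i - (if i \<in> ends then 0 else ?B (nxt i))" if "m \<le> d i + Suc k" for i
      using that B[of i] assms[of i] d_nxt[of i] by auto
    then show ?case by (intro exI[of _ ?B]) blast
  qed
  from this[of m] show ?thesis by simp
qed

text \<open>For each \<open>\<alpha>\<close> the coefficients \<open>B\<close> are found by recursion from the ends of the blocks, and \<open>B i1\<close>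
  is an affine function \<open>\<beta> i1 + \<alpha> \<gamma> i1\<close> of \<open>\<alpha>\<close>. In the linearised equation for \<open>B i1\<close> the
  exponent \<open>m + 1\<close> is a root of the indicial polynomial, so \<open>B i1\<close> cannot be used to solve it, and is
  set to \<open>0\<close>; this is possible because \<open>\<gamma> i1 \<noteq> 0\<close>. Indeed \<open>\<gamma>\<close> is a negative multiple
  of \<open>C\<close> all along the chain of \<open>i1\<close>, where consecutive entries of \<open>C\<close> alternate in sign.\<close>

lemma second_order_coefficients:
  fixes h :: "'n \<Rightarrow> complex"
  shows "\<exists>\<alpha> B. B i1 = 0 \<and> (\<forall>i. of_nat (m + d i + 1) * B i
     = h i - of_nat (m + d i) * \<alpha> * C i - (if i \<in> ends then 0 else B (nxt i)))"
proof -
  have p: "of_nat (m + d i + 1) \<noteq> (0::complex)" for i by (simp del: of_nat_add of_nat_Suc)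
  obtain \<beta> where \<beta>: "of_nat (m + d i + 1) * \<beta> i = h i - (if i \<in> ends then 0 else \<beta> (nxt i))" for i
    using backward_recursion[of "\<lambda>i. of_nat (m + d i + 1)" h, OF p] by blast
  obtain \<gamma> where \<gamma>: "of_nat (m + d i + 1) * \<gamma> i
      = - (of_nat (m + d i) * C i) - (if i \<in> ends then 0 else \<gamma> (nxt i))" for i
    using backward_recursion[of "\<lambda>i. of_nat (m + d i + 1)" "\<lambda>i. - (of_nat (m + d i) * C i)", OF p] by blast
  have "\<exists>g>0. \<gamma> i = - of_real g * C i" if "last_of i = last_of i1" "m \<le> d i + k" for i k
    using that
  proof (induction k arbitrary: i)
    case 0
    then show ?case using d_less[of i] by simp
  next
    case (Suc k)
    let ?p = "real (m + d i)"
    have pp: "?p > 0" using m by simp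
    have nz: "complex_of_real (?p + 1) \<noteq> 0" using pp unfolding of_real_eq_0_iff by linarith
    have solve: "\<gamma> i = - of_real (r / (?p + 1)) * C i" if "of_real (?p + 1) * \<gamma> i = - of_real r * C i" for r
    proof -
      have "\<gamma> i = of_real (?p + 1) * \<gamma> i / of_real (?p + 1)" using nz by simp
      then show ?thesis unfolding that of_real_divide by simp
    qed
    show ?case
    proof (cases "i \<in> ends")
      case True
      then have "of_real (?p + 1) * \<gamma> i = - of_real ?p * C i"
        using \<gamma>[of i] by (simp add: algebra_simps)
      then have "\<gamma> i = - of_real (?p / (?p + 1)) * C i" by (rule solve)
      moreover have "?p / (?p + 1) > 0" using pp by simp
      ultimately show ?thesis by blast
    next
      case False
      then obtain g where g: "g > 0" "\<gamma> (nxt i) = - of_real g * C (nxt i)"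
        using Suc.IH[of "nxt i"] Suc.prems last_nxt d_nxt by force
      have "d i \<noteq> m - 1" using False deepest_in_ends by blast
      then have "of_nat (m + d i) * C i = - C (nxt i)" using C_recursion[of i] False by simp
      then have "C (nxt i) = - (of_nat (m + d i) * C i)" by (simp only: minus_minus)
      then have Cn: "C (nxt i) = - of_real ?p * C i" by (simp only: of_real_of_nat_eq mult_minus_left)
      have "of_real (?p + 1) * \<gamma> i = - (of_real ?p * C i) - \<gamma> (nxt i)"
        using \<gamma>[of i] False by (simp add: algebra_simps)
      also have "\<dots> = - of_real (?p * (1 + g)) * C i"
        unfolding g(2) Cn by (simp add: algebra_simps)
      finally have "of_real (?p + 1) * \<gamma> i = - of_real (?p * (1 + g)) * C i" .
      then have "\<gamma> i = - of_real (?p * (1 + g) / (?p + 1)) * C i" by (rule solve)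
      moreover have "?p * (1 + g) / (?p + 1) > 0" using pp g by simp
      ultimately show ?thesis by blast
    qed
  qed
  from this[of i1 m] obtain g where "g > 0" "\<gamma> i1 = - of_real g * C i1" by auto
  then have \<gamma>1: "\<gamma> i1 \<noteq> 0" using C_i1 C0_nonzero by simp
  define \<alpha> where "\<alpha> = - \<beta> i1 / \<gamma> i1"
  define B where "B i = \<beta> i + \<alpha> * \<gamma> i" for i
  have "B i1 = 0" using \<gamma>1 by (simp add: B_def \<alpha>_def)
  moreover have "of_nat (m + d i + 1) * B i
     = h i - of_nat (m + d i) * \<alpha> * C i - (if i \<in> ends then 0 else B (nxt i))" for i
  proof -
    have "of_nat (m + d i + 1) * B i = of_nat (m + d i + 1) * \<beta> i + \<alpha> * (of_nat (m + d i + 1) * \<gamma> i)"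
      by (simp only: B_def distrib_left mult.left_commute)
    also have "\<dots> = h i - of_nat (m + d i) * \<alpha> * C i - (if i \<in> ends then 0 else B (nxt i))"
      unfolding \<beta> \<gamma> by (simp add: B_def algebra_simps)
    finally show ?thesis .
  qed
  ultimately show ?thesis by blast
qed

text \<open>The exponent \<open>m + 1\<close> is an indicial root of the linearised equation: \<open>2 a C0\<close> equals
  \<open>(m + 1) (m + 2) \<dots> (2 m)\<close> up to sign.\<close>

lemma resonance: "2 * norm (a (last_of i1) * C0) = pochhammer (real m + 1) m"
proof -
  have "fact m * pochhammer (real m + 1) m = (fact (2 * m) :: real)"
    using pochhammer_product[of m "2 * m" "1 :: real"] by (simp add: pochhammer_fact add.commute)
  also have "fact (2 * m) = 2 * (real m * fact (2 * m - 1))"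
    using fact_reduce[of "2 * m", where 'a = real] m by simp
  also have "fact m = real m * (fact (m - 1) :: real)" using fact_reduce[of m] m by simp
  finally have "real m * (fact (m - 1) * pochhammer (real m + 1) m) = real m * (2 * fact (2 * m - 1))"
    by (simp add: mult_ac)
  then have "fact (m - 1) * pochhammer (real m + 1) m = 2 * fact (2 * m - 1)" using m by simp
  moreover have "norm (a (last_of i1) * C0) = fact (2 * m - 1) / fact (m - 1)"
    using a_nonzero by (simp add: C0_def norm_mult norm_divide norm_power)
  ultimately have "fact (m - 1) * (2 * norm (a (last_of i1) * C0)) = fact (m - 1) * pochhammer (real m + 1) m"
    by (simp only:) simp
  then show ?thesis by (simp only: mult_cancel_left fact_nonzero simp_thms)
qed

text \<open>Summing a term of size \<open>t\<^sup>-\<^sup>(\<^sup>s\<^sup>+\<^sup>d\<^sup>)\<^sup>-\<^sup>1\<close> divides its constant by \<open>s + d\<close>. Going once around the chain of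
  \<open>i1\<close>, the linearised operator multiplies by \<open>2 \<bar>a C0\<bar>\<close> and divides by \<open>s (s + 1) \<dots> (s + m - 1)\<close>,
  which for \<open>s > m + 1\<close> is a contraction by lemma \<open>resonance\<close>. The weights distribute the
  factor \<open>q\<^sup>m\<close> of one turn evenly over its \<open>m\<close> steps; the other blocks only receive from this chain, and it
  suffices to give them a large weight.\<close>

lemma contracting_weights:
  fixes s :: real
  assumes s: "real m + 1 < s"
  shows "\<exists>lam q. (\<forall>i. 0 < lam i) \<and> 0 < q \<and> q < 1 \<and>
    (\<forall>i. (if i \<in> ends then 0 else lam (nxt i)) + (if d i = m - 1 then 2 * norm (a i * C0) * lam i1 else 0)
       \<le> q * (lam i * (s + real (d i))))"
proof -
  let ?E = "last_of i1"
  define r where "r = pochhammer (real m + 1) m / pochhammer s m"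
  have pos: "0 < pochhammer (real m + 1) m" "0 < pochhammer s k" for k
    using s by (auto intro!: pochhammer_pos)
  have "pochhammer (real m + 1) m < pochhammer s m"
    unfolding pochhammer_prod using s m by (intro prod_mono_strict[where i = 0]) auto
  then have r: "0 < r" "r < 1" using pos by (auto simp: r_def)
  define q where "q = root m r"
  have q: "0 < q" "q < 1" "q ^ m = r" using r m by (auto simp: q_def)
  \<comment> \<open>The weight of another block is scaled by a bound of the ratio of the
      coefficients that drive the two blocks.\<close>
  define M where "M i = (if last_of i = ?E then 1 else 1 + (\<Sum>j\<in>UNIV. norm (a j) / norm (a ?E)))" for i
  define lam where "lam i = M i * (q ^ d i * pochhammer s (d i))" for i
  have sum_ge: "norm (a i) / norm (a ?E) \<le> (\<Sum>j\<in>UNIV. norm (a j) / norm (a ?E))" for i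
    by (rule member_le_sum) auto
  have "0 \<le> (\<Sum>j\<in>UNIV. norm (a j) / norm (a ?E))" by (intro sum_nonneg) auto
  then have Mpos: "0 < M i" for i by (simp add: M_def add_pos_nonneg)
  then have lam: "0 < lam i" for i using q pos by (simp add: lam_def)
  have "(if i \<in> ends then 0 else lam (nxt i)) + (if d i = m - 1 then 2 * norm (a i * C0) * lam i1 else 0)
       \<le> q * (lam i * (s + real (d i)))" for i
  proof (cases "i \<in> ends")
    case False
    then have "d i \<noteq> m - 1" using deepest_in_ends by blast
    moreover have "lam (nxt i) = q * (lam i * (s + real (d i)))"
      using False by (simp add: lam_def M_def d_nxt last_nxt pochhammer_Suc)
    ultimately show ?thesis using False by simp
  next
    case True
    show ?thesis
    proof (cases "d i = m - 1")
      case d: True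
      have "q * (lam i * (s + real (d i))) = M i * (q ^ Suc (m - 1) * (pochhammer s (m - 1) * (s + real (m - 1))))"
        by (simp add: lam_def d)
      also have "\<dots> = M i * (q ^ m * pochhammer s m)"
        using m pochhammer_Suc[of s "m - 1"] by simp
      also have "\<dots> = M i * (2 * norm (a ?E * C0))"
        using q(3) pos(2)[of m] resonance by (simp add: r_def)
      also have "norm (a i * C0) \<le> M i * norm (a ?E * C0)"
      proof (cases "i = ?E")
        case True
        then show ?thesis using last_end[OF \<open>i \<in> ends\<close>] by (simp add: M_def)
      next
        case False
        then have "norm (a i) / norm (a ?E) \<le> M i"
          using sum_ge[of i] last_end[OF \<open>i \<in> ends\<close>] by (simp add: M_def)
        then have "norm (a i) \<le> M i * norm (a ?E)" using a_nonzero by (simp add: field_simps)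
        then show ?thesis by (simp add: norm_mult mult_right_mono flip: mult.assoc)
      qed
      then have "2 * norm (a i * C0) \<le> M i * (2 * norm (a ?E * C0))" by simp
      finally show ?thesis using True d d_i1 by (simp add: lam_def M_def)
    next
      case False
      then show ?thesis using True lam[of i] q s by simp
    qed
  qed
  then show ?thesis using lam q by blast
qed

lemma C_closed_form:
  assumes "d (last_of i) = m - 1"
  shows "C i = (-1) ^ (m + d i) * (a (last_of i) / (a (last_of i1))\<^sup>2) * of_nat (2 * m - 1)
     * of_nat ((2 * m - 2) choose (m - 1)) * fact (m + d i - 1)"
proof -
  have "(fact (2 * m - 1) :: complex) = of_nat (2 * m - 1) * fact (2 * m - 2)"
  proof -
    have e: "2 * m - 1 - 1 = 2 * m - 2" by simp
    show ?thesis by (rule fact_reduce[of "2 * m - 1", unfolded e]) (use m in simp)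
  qed
  moreover have "(fact (2 * m - 2) :: complex) = of_nat ((2 * m - 2) choose (m - 1)) * (fact (m - 1))\<^sup>2"
  proof -
    have e: "2 * m - 2 - (m - 1) = m - 1" by simp
    have "of_nat ((2 * m - 2) choose (m - 1)) = (fact (2 * m - 2) / (fact (m - 1) * fact (m - 1)) :: complex)"
      using binomial_fact[of "m - 1" "2 * m - 2", where 'a = complex] unfolding e by simp
    then show ?thesis by (simp add: power2_eq_square)
  qed
  ultimately have f: "(fact (2 * m - 1) :: complex)
      = of_nat (2 * m - 1) * (of_nat ((2 * m - 2) choose (m - 1)) * (fact (m - 1))\<^sup>2)" by simp
  have "C0\<^sup>2 = (fact (2 * m - 1))\<^sup>2 / ((fact (m - 1))\<^sup>2 * (a (last_of i1))\<^sup>2)"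
    by (simp add: C0_def power_divide power_mult_distrib power_mult[symmetric] mult.commute)
  then have "C0\<^sup>2 / fact (2 * m - 1) = fact (2 * m - 1) / (fact (m - 1))\<^sup>2 / (a (last_of i1))\<^sup>2"
    by (simp add: power2_eq_square)
  also have "\<dots> = of_nat (2 * m - 1) * of_nat ((2 * m - 2) choose (m - 1)) / (a (last_of i1))\<^sup>2"
    unfolding f by (simp del: of_nat_mult of_nat_diff)
  finally have C0: "C0\<^sup>2 / fact (2 * m - 1)
      = of_nat (2 * m - 1) * of_nat ((2 * m - 2) choose (m - 1)) / (a (last_of i1))\<^sup>2" .
  have "m + d i = (m - d i) + 2 * d i" using d_less[of i] by simp
  then have "(-1) ^ (m + d i) = ((-1) ^ ((m - d i) + 2 * d i) :: complex)" by (rule arg_cong)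
  then have "(-1) ^ (m + d i) = ((-1) ^ (m - d i) :: complex)" by (simp only: power_add power_mult) simp
  moreover have "C i = (-1) ^ (m - d i) * a (last_of i) * (C0\<^sup>2 / fact (2 * m - 1)) * fact (m + d i - 1)"
    using assms by (simp add: C_def)
  ultimately show ?thesis unfolding C0 by (simp only:) (simp add: mult_ac)
qed

end

section \<open>The residual of the formal curve\<close>

text \<open>A map \<open>F\<close> in weighted form, valid for \<open>\<bar>x\<bar> \<le> x0\<close> and \<open>\<bar>y j\<bar> \<le> Y\<close>, together with a solution
  \<open>\<alpha>\<close>, \<open>B\<close> of the second order equations.\<close>

locale approximate_curve = jordan_chains m d nxt ends last_of i1 a
  for m :: nat and d :: "'n::finite \<Rightarrow> nat" and nxt ends last_of i1 and a :: "'n \<Rightarrow> complex" +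
  fixes F :: "complex^'n \<Rightarrow> complex^'n" and H :: "'n \<Rightarrow> complex \<Rightarrow> ('n \<Rightarrow> complex) \<Rightarrow> complex"
    and x0 Y K :: real and \<alpha> :: complex and B :: "'n \<Rightarrow> complex"
  assumes x0: "0 < x0" and K: "0 \<le> K" and Y: "norm (C j) < Y"
    and H: "lipschitz_remainder x0 Y K (H i)"
    and expansion: "\<lbrakk>norm x \<le> x0; \<And>j. norm (y j) \<le> Y\<rbrakk> \<Longrightarrow>
      F (\<chi> j. x ^ (m + d j) * y j) $ i = x ^ (m + d i) * y i
        + (if i \<in> ends then 0 else x ^ (m + d i + 1) * y (nxt i))
        + x ^ (2 * m) * (a i * (y i1)\<^sup>2 + x * H i x y)"
    and B_i1: "B i1 = 0"
    and B_recursion: "of_nat (m + d i + 1) * B i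
      = (of_nat ((m + d i) * (m + d i + 1)) / 2 * C i - (if d i = m - 1 then H i 0 C else 0)
          - (if d i + 2 = m then a i * C0\<^sup>2 else 0))
        - of_nat (m + d i) * \<alpha> * C i - (if i \<in> ends then 0 else B (nxt i))"
begin

abbreviation "x \<equiv> small_time \<alpha>"
abbreviation "u \<equiv> log_time \<alpha>"

definition profile :: "complex \<Rightarrow> 'n \<Rightarrow> complex" where
  "profile t j = C j + B j * x t"

text \<open>The first two terms of the formal curve, in the small variable \<open>x = 1 / u\<close>.\<close>

definition \<psi> :: "complex \<Rightarrow> complex^'n" where
  "\<psi> t = (\<chi> j. x t ^ (m + d j) * profile t j)"

lemma profile_i1: "profile t i1 = C0"
  by (simp add: profile_def B_i1 C_i1)

lemma tendsto_profile: "((\<lambda>t. profile t j) \<longlongrightarrow> C j) strip_at_top"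
proof -
  have "((\<lambda>t. C j + B j * x t) \<longlongrightarrow> C j + B j * 0) strip_at_top"
    by (intro tendsto_add tendsto_mult tendsto_const tendsto_small_time)
  then show ?thesis by (simp add: profile_def)
qed

lemma eventually_small: "\<forall>\<^sub>F t in strip_at_top. norm (x t) < x0"
  using order_tendstoD(2)[OF tendsto_norm[OF tendsto_small_time]] x0 by simp

lemma eventually_profile: "\<forall>\<^sub>F t in strip_at_top. \<forall>j. norm (profile t j) < Y"
  by (rule eventually_all_finite) (use order_tendstoD(2)[OF tendsto_norm[OF tendsto_profile] Y] in auto)

lemma x_power_bigo:
  assumes "k \<le> l"
  shows "(\<lambda>t. x t ^ l) \<in> O[strip_at_top](\<lambda>t. x t ^ k)"
proof -
  have "(\<lambda>t. x t ^ k * x t ^ (l - k)) \<in> O[strip_at_top](\<lambda>t. x t ^ k * 1)"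
    by (intro landau_o.big.mult landau_o.big_refl
        bigo_1_if_tendsto[OF tendsto_power[OF tendsto_small_time]])
  then show ?thesis using assms by (simp add: power_add[symmetric])
qed

lemma x_power_Suc_bigo:
  "(\<lambda>t. x t ^ (k + 1)) \<in> O[strip_at_top](\<lambda>t. x t ^ k * sqrt_decay t)"
  using landau_o.big.mult[OF landau_o.big_refl[of "\<lambda>t. x t ^ k"] small_time_bigo_sqrt_decay[of \<alpha>]]
  by (simp add: mult.commute)

lemma bigo_cmult:
  fixes f :: "complex \<Rightarrow> complex"
  assumes "f \<in> O[L](g)"
  shows "(\<lambda>t. c * f t) \<in> O[L](g)"
  using assms by (cases "c = 0") auto

lemma H_profile_bigo: "(\<lambda>t. H i (x t) (profile t) - H i 0 C) \<in> O[strip_at_top](x)"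
proof (rule bigoI)
  show "\<forall>\<^sub>F t in strip_at_top. norm (H i (x t) (profile t) - H i 0 C)
      \<le> (K * (\<Sum>j\<in>UNIV. norm (B j)) + K) * norm (x t)"
    using eventually_small eventually_profile
  proof eventually_elim
    case (elim t)
    have C: "norm (C j) \<le> Y" for j using Y[of j] by simp
    have 1: "norm (H i (x t) (profile t) - H i (x t) C) \<le> K * (\<Sum>j\<in>UNIV. norm (profile t j - C j))"
      and 2: "norm (H i (x t) C - H i 0 C) \<le> K * norm (x t)"
      using H[of i, unfolded lipschitz_remainder_def, rule_format, of "x t" "profile t" C]
        H[of i, unfolded lipschitz_remainder_def, rule_format, of "x t" C C]
        elim C by (auto intro: less_imp_le)
    have "(\<Sum>j\<in>UNIV. norm (profile t j - C j)) = (\<Sum>j\<in>UNIV. norm (B j)) * norm (x t)"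
      by (simp add: profile_def norm_mult sum_distrib_right)
    then have "norm (H i (x t) (profile t) - H i (x t) C) + norm (H i (x t) C - H i 0 C)
        \<le> (K * (\<Sum>j\<in>UNIV. norm (B j)) + K) * norm (x t)"
      using 1 2 by (simp add: distrib_right)
    then show ?case
      using norm_triangle_ineq[of "H i (x t) (profile t) - H i (x t) C" "H i (x t) C - H i 0 C"] by simp
  qed
qed

text \<open>The terms of order up to \<open>x\<^sup>m\<^sup>+\<^sup>d\<^sup>+\<^sup>2\<close> of the nonlinear part. Since \<open>2 m\<close> is compared with \<open>m + d\<close>, they
  depend on whether the depth is \<open>m - 1\<close>, where the first two terms count, \<open>m - 2\<close>, where only
  the first one does, or less.\<close>

lemma quadratic_part_bigo:
  "(\<lambda>t. x t ^ (2 * m) * (a i * C0\<^sup>2 + x t * H i (x t) (profile t))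
      - (if d i = m - 1 then a i * C0\<^sup>2 else 0) * x t ^ (m + d i + 1)
      - ((if d i = m - 1 then H i 0 C else 0) + (if d i + 2 = m then a i * C0\<^sup>2 else 0)) * x t ^ (m + d i + 2))
   \<in> O[strip_at_top](\<lambda>t. x t ^ (m + d i + 3))"
proof -
  have H0: "((\<lambda>t. H i (x t) (profile t)) \<longlongrightarrow> H i 0 C) strip_at_top"
    using tendsto_0_bigo[OF H_profile_bigo tendsto_small_time] by (rule Lim_null[THEN iffD2])
  consider "d i = m - 1" | "d i + 2 = m" | "d i + 3 \<le> m" using d_less[of i] by linarith
  then show ?thesis
  proof cases
    case 1
    have e: "m + d i + 1 = 2 * m" "m + d i + 2 = 2 * m + 1" "m + d i + 3 = (2 * m + 1) + 1" "d i + 2 \<noteq> m"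
      using 1 m by auto
    have "(\<lambda>t. x t ^ (2 * m + 1) * (H i (x t) (profile t) - H i 0 C))
        \<in> O[strip_at_top](\<lambda>t. x t ^ (2 * m + 1) * x t)"
      by (intro landau_o.big.mult landau_o.big_refl H_profile_bigo)
    then show ?thesis unfolding e using e(4) 1 by (simp add: algebra_simps)
  next
    case 2
    have e: "m + d i + 2 = 2 * m" "m + d i + 3 = 2 * m + 1" "d i \<noteq> m - 1" using 2 m by auto
    have "(\<lambda>t. x t ^ (2 * m + 1) * H i (x t) (profile t)) \<in> O[strip_at_top](\<lambda>t. x t ^ (2 * m + 1) * 1)"
      by (intro landau_o.big.mult landau_o.big_refl bigo_1_if_tendsto[OF H0])
    then show ?thesis unfolding e using e(3) 2 by (simp add: algebra_simps)
  next
    case 3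
    then have e: "d i \<noteq> m - 1" "d i + 2 \<noteq> m" by auto
    have "((\<lambda>t. a i * C0\<^sup>2 + x t * H i (x t) (profile t)) \<longlongrightarrow> a i * C0\<^sup>2 + 0 * H i 0 C) strip_at_top"
      by (intro tendsto_add tendsto_mult tendsto_const tendsto_small_time H0)
    then have "(\<lambda>t. x t ^ (2 * m) * (a i * C0\<^sup>2 + x t * H i (x t) (profile t)))
        \<in> O[strip_at_top](\<lambda>t. x t ^ (m + d i + 3) * 1)"
      by (intro landau_o.big.mult x_power_bigo bigo_1_if_tendsto) (use 3 in auto)
    then show ?thesis using e by simp
  qed
qed

text \<open>The coefficients of order \<open>x\<^sup>m\<^sup>+\<^sup>d\<^sup>+\<^sup>1\<close> cancel by the recursion of \<open>C\<close>, and those of order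
  \<open>x\<^sup>m\<^sup>+\<^sup>d\<^sup>+\<^sup>2\<close> by the recursion of \<open>B\<close>.\<close>

lemma residual_bigo:
  "(\<lambda>t. F (\<psi> t) $ i - \<psi> (t + 1) $ i) \<in> O[strip_at_top](\<lambda>t. x t ^ (m + d i + 2) * sqrt_decay t)"
proof -
  define p where "p = m + d i"
  define st where "st k t = x (t + 1) ^ k - x t ^ k + of_nat k * x t ^ (k + 1)
       + (of_nat k * \<alpha> - of_nat (k * (k + 1)) / 2) * x t ^ (k + 2)" for k :: nat and t
  define Q where "Q t = x t ^ (2 * m) * (a i * C0\<^sup>2 + x t * H i (x t) (profile t))
      - (if d i = m - 1 then a i * C0\<^sup>2 else 0) * x t ^ (p + 1)
      - ((if d i = m - 1 then H i 0 C else 0) + (if d i + 2 = m then a i * C0\<^sup>2 else 0)) * x t ^ (p + 2)" for t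
  define c where "c = B i * (of_nat (p + 1) * \<alpha> - of_nat ((p + 1) * (p + 2)) / 2)"
  have step: "st k \<in> O[strip_at_top](\<lambda>t. x t ^ (k + 2) * sqrt_decay t)" for k
    unfolding st_def by (rule small_time_power_step)
  have x3: "(\<lambda>t. x t ^ (p + 3)) \<in> O[strip_at_top](\<lambda>t. x t ^ (p + 2) * sqrt_decay t)"
  proof -
    have e: "p + 3 = p + 2 + 1" by simp
    show ?thesis unfolding e by (rule x_power_Suc_bigo)
  qed
  have Q: "Q \<in> O[strip_at_top](\<lambda>t. x t ^ (p + 2) * sqrt_decay t)"
    using landau_o.big_trans[OF quadratic_part_bigo[of i] x3[unfolded p_def]] unfolding Q_def p_def .
  have st2: "st (p + 1) \<in> O[strip_at_top](\<lambda>t. x t ^ (p + 2) * sqrt_decay t)"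
  proof (rule landau_o.big_trans[OF step])
    show "(\<lambda>t. x t ^ (p + 1 + 2) * sqrt_decay t) \<in> O[strip_at_top](\<lambda>t. x t ^ (p + 2) * sqrt_decay t)"
      by (intro landau_o.big.mult x_power_bigo landau_o.big_refl) simp
  qed
  have "(\<lambda>t. Q t - C i * st p t - B i * st (p + 1) t + c * x t ^ (p + 3))
      \<in> O[strip_at_top](\<lambda>t. x t ^ (p + 2) * sqrt_decay t)"
    by (intro sum_in_bigo(1)[OF sum_in_bigo(2)[OF sum_in_bigo(2)[OF Q]]] bigo_cmult step st2 x3)
  moreover have "\<forall>\<^sub>F t in strip_at_top.
      Q t - C i * st p t - B i * st (p + 1) t + c * x t ^ (p + 3) = F (\<psi> t) $ i - \<psi> (t + 1) $ i"
    using eventually_small eventually_profile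
  proof eventually_elim
    case (elim t)
    define X where "X = x t"
    define N where "N = (if i \<in> ends then 0 else C (nxt i))"
    define N' where "N' = (if i \<in> ends then 0 else B (nxt i))"
    have F: "F (\<psi> t) $ i = X ^ p * (C i + B i * X) + X ^ (p + 1) * (N + N' * X)
        + X ^ (2 * m) * (a i * C0\<^sup>2 + X * H i X (profile t))"
      unfolding \<psi>_def
      using expansion[of "x t" "profile t" i] elim
      by (simp add: less_imp_le profile_i1 X_def N_def N'_def p_def) (simp add: profile_def)
    have \<psi>': "\<psi> (t + 1) $ i = C i * x (t + 1) ^ p + B i * x (t + 1) ^ (p + 1)"
      by (simp add: \<psi>_def profile_def p_def algebra_simps)
    have 1: "of_nat p * C i = - N - (if d i = m - 1 then a i * C0\<^sup>2 else 0)"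
      unfolding p_def N_def by (rule C_recursion)
    have 2: "of_nat (p + 1) * B i = (of_nat (p * (p + 1)) / 2 * C i - (if d i = m - 1 then H i 0 C else 0)
          - (if d i + 2 = m then a i * C0\<^sup>2 else 0)) - of_nat p * \<alpha> * C i - N'"
      unfolding p_def N'_def by (rule B_recursion)
    \<comment> \<open>With the coefficients named, the claim is a polynomial identity in \<open>X\<close>,
        valid after elimination of \<open>N\<close> and \<open>N'\<close> by the two recursions.\<close>
    define A1 where "A1 = (if d i = m - 1 then a i * C0\<^sup>2 else 0)"
    define A2 where "A2 = (if d i = m - 1 then H i 0 C else 0)"
    define A3 where "A3 = (if d i + 2 = m then a i * C0\<^sup>2 else 0)"
    define P where "P = (of_nat p :: complex)"
    define P2 where "P2 = (of_nat (p * (p + 1)) / 2 :: complex)"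
    define P3 where "P3 = (of_nat ((p + 1) * (p + 2)) / 2 :: complex)"
    have 1: "N = - P * C i - A1" using 1 by (simp add: A1_def P_def)
    have 2: "N' = P2 * C i - A2 - A3 - P * \<alpha> * C i - (P + 1) * B i"
      using 2 by (simp add: A2_def A3_def P_def P2_def algebra_simps)
    have st: "st p t = x (t + 1) ^ p - X ^ p + P * (X ^ p * X) + (P * \<alpha> - P2) * (X ^ p * X\<^sup>2)"
      by (simp add: st_def X_def P_def P2_def power2_eq_square mult_ac)
    have st': "st (p + 1) t = x (t + 1) ^ (p + 1) - X ^ p * X + (P + 1) * (X ^ p * X\<^sup>2)
        + ((P + 1) * \<alpha> - P3) * (X ^ p * X ^ 3)"
      by (simp add: st_def X_def P_def P3_def power2_eq_square power3_eq_cube mult_ac add_ac)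
    have Q': "Q t = X ^ (2 * m) * (a i * C0\<^sup>2 + X * H i X (profile t)) - A1 * (X ^ p * X) - (A2 + A3) * (X ^ p * X\<^sup>2)"
      by (simp add: Q_def X_def A1_def A2_def A3_def power2_eq_square mult_ac)
    have c': "c = B i * ((P + 1) * \<alpha> - P3)"
      by (simp add: c_def P_def P3_def add_ac)
    show ?case
      unfolding F \<psi>' st st' Q' c' X_def[symmetric] 1 2
      by (simp add: algebra_simps power2_eq_square power3_eq_cube power_add)
  qed
  ultimately show ?thesis unfolding p_def[symmetric] by (rule landau_o.big.in_cong[THEN iffD1, rotated])
qed

end

section \<open>Contraction near the formal curve\<close>

text \<open>The constants \<open>lam\<close>, \<open>q\<close> are those of lemma \<open>contracting_weights\<close> for \<open>s = m + 5 / 4\<close>. The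
  exponent must exceed \<open>m + 1\<close> for the contraction, and stay below \<open>m + 3 / 2\<close>, since the
  residual is only known to be \<open>O(t\<^sup>-\<^sup>(\<^sup>m\<^sup>+\<^sup>d\<^sup>)\<^sup>-\<^sup>2\<^sup>-\<^sup>1\<^sup>/\<^sup>2)\<close>.\<close>

locale weighted_curve = approximate_curve m d nxt ends last_of i1 a F H x0 Y K \<alpha> B
  for m :: nat and d :: "'n::finite \<Rightarrow> nat" and nxt ends last_of i1 and a :: "'n \<Rightarrow> complex"
    and F H x0 Y K \<alpha> B +
  fixes lam :: "'n \<Rightarrow> real" and q r :: real
  assumes lam: "0 < lam i" and q: "0 < q" "q < 1" and r: "0 < r"
    and weights: "(if i \<in> ends then 0 else lam (nxt i))
        + (if d i = m - 1 then 2 * norm (a i * C0) * lam i1 else 0)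
       \<le> q * (lam i * (real m + 5 / 4 + real (d i)))"
    and F_holomorphic: "\<lbrakk>open V; \<And>j. (\<lambda>t. \<phi> t $ j) holomorphic_on V;
        \<And>t j. t \<in> V \<Longrightarrow> norm (\<phi> t $ j) \<le> r\<rbrakk> \<Longrightarrow> (\<lambda>t. F (\<phi> t) $ i) holomorphic_on V"
    and F_0: "F 0 = 0"
begin

definition decay :: "'n \<Rightarrow> real" where
  "decay i = real m + 5 / 4 + real (d i)"

definition \<omega> :: "complex \<Rightarrow> 'n \<Rightarrow> real" where
  "\<omega> t i = lam i * Re t powr (- decay i)"

definition ratio :: "complex \<Rightarrow> real" where
  "ratio t = norm (u t / of_real (Re t))"

text \<open>The radius \<open>\<omega>\<close> of the neighbourhood in the weighted coordinates \<open>y\<close>.\<close>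

definition \<delta> :: "complex \<Rightarrow> 'n \<Rightarrow> real" where
  "\<delta> t j = ratio t ^ (m + d j) * lam j * Re t powr (- 5 / 4)"

lemma tendsto_ratio: "(ratio \<longlongrightarrow> 1) strip_at_top"
  using tendsto_norm[OF log_time_over_Re[of \<alpha>]] by (simp add: ratio_def[abs_def])

lemma tendsto_Re_powr:
  fixes c :: real
  assumes "c < 0"
  shows "((\<lambda>t. Re t powr c) \<longlongrightarrow> 0) strip_at_top"
  by (rule filterlim_compose[OF _ filterlim_Re_strip]) (rule tendsto_neg_powr[OF assms filterlim_ident])

lemma tendsto_\<delta>: "((\<lambda>t. \<delta> t j) \<longlongrightarrow> 0) strip_at_top"
proof -
  have "((\<lambda>t. ratio t ^ (m + d j) * lam j * Re t powr (- 5 / 4)) \<longlongrightarrow> 1 ^ (m + d j) * lam j * 0) strip_at_top"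
    by (intro tendsto_mult tendsto_power tendsto_const tendsto_ratio tendsto_Re_powr) simp
  then show ?thesis by (simp add: \<delta>_def)
qed

lemma \<omega>_eq:
  assumes "1 \<le> Re t" "u t \<noteq> 0"
  shows "\<omega> t j = norm (x t) ^ (m + d j) * \<delta> t j"
proof -
  have "norm (x t) * ratio t = 1 / Re t"
    using assms by (simp add: small_time_def ratio_def norm_divide)
  then have "norm (x t) ^ (m + d j) * \<delta> t j = lam j * ((1 / Re t) ^ (m + d j) * Re t powr (- 5 / 4))"
    by (simp add: \<delta>_def mult_ac power_mult_distrib[symmetric])
  also have "(1 / Re t) ^ (m + d j) = Re t powr (- real (m + d j))"
    using assms by (simp add: powr_minus powr_realpow power_one_over inverse_eq_divide del: of_nat_add)
  also have "Re t powr (- real (m + d j)) * Re t powr (- 5 / 4) = Re t powr (- decay j)"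
    by (simp add: powr_add[symmetric] decay_def algebra_simps)
  finally show ?thesis by (simp add: \<omega>_def)
qed

text \<open>The conditions under which the neighbourhood of the formal curve at time \<open>t\<close> lies in the domain of
  the weighted form of \<open>F\<close>.\<close>

definition good :: "complex \<Rightarrow> bool" where
  "good t \<longleftrightarrow> norm (x t) \<le> x0 \<and> 1 \<le> Re t \<and> u t \<noteq> 0 \<and> (\<forall>j. norm (profile t j) + \<delta> t j \<le> Y)"

lemma eventually_good: "eventually good strip_at_top"
proof -
  have "\<forall>\<^sub>F t in strip_at_top. \<forall>j. norm (profile t j) + \<delta> t j < Y"
  proof (rule eventually_all_finite)
    fix j
    have "((\<lambda>t. norm (profile t j) + \<delta> t j) \<longlongrightarrow> norm (C j) + 0) strip_at_top"
      by (intro tendsto_add tendsto_norm tendsto_profile tendsto_\<delta>)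
    then show "\<forall>\<^sub>F t in strip_at_top. norm (profile t j) + \<delta> t j < Y"
      using order_tendstoD(2) Y[of j] by fastforce
  qed
  then show ?thesis
    using eventually_small eventually_log_time_nonzero[of \<alpha>] eventually_strip_Re_ge[of 1]
    by eventually_elim (auto simp: good_def less_imp_le)
qed

lemma good_x_nonzero: "good t \<Longrightarrow> x t \<noteq> 0"
  by (simp add: good_def small_time_def)

lemma \<delta>_nonneg: "0 \<le> \<delta> t j"
  using lam[of j] by (simp add: \<delta>_def ratio_def)

lemma box_scaled:
  assumes "good t" and "norm (z $ j - \<psi> t $ j) \<le> \<omega> t j"
  shows "norm (z $ j / x t ^ (m + d j) - profile t j) \<le> \<delta> t j"
    and "norm (z $ j / x t ^ (m + d j)) \<le> Y"
proof -
  have xn: "x t \<noteq> 0" using assms(1) by (rule good_x_nonzero)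
  have "z $ j / x t ^ (m + d j) - profile t j = (z $ j - \<psi> t $ j) / x t ^ (m + d j)"
    using xn by (simp add: \<psi>_def diff_divide_distrib)
  also have "norm \<dots> \<le> \<omega> t j / norm (x t) ^ (m + d j)"
    using assms(2) by (simp add: norm_divide norm_power divide_right_mono)
  also have "\<dots> = \<delta> t j" using \<omega>_eq[of t j] assms(1) xn by (simp add: good_def)
  finally show *: "norm (z $ j / x t ^ (m + d j) - profile t j) \<le> \<delta> t j" .
  have "norm (profile t j) + \<delta> t j \<le> Y" using assms(1) by (simp add: good_def)
  then show "norm (z $ j / x t ^ (m + d j)) \<le> Y"
    using * norm_triangle_ineq2[of "z $ j / x t ^ (m + d j)" "profile t j"] by linarith
qed

text \<open>The Lipschitz constant of \<open>F - id\<close> on the neighbourhood of radius \<open>\<omega>\<close>, measured in units of \<open>\<omega>\<close>.\<close>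

definition increment_bound :: "complex \<Rightarrow> 'n \<Rightarrow> real" where
  "increment_bound t i = (if i \<in> ends then 0 else \<omega> t (nxt i)) + norm (x t) ^ (2 * m) *
     (norm (a i) * (2 * (norm C0 + \<delta> t i1)) * \<delta> t i1 + norm (x t) * (K * (\<Sum>j\<in>UNIV. \<delta> t j)))"

text \<open>The square is Lipschitz with the sum of its arguments as constant, which near the curve is close to
  \<open>2 C0\<close>; the remainder \<open>H\<close> carries an additional factor \<open>x\<close>.\<close>

lemma F_diff_bound:
  assumes t: "good t" and z: "\<And>j. norm (z $ j - \<psi> t $ j) \<le> \<omega> t j" and z': "\<And>j. norm (z' $ j - \<psi> t $ j) \<le> \<omega> t j"
    and D: "\<And>j. norm (z $ j - z' $ j) \<le> D * \<omega> t j"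
  shows "norm ((F z - z) $ i - (F z' - z') $ i) \<le> D * increment_bound t i"
proof -
  define y where "y z j = z $ j / x t ^ (m + d j)" for z :: "complex^'n" and j
  have xn: "x t \<noteq> 0" using t by (rule good_x_nonzero)
  have x: "norm (x t) \<le> x0" and Re: "1 \<le> Re t" using t by (auto simp: good_def)
  have \<omega>: "0 < \<omega> t j" for j using lam[of j] Re by (simp add: \<omega>_def)
  have D0: "0 \<le> D"
    using order_trans[OF norm_ge_zero D[of i1]] \<omega>[of i1] by (simp add: zero_le_mult_iff)
  have yY: "norm (y z j) \<le> Y" "norm (y z' j) \<le> Y" for j
    unfolding y_def using box_scaled(2)[OF t z] box_scaled(2)[OF t z'] by auto
  have eq: "z = (\<chi> j. x t ^ (m + d j) * y z j)" for z using xn by (simp add: y_def vec_eq_iff)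
  have ex: "(F z - z) $ i = (if i \<in> ends then 0 else z $ nxt i)
      + x t ^ (2 * m) * (a i * (y z i1)\<^sup>2 + x t * H i (x t) (y z))" if "\<And>j. norm (y z j) \<le> Y" for z
  proof -
    have "i \<notin> ends \<Longrightarrow> x t ^ (m + d i + 1) * y z (nxt i) = z $ nxt i"
      using xn d_nxt[of i] by (simp add: y_def)
    moreover have "x t ^ (m + d i) * y z i = z $ i" using xn by (simp add: y_def)
    ultimately show ?thesis
      using expansion[of "x t" "y z" i, OF x that] eq[of z] by auto
  qed
  have y_diff: "norm (y z j - y z' j) \<le> D * \<delta> t j" for j
  proof -
    have "norm (y z j - y z' j) \<le> D * \<omega> t j / norm (x t) ^ (m + d j)"
      using D[of j] by (simp add: y_def diff_divide_distrib[symmetric] norm_divide norm_power divide_right_mono)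
    also have "\<dots> = D * \<delta> t j" using \<omega>_eq[of t j] t xn by (simp add: good_def)
    finally show ?thesis .
  qed
  have y1: "norm (y z i1 + y z' i1) \<le> 2 * (norm C0 + \<delta> t i1)"
  proof -
    have "norm (y z i1 - C0) \<le> \<delta> t i1" "norm (y z' i1 - C0) \<le> \<delta> t i1"
      using box_scaled(1)[OF t z, of i1] box_scaled(1)[OF t z', of i1] by (auto simp: y_def profile_i1)
    then have "norm (y z i1) \<le> norm C0 + \<delta> t i1" "norm (y z' i1) \<le> norm C0 + \<delta> t i1"
      using norm_triangle_ineq2[of "y z i1" C0] norm_triangle_ineq2[of "y z' i1" C0] by linarith+
    from order_trans[OF norm_triangle_ineq add_mono[OF this]] show ?thesis by simp
  qed
  have sq: "norm ((y z i1)\<^sup>2 - (y z' i1)\<^sup>2) \<le> (2 * (norm C0 + \<delta> t i1)) * (D * \<delta> t i1)"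
  proof -
    have "(y z i1)\<^sup>2 - (y z' i1)\<^sup>2 = (y z i1 + y z' i1) * (y z i1 - y z' i1)"
      by (simp add: power2_eq_square algebra_simps)
    then show ?thesis using \<delta>_nonneg[of t i1]
      by (simp only: norm_mult) (intro mult_mono y1 y_diff, auto)
  qed
  have Hd: "norm (H i (x t) (y z) - H i (x t) (y z')) \<le> K * (D * (\<Sum>j\<in>UNIV. \<delta> t j))"
  proof -
    have "norm (H i (x t) (y z) - H i (x t) (y z')) \<le> K * (\<Sum>j\<in>UNIV. norm (y z j - y z' j))"
      using H[of i, unfolded lipschitz_remainder_def, rule_format, of "x t" "y z" "y z'"] x yY by auto
    also have "\<dots> \<le> K * (\<Sum>j\<in>UNIV. D * \<delta> t j)"
      using K by (intro mult_left_mono sum_mono y_diff)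
    finally show ?thesis by (simp add: sum_distrib_left)
  qed
  have "(F z - z) $ i - (F z' - z') $ i = (if i \<in> ends then 0 else z $ nxt i - z' $ nxt i)
      + x t ^ (2 * m) * (a i * ((y z i1)\<^sup>2 - (y z' i1)\<^sup>2) + x t * (H i (x t) (y z) - H i (x t) (y z')))"
    unfolding ex[OF yY(1)] ex[OF yY(2)] by (simp add: algebra_simps)
  also have "norm \<dots> \<le> (if i \<in> ends then 0 else D * \<omega> t (nxt i)) + norm (x t) ^ (2 * m) *
     (norm (a i) * ((2 * (norm C0 + \<delta> t i1)) * (D * \<delta> t i1)) + norm (x t) * (K * (D * (\<Sum>j\<in>UNIV. \<delta> t j))))"
  proof (rule order_trans[OF norm_triangle_ineq add_mono])
    show "norm (if i \<in> ends then 0 else z $ nxt i - z' $ nxt i) \<le> (if i \<in> ends then 0 else D * \<omega> t (nxt i))"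
      using D[of "nxt i"] by simp
    have "norm (a i * ((y z i1)\<^sup>2 - (y z' i1)\<^sup>2)) \<le> norm (a i) * ((2 * (norm C0 + \<delta> t i1)) * (D * \<delta> t i1))"
      unfolding norm_mult[of "a i"] by (intro mult_left_mono sq norm_ge_zero)
    moreover have "norm (x t * (H i (x t) (y z) - H i (x t) (y z'))) \<le> norm (x t) * (K * (D * (\<Sum>j\<in>UNIV. \<delta> t j)))"
      unfolding norm_mult[of "x t"] by (intro mult_left_mono Hd norm_ge_zero)
    ultimately show "norm (x t ^ (2 * m) * (a i * ((y z i1)\<^sup>2 - (y z' i1)\<^sup>2)
          + x t * (H i (x t) (y z) - H i (x t) (y z'))))
        \<le> norm (x t) ^ (2 * m) * (norm (a i) * ((2 * (norm C0 + \<delta> t i1)) * (D * \<delta> t i1))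
          + norm (x t) * (K * (D * (\<Sum>j\<in>UNIV. \<delta> t j))))"
      unfolding norm_mult[of "x t ^ (2 * m)"] norm_power
      by (intro mult_left_mono order_trans[OF norm_triangle_ineq add_mono]) auto
  qed
  also have "\<dots> = D * increment_bound t i" by (simp add: increment_bound_def algebra_simps)
  finally show ?thesis .
qed

text \<open>After division by the scale of the decrement of \<open>\<omega>\<close> only the linear part and, at depth
  \<open>m - 1\<close>, the derivative of the square survive; this limit is the left-hand side of the
  inequality satisfied by the weights.\<close>

lemma increment_bound_limit:
  "((\<lambda>t. increment_bound t i * Re t powr (decay i + 1)) \<longlongrightarrow> (if i \<in> ends then 0 else lam (nxt i))
      + (if d i = m - 1 then 2 * norm (a i * C0) * lam i1 else 0)) strip_at_top"
proof -
  let ?k = "m - 1 - d i"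
  let ?M = "\<lambda>t. (if i \<in> ends then 0 else lam (nxt i)) + (1 / Re t) ^ ?k * inverse (ratio t) ^ (2 * m) *
     (norm (a i) * (2 * (norm C0 + \<delta> t i1)) * (ratio t ^ m * lam i1)
      + norm (x t) * (K * (\<Sum>j\<in>UNIV. ratio t ^ (m + d j) * lam j)))"
  have "((\<lambda>t. (1 / Re t) ^ ?k) \<longlongrightarrow> (if d i = m - 1 then 1 else 0)) strip_at_top"
  proof (cases "d i = m - 1")
    case False
    then have "?k \<noteq> 0" using d_less[of i] by simp
    have "((\<lambda>t. 1 / Re t) \<longlongrightarrow> 0) strip_at_top"
      by (rule filterlim_compose[OF _ filterlim_Re_strip]) real_asymp
    from tendsto_power[OF this, of ?k] show ?thesis using False \<open>?k \<noteq> 0\<close> by (simp add: power_0_left)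
  qed simp
  then have "(?M \<longlongrightarrow> (if i \<in> ends then 0 else lam (nxt i)) + (if d i = m - 1 then 1 else 0) * inverse 1 ^ (2 * m) *
     (norm (a i) * (2 * (norm C0 + 0)) * (1 ^ m * lam i1) + norm (0::complex) * (K * (\<Sum>j\<in>UNIV. 1 ^ (m + d j) * lam j)))) strip_at_top"
    by (intro tendsto_add tendsto_mult tendsto_const tendsto_power tendsto_inverse tendsto_ratio tendsto_\<delta>
        tendsto_norm tendsto_small_time tendsto_sum) auto
  also have "(if i \<in> ends then 0 else lam (nxt i)) + (if d i = m - 1 then 1 else 0) * inverse 1 ^ (2 * m) *
     (norm (a i) * (2 * (norm C0 + 0)) * (1 ^ m * lam i1) + norm (0::complex) * (K * (\<Sum>j\<in>UNIV. 1 ^ (m + d j) * lam j)))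
     = (if i \<in> ends then 0 else lam (nxt i)) + (if d i = m - 1 then 2 * norm (a i * C0) * lam i1 else 0)"
    by (simp add: norm_mult)
  finally have lim: "(?M \<longlongrightarrow> (if i \<in> ends then 0 else lam (nxt i))
      + (if d i = m - 1 then 2 * norm (a i * C0) * lam i1 else 0)) strip_at_top" .
  have "\<forall>\<^sub>F t in strip_at_top. ?M t = increment_bound t i * Re t powr (decay i + 1)"
    using eventually_good
  proof eventually_elim
    case (elim t)
    define \<tau> where "\<tau> = Re t"
    have \<tau>: "1 \<le> \<tau>" "u t \<noteq> 0" using elim by (auto simp: good_def \<tau>_def)
    have rat: "ratio t > 0" using \<tau> by (simp add: ratio_def \<tau>_def[symmetric])
    have nx: "norm (x t) = inverse (ratio t) * (1 / \<tau>)"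
      using \<tau> by (simp add: small_time_def ratio_def norm_divide \<tau>_def)
    have pw: "\<tau> powr (decay i + 1) * \<tau> powr (- 5 / 4) = \<tau> ^ (m + d i + 1)"
    proof -
      have "\<tau> powr (decay i + 1) * \<tau> powr (- 5 / 4) = \<tau> powr (real (m + d i + 1))"
        by (simp add: powr_add[symmetric] decay_def add_ac)
      then show ?thesis using \<tau> by (simp add: powr_realpow del: of_nat_add of_nat_Suc)
    qed
    have pk: "(1 / \<tau>) ^ (2 * m) * \<tau> ^ (m + d i + 1) = (1 / \<tau>) ^ ?k"
    proof -
      have "2 * m = ?k + (m + d i + 1)" using d_less[of i] by simp
      then have "(1 / \<tau>) ^ (2 * m) = (1 / \<tau>) ^ ?k * (1 / \<tau>) ^ (m + d i + 1)" by (metis power_add)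
      then show ?thesis using \<tau> by (simp add: power_one_over)
    qed
    define \<delta>' where "\<delta>' j = ratio t ^ (m + d j) * lam j" for j
    have \<delta>': "\<delta> t j = \<delta>' j * \<tau> powr (- 5 / 4)" for j by (simp add: \<delta>_def \<delta>'_def \<tau>_def)
    have sum': "(\<Sum>j\<in>UNIV. \<delta> t j) = (\<Sum>j\<in>UNIV. \<delta>' j) * \<tau> powr (- 5 / 4)"
      by (simp add: \<delta>' sum_distrib_right)
    have \<omega>': "i \<notin> ends \<Longrightarrow> \<omega> t (nxt i) * \<tau> powr (decay i + 1) = lam (nxt i)"
      using \<tau> by (simp add: \<omega>_def \<tau>_def[symmetric] decay_def d_nxt powr_add[symmetric])
    define A where "A = norm (a i) * (2 * (norm C0 + \<delta> t i1))"
    have "norm (x t) ^ (2 * m) * (A * \<delta> t i1 + norm (x t) * (K * (\<Sum>j\<in>UNIV. \<delta> t j))) * \<tau> powr (decay i + 1)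
        = norm (x t) ^ (2 * m) * (A * \<delta>' i1 + norm (x t) * (K * (\<Sum>j\<in>UNIV. \<delta>' j))) * (\<tau> powr (decay i + 1) * \<tau> powr (- 5 / 4))"
      unfolding sum' \<delta>'[of i1] by (simp add: algebra_simps)
    also have "\<dots> = inverse (ratio t) ^ (2 * m) * ((1 / \<tau>) ^ (2 * m) * \<tau> ^ (m + d i + 1))
        * (A * \<delta>' i1 + norm (x t) * (K * (\<Sum>j\<in>UNIV. \<delta>' j)))"
      unfolding pw nx power_mult_distrib by (simp add: mult_ac)
    also have "\<dots> = (1 / \<tau>) ^ ?k * inverse (ratio t) ^ (2 * m) * (A * \<delta>' i1 + norm (x t) * (K * (\<Sum>j\<in>UNIV. \<delta>' j)))"
      unfolding pk by (simp add: mult_ac)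
    finally have fin: "norm (x t) ^ (2 * m) * (A * \<delta> t i1 + norm (x t) * (K * (\<Sum>j\<in>UNIV. \<delta> t j))) * \<tau> powr (decay i + 1)
        = (1 / \<tau>) ^ ?k * inverse (ratio t) ^ (2 * m) * (A * \<delta>' i1 + norm (x t) * (K * (\<Sum>j\<in>UNIV. \<delta>' j)))" .
    have M: "?M t = (if i \<in> ends then 0 else lam (nxt i)) + (1 / \<tau>) ^ ?k * inverse (ratio t) ^ (2 * m) *
        (A * \<delta>' i1 + norm (x t) * (K * (\<Sum>j\<in>UNIV. \<delta>' j)))"
      by (simp only: A_def \<delta>'_def d_i1 add_0_right \<tau>_def)
    have incr: "increment_bound t i = (if i \<in> ends then 0 else \<omega> t (nxt i)) + norm (x t) ^ (2 * m) *
        (A * \<delta> t i1 + norm (x t) * (K * (\<Sum>j\<in>UNIV. \<delta> t j)))"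
      by (simp only: A_def increment_bound_def)
    show ?case
    proof (cases "i \<in> ends")
      case True
      show ?thesis
        unfolding M incr unfolding \<tau>_def[symmetric] distrib_right[of _ _ "\<tau> powr _"] fin using True by simp
    next
      case False
      show ?thesis
        unfolding M incr unfolding \<tau>_def[symmetric] distrib_right[of _ _ "\<tau> powr _"] fin using False \<omega>' by simp
    qed
  qed
  with lim show ?thesis by (rule Lim_transform_eventually)
qed

lemma \<omega>_step_limit:
  "((\<lambda>t. (\<omega> t i - \<omega> (t + 1) i) * Re t powr (decay i + 1)) \<longlongrightarrow> lam i * decay i) strip_at_top"
proof -
  have "((\<lambda>\<tau>::real. (\<tau> powr (- p) - (\<tau> + 1) powr (- p)) * \<tau> powr (p + 1)) \<longlongrightarrow> p) at_top" if "p > 0" for p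
    using that by real_asymp
  from this[of "decay i"] have "((\<lambda>\<tau>::real. (\<tau> powr (- decay i) - (\<tau> + 1) powr (- decay i)) * \<tau> powr (decay i + 1)) \<longlongrightarrow> decay i) at_top"
    by (simp add: decay_def add_pos_nonneg)
  from tendsto_mult[OF tendsto_const[of "lam i"] filterlim_compose[OF this filterlim_Re_strip]]
  show ?thesis by (simp add: \<omega>_def algebra_simps)
qed

text \<open>The residual has \<open>\<surd>t\<close> to spare over \<open>t\<^sup>-\<^sup>(\<^sup>m\<^sup>+\<^sup>d\<^sup>+\<^sup>2\<^sup>)\<close>, and the weights use up a quarter power of it.\<close>

lemma residual_limit:
  "((\<lambda>t. norm (F (\<psi> t) $ i - \<psi> (t + 1) $ i) * Re t powr (decay i + 1)) \<longlongrightarrow> 0) strip_at_top"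
proof -
  obtain c where c: "\<forall>\<^sub>F t in strip_at_top. norm (F (\<psi> t) $ i - \<psi> (t + 1) $ i)
      \<le> c * norm (x t ^ (m + d i + 2) * sqrt_decay t)"
    using residual_bigo by (rule landau_o.bigE)
  have "((\<lambda>t. c * (inverse (ratio t) ^ (m + d i + 2) * Re t powr (- 1 / 4))) \<longlongrightarrow> c * (inverse 1 ^ (m + d i + 2) * 0)) strip_at_top"
    by (intro tendsto_mult tendsto_const tendsto_power tendsto_inverse tendsto_ratio tendsto_Re_powr) auto
  then have lim: "((\<lambda>t. c * (inverse (ratio t) ^ (m + d i + 2) * Re t powr (- 1 / 4))) \<longlongrightarrow> 0) strip_at_top" by simp
  show ?thesis
  proof (rule Lim_null_comparison[OF _ lim])
    show "\<forall>\<^sub>F t in strip_at_top. norm (norm (F (\<psi> t) $ i - \<psi> (t + 1) $ i) * Re t powr (decay i + 1))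
        \<le> c * (inverse (ratio t) ^ (m + d i + 2) * Re t powr (- 1 / 4))"
      using c eventually_good
    proof eventually_elim
      case (elim t)
      define \<tau> where "\<tau> = Re t"
      have \<tau>: "1 \<le> \<tau>" "u t \<noteq> 0" using elim by (auto simp: good_def \<tau>_def)
      have nx: "norm (x t) = inverse (ratio t) * (1 / \<tau>)"
        using \<tau> by (simp add: small_time_def ratio_def norm_divide \<tau>_def)
      have "(1 / \<tau>) ^ (m + d i + 2) = \<tau> powr (- real (m + d i + 2))"
        using \<tau> by (simp add: powr_minus powr_realpow power_one_over inverse_eq_divide del: of_nat_add of_nat_Suc)
      then have pw: "(1 / \<tau>) ^ (m + d i + 2) * \<tau> powr (- 1 / 2) * \<tau> powr (decay i + 1) = \<tau> powr (- 1 / 4)"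
        by (simp add: powr_add[symmetric] decay_def)
      have "norm (x t ^ (m + d i + 2) * sqrt_decay t) = norm (x t) ^ (m + d i + 2) * \<tau> powr (- 1 / 2)"
        by (simp add: norm_mult norm_power sqrt_decay_def \<tau>_def)
      then have "norm (x t ^ (m + d i + 2) * sqrt_decay t) * \<tau> powr (decay i + 1)
          = inverse (ratio t) ^ (m + d i + 2) * \<tau> powr (- 1 / 4)"
        unfolding pw[symmetric] nx power_mult_distrib by (simp add: mult_ac)
      then show ?case
        using mult_right_mono[OF elim(1), of "\<tau> powr (decay i + 1)"]
        by (simp add: \<tau>_def[symmetric] mult.assoc)
    qed
  qed
qed

end

section \<open>The translation curve\<close>

definition translation_curve ::
    "(complex^'n::finite \<Rightarrow> complex^'n) \<Rightarrow> real \<Rightarrow> (complex \<Rightarrow> complex^'n) \<Rightarrow> bool" where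
  "translation_curve F R \<phi> \<longleftrightarrow>
     (\<forall>i. (\<lambda>t. \<phi> t $ i) holomorphic_on right_strip R) \<and> inj_on \<phi> (right_strip R) \<and>
     (\<forall>t\<in>right_strip R. \<phi> t \<noteq> 0 \<and> \<phi> (t + 1) = F (\<phi> t))"

context weighted_curve
begin

text \<open>All inequalities of lemma \<open>difference_equation_solution\<close> hold strictly in the limit, with a factor
  \<open>\<theta>\<close> between \<open>q\<close> and \<open>1\<close>, hence on some half-strip.\<close>

lemma curve_exists:
  "\<exists>R \<phi>. (\<forall>t\<in>right_strip R. good t) \<and> (\<forall>i. (\<lambda>t. \<phi> t $ i) holomorphic_on right_strip R)
    \<and> (\<forall>t\<in>right_strip R. \<forall>i. norm (\<phi> t $ i - \<psi> t $ i) \<le> \<omega> t i)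
    \<and> (\<forall>t\<in>right_strip R. \<phi> (t + 1) = F (\<phi> t))"
proof -
  define \<theta> where "\<theta> = (q + 1) / 2"
  have \<theta>: "0 \<le> \<theta>" "\<theta> < 1" "q < \<theta>" using q by (auto simp: \<theta>_def)
  have decay_pos: "0 < decay i" for i by (simp add: decay_def add_pos_nonneg)
  have ev_L: "\<forall>\<^sub>F t in strip_at_top. \<forall>i. increment_bound t i \<le> \<theta> * (\<omega> t i - \<omega> (t + 1) i)"
  proof (rule eventually_all_finite)
    fix i
    let ?b = "(if i \<in> ends then 0 else lam (nxt i)) + (if d i = m - 1 then 2 * norm (a i * C0) * lam i1 else 0)"
    have "((\<lambda>t. \<theta> * ((\<omega> t i - \<omega> (t + 1) i) * Re t powr (decay i + 1)) - increment_bound t i * Re t powr (decay i + 1))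
        \<longlongrightarrow> \<theta> * (lam i * decay i) - ?b) strip_at_top"
      by (intro tendsto_diff tendsto_mult tendsto_const \<omega>_step_limit increment_bound_limit)
    moreover have "0 < \<theta> * (lam i * decay i) - ?b"
      using weights[of i] mult_strict_right_mono[OF \<theta>(3) mult_pos_pos[OF lam[of i] decay_pos[of i]]]
      by (simp add: decay_def)
    ultimately have "\<forall>\<^sub>F t in strip_at_top.
        0 < \<theta> * ((\<omega> t i - \<omega> (t + 1) i) * Re t powr (decay i + 1)) - increment_bound t i * Re t powr (decay i + 1)"
      by (rule order_tendstoD(1))
    then show "\<forall>\<^sub>F t in strip_at_top. increment_bound t i \<le> \<theta> * (\<omega> t i - \<omega> (t + 1) i)"
    proof eventually_elim
      case (elim t)
      then have "0 < (\<theta> * (\<omega> t i - \<omega> (t + 1) i) - increment_bound t i) * Re t powr (decay i + 1)"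
        by (simp add: algebra_simps)
      then show ?case by (simp add: zero_less_mult_iff)
    qed
  qed
  have ev_res: "\<forall>\<^sub>F t in strip_at_top. \<forall>i. norm (F (\<psi> t) $ i - \<psi> (t + 1) $ i) \<le> (1 - \<theta>) * (\<omega> t i - \<omega> (t + 1) i)"
  proof (rule eventually_all_finite)
    fix i
    let ?r = "\<lambda>t. norm (F (\<psi> t) $ i - \<psi> (t + 1) $ i)"
    have "((\<lambda>t. (1 - \<theta>) * ((\<omega> t i - \<omega> (t + 1) i) * Re t powr (decay i + 1)) - ?r t * Re t powr (decay i + 1))
        \<longlongrightarrow> (1 - \<theta>) * (lam i * decay i) - 0) strip_at_top"
      by (intro tendsto_diff tendsto_mult tendsto_const \<omega>_step_limit residual_limit)
    moreover have "0 < (1 - \<theta>) * (lam i * decay i) - 0"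
      using \<theta> lam[of i] decay_pos[of i] by simp
    ultimately have "\<forall>\<^sub>F t in strip_at_top.
        0 < (1 - \<theta>) * ((\<omega> t i - \<omega> (t + 1) i) * Re t powr (decay i + 1)) - ?r t * Re t powr (decay i + 1)"
      by (rule order_tendstoD(1))
    then show "\<forall>\<^sub>F t in strip_at_top. ?r t \<le> (1 - \<theta>) * (\<omega> t i - \<omega> (t + 1) i)"
    proof eventually_elim
      case (elim t)
      then have "0 < ((1 - \<theta>) * (\<omega> t i - \<omega> (t + 1) i) - ?r t) * Re t powr (decay i + 1)"
        by (simp add: algebra_simps)
      then show ?case by (simp add: zero_less_mult_iff)
    qed
  qed
  have ev_r: "\<forall>\<^sub>F t in strip_at_top. \<forall>j. norm (\<psi> t $ j) + \<omega> t j < r"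
  proof (rule eventually_all_finite)
    fix j
    have "((\<lambda>t. norm (x t ^ (m + d j) * profile t j) + lam j * Re t powr (- decay j))
        \<longlongrightarrow> norm (0 ^ (m + d j) * C j) + lam j * 0) strip_at_top"
      using decay_pos[of j]
      by (intro tendsto_add tendsto_norm tendsto_mult tendsto_const tendsto_power tendsto_small_time
          tendsto_profile tendsto_Re_powr) auto
    moreover have "norm (0 ^ (m + d j) * C j) + lam j * 0 < r" using m r by (simp add: power_0_left)
    ultimately show "\<forall>\<^sub>F t in strip_at_top. norm (\<psi> t $ j) + \<omega> t j < r"
      using order_tendstoD(2) by (fastforce simp: \<psi>_def \<omega>_def)
  qed
  obtain R where R: "1 \<le> R" and all: "\<And>t. t \<in> right_strip R \<Longrightarrow> good t
      \<and> (\<forall>i. increment_bound t i \<le> \<theta> * (\<omega> t i - \<omega> (t + 1) i))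
      \<and> (\<forall>i. norm (F (\<psi> t) $ i - \<psi> (t + 1) $ i) \<le> (1 - \<theta>) * (\<omega> t i - \<omega> (t + 1) i))
      \<and> (\<forall>j. norm (\<psi> t $ j) + \<omega> t j < r)"
    using eventually_strip_obtain[OF eventually_conj[OF eventually_good eventually_conj[OF ev_L eventually_conj[OF ev_res ev_r]]], of 1]
    by blast
  have Re1: "1 < Re t" if "t \<in> right_strip R" for t using that R by (simp add: right_strip_def)
  have u_hol: "u holomorphic_on right_strip R"
    unfolding log_time_def[abs_def]
    by (intro holomorphic_intros) (use Re1 complex_nonpos_Reals_iff in force)
  have x_hol: "x holomorphic_on right_strip R"
    unfolding small_time_def[abs_def]
    by (intro holomorphic_intros u_hol) (use all in \<open>auto simp: good_def\<close>)
  show ?thesis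
  proof (rule difference_equation_solution[of "right_strip R" \<theta> \<psi> \<omega> F])
    show "open (right_strip R)" by (rule open_right_strip)
    show "t + 1 \<in> right_strip R" if "t \<in> right_strip R" for t using that by (rule right_strip_add_1)
    show "0 \<le> \<theta>" "\<theta> < 1" by fact+
    show "(\<lambda>t. \<psi> t $ i) holomorphic_on right_strip R" for i
      unfolding \<psi>_def profile_def by (simp add: holomorphic_intros x_hol)
    show "uniform_limit (right_strip R) (\<lambda>k t. \<omega> (t + of_nat k) i) (\<lambda>_. 0) sequentially" for i
    proof (rule uniform_limitI)
      fix e :: real assume "e > 0"
      have "((\<lambda>s::real. lam i * s powr (- decay i)) \<longlongrightarrow> lam i * 0) at_top"
        using decay_pos[of i] by (intro tendsto_mult tendsto_const tendsto_neg_powr filterlim_ident) simp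
      from filterlim_compose[OF this filterlim_real_sequentially]
      have "(\<lambda>k. lam i * real k powr (- decay i)) \<longlonglongrightarrow> 0" by simp
      from order_tendstoD(2)[OF this \<open>e > 0\<close>] eventually_gt_at_top[of 0]
      show "\<forall>\<^sub>F k in sequentially. \<forall>t\<in>right_strip R. dist (\<omega> (t + of_nat k) i) 0 < e"
      proof eventually_elim
        case (elim k)
        show ?case
        proof
          fix t assume "t \<in> right_strip R"
          then have "real k \<le> Re t + real k" using Re1[of t] by simp
          then have "(Re t + real k) powr (- decay i) \<le> real k powr (- decay i)"
            using elim decay_pos[of i] by (intro powr_mono2') auto
          from mult_left_mono[OF this less_imp_le[OF lam[of i]]] elim
          have "lam i * (Re t + real k) powr (- decay i) < e" by linarith
          then show "dist (\<omega> (t + of_nat k) i) 0 < e" using lam[of i] by (simp add: \<omega>_def abs_mult)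
        qed
      qed
    qed
    show "bdd_above ((\<lambda>t. \<omega> t i) ` right_strip R)" for i
    proof (rule bdd_aboveI2[of _ _ "lam i"])
      fix t assume "t \<in> right_strip R"
      then have "Re t powr (- decay i) \<le> 1 powr (- decay i)"
        using Re1[of t] decay_pos[of i] by (intro powr_mono2') auto
      from mult_left_mono[OF this less_imp_le[OF lam[of i]]] show "\<omega> t i \<le> lam i" using lam[of i] by (simp add: \<omega>_def)
    qed
    show "(\<lambda>t. F (\<phi> t) $ i) holomorphic_on right_strip R"
      if hol: "\<And>j. (\<lambda>t. \<phi> t $ j) holomorphic_on right_strip R"
        and box: "\<And>t j. t \<in> right_strip R \<Longrightarrow> norm (\<phi> t $ j - \<psi> t $ j) \<le> \<omega> t j" for \<phi> i
    proof (rule F_holomorphic[OF open_right_strip hol])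
      fix t j assume t: "t \<in> right_strip R"
      have "norm (\<psi> t $ j) + \<omega> t j < r" using all[OF t] by blast
      then show "norm (\<phi> t $ j) \<le> r"
        using box[OF t, of j] norm_triangle_ineq2[of "\<phi> t $ j" "\<psi> t $ j"] by linarith
    qed
    show "norm ((F z - z) $ i - (F w - w) $ i) \<le> \<theta> * D * (\<omega> t i - \<omega> (t + 1) i)"
      if t: "t \<in> right_strip R" and z: "\<And>j. norm (z $ j - \<psi> t $ j) \<le> \<omega> t j"
        and w: "\<And>j. norm (w $ j - \<psi> t $ j) \<le> \<omega> t j" and D: "\<And>j. norm (z $ j - w $ j) \<le> D * \<omega> t j" for t z w D i
    proof -
      have g: "good t" and Lt: "increment_bound t i \<le> \<theta> * (\<omega> t i - \<omega> (t + 1) i)" using all[OF t] by auto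
      have "0 < \<omega> t i1" using lam[of i1] Re1[OF t] by (simp add: \<omega>_def)
      moreover have "0 \<le> D * \<omega> t i1" using order_trans[OF norm_ge_zero D] .
      ultimately have "0 \<le> D" by (simp add: zero_le_mult_iff)
      have "norm ((F z - z) $ i - (F w - w) $ i) \<le> D * increment_bound t i" by (rule F_diff_bound[OF g z w D])
      also have "\<dots> \<le> D * (\<theta> * (\<omega> t i - \<omega> (t + 1) i))" by (rule mult_left_mono[OF Lt \<open>0 \<le> D\<close>])
      finally show ?thesis by (simp only: mult_ac)
    qed
    show "norm (F (\<psi> t) $ i - \<psi> (t + 1) $ i) \<le> (1 - \<theta>) * (\<omega> t i - \<omega> (t + 1) i)"
      if "t \<in> right_strip R" for t i using all[OF that] by blast
    fix \<phi> assume *: "\<And>i. (\<lambda>t. \<phi> t $ i) holomorphic_on right_strip R"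
      "\<And>t i. t \<in> right_strip R \<Longrightarrow> norm (\<phi> t $ i - \<psi> t $ i) \<le> \<omega> t i"
      "\<And>t. t \<in> right_strip R \<Longrightarrow> \<phi> (t + 1) = F (\<phi> t)"
    show ?thesis
    proof (intro exI conjI ballI allI)
      show "good t" if "t \<in> right_strip R" for t using all[OF that] by simp
    qed (rule *; assumption)+
  qed
qed

text \<open>The error is \<open>O(t\<^sup>-\<^sup>5\<^sup>/\<^sup>4)\<close> relative to the leading power, so the second coefficient \<open>B i\<close> is
  visible in the solution.\<close>

lemma scaled_limit:
  assumes good: "\<And>t. t \<in> right_strip R \<Longrightarrow> good t"
    and box: "\<And>t i. t \<in> right_strip R \<Longrightarrow> norm (\<phi> t $ i - \<psi> t $ i) \<le> \<omega> t i"
  shows "((\<lambda>t. u t * (u t ^ (m + d i) * \<phi> t $ i - C i - B i * x t)) \<longlongrightarrow> 0) strip_at_top"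
proof -
  have lim: "((\<lambda>t. ratio t ^ (m + d i + 1) * lam i * Re t powr (- 1 / 4)) \<longlongrightarrow> 0) strip_at_top"
  proof -
    have "((\<lambda>t. ratio t ^ (m + d i + 1) * lam i * Re t powr (- 1 / 4)) \<longlongrightarrow> 1 ^ (m + d i + 1) * lam i * 0) strip_at_top"
      by (intro tendsto_mult tendsto_power tendsto_const tendsto_ratio tendsto_Re_powr) simp
    then show ?thesis by simp
  qed
  show ?thesis
  proof (rule Lim_null_comparison[OF _ lim])
    show "\<forall>\<^sub>F t in strip_at_top. norm (u t * (u t ^ (m + d i) * \<phi> t $ i - C i - B i * x t))
        \<le> ratio t ^ (m + d i + 1) * lam i * Re t powr (- 1 / 4)"
      using eventually_right_strip[of R]
    proof eventually_elim
      case t: (elim t)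
      have g: "1 \<le> Re t" "u t \<noteq> 0" using good[OF t] by (auto simp: good_def)
      have "u t ^ (m + d i) * \<phi> t $ i - C i - B i * x t = \<phi> t $ i / x t ^ (m + d i) - profile t i"
        by (simp add: profile_def small_time_def power_one_over)
      then have "norm (u t * (u t ^ (m + d i) * \<phi> t $ i - C i - B i * x t)) \<le> norm (u t) * \<delta> t i"
        using box_scaled(1)[OF good[OF t] box[OF t]] by (simp add: norm_mult mult_left_mono)
      also have "norm (u t) = ratio t * Re t" using g by (simp add: ratio_def norm_divide)
      also have "ratio t * Re t * \<delta> t i = ratio t ^ (m + d i + 1) * lam i * (Re t * Re t powr (- 5 / 4))"
        by (simp add: \<delta>_def)
      also have "Re t * Re t powr (- 5 / 4) = Re t powr (- 1 / 4)"
        using g powr_add[of "Re t" 1 "- 5 / 4"] by simp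
      finally show ?case .
    qed
  qed
qed

text \<open>The block of \<open>i1\<close> has at least two rows, and the second one is, to leading order, the derivative of
  the first one.\<close>

lemma C_nxt_i1_nonzero: "C (nxt i1) \<noteq> 0"
proof
  assume "C (nxt i1) = 0"
  moreover have "d i1 \<noteq> m - 1" using m d_i1 by simp
  ultimately have "of_nat m * C i1 = 0" using C_recursion[of i1] i1_not_end d_i1 by simp
  then show False using m C_i1 C0_nonzero by simp
qed

lemma leading_limit:
  assumes "((\<lambda>t. u t * (u t ^ (m + d i) * \<phi> t $ i - C i - B i * x t)) \<longlongrightarrow> 0) strip_at_top"
  shows "((\<lambda>t. u t ^ (m + d i) * \<phi> t $ i) \<longlongrightarrow> C i) strip_at_top"
    and "((\<lambda>t. t ^ (m + d i) * \<phi> t $ i) \<longlongrightarrow> C i) strip_at_top"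
proof -
  have "((\<lambda>t. x t * (u t * (u t ^ (m + d i) * \<phi> t $ i - C i - B i * x t)) + C i + B i * x t)
      \<longlongrightarrow> 0 * 0 + C i + B i * 0) strip_at_top"
    by (intro tendsto_add tendsto_mult assms tendsto_const tendsto_small_time)
  moreover have "\<forall>\<^sub>F t in strip_at_top. x t * (u t * (u t ^ (m + d i) * \<phi> t $ i - C i - B i * x t)) + C i + B i * x t
      = u t ^ (m + d i) * \<phi> t $ i"
    using eventually_log_time_nonzero[of \<alpha>]
  proof eventually_elim
    case (elim t)
    then have "x t * u t = 1" by (simp add: small_time_def)
    then show ?case by (simp add: mult.assoc[symmetric])
  qed
  ultimately show *: "((\<lambda>t. u t ^ (m + d i) * \<phi> t $ i) \<longlongrightarrow> C i) strip_at_top"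
    using Lim_transform_eventually[of _ "0 * 0 + C i + B i * 0"] by simp
  have lim: "((\<lambda>t. inverse (u t / t) ^ (m + d i) * (u t ^ (m + d i) * \<phi> t $ i)) \<longlongrightarrow> inverse 1 ^ (m + d i) * C i) strip_at_top"
    by (intro tendsto_mult tendsto_power tendsto_inverse log_time_over_self *) simp
  have ev: "\<forall>\<^sub>F t in strip_at_top. inverse (u t / t) ^ (m + d i) * (u t ^ (m + d i) * \<phi> t $ i)
      = t ^ (m + d i) * \<phi> t $ i"
    using eventually_log_time_nonzero[of \<alpha>] by eventually_elim (simp add: power_divide)
  from Lim_transform_eventually[OF lim ev]
  show "((\<lambda>t. t ^ (m + d i) * \<phi> t $ i) \<longlongrightarrow> C i) strip_at_top" by simp
qed

text \<open>The quotient of the two coordinates recovers the corrected time up to an affine change and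
  an error that tends to \<open>0\<close>.\<close>

lemma ratio_of_components_limit:
  assumes "\<And>i. ((\<lambda>t. u t * (u t ^ (m + d i) * \<phi> t $ i - C i - B i * x t)) \<longlongrightarrow> 0) strip_at_top"
  shows "((\<lambda>t. \<phi> t $ i1 / \<phi> t $ nxt i1 - C0 / C (nxt i1) * u t)
     \<longlongrightarrow> - (C0 * B (nxt i1)) / (C (nxt i1))\<^sup>2) strip_at_top"
proof -
  let ?n = "nxt i1"
  define y where "y i t = u t ^ (m + d i) * \<phi> t $ i" for i t
  define R where "R i t = u t * (y i t - C i - B i * x t)" for i t
  have dn: "d ?n = 1" using d_nxt[OF i1_not_end] d_i1 by simp
  have R: "(R i \<longlongrightarrow> 0) strip_at_top" for i using assms[of i] by (simp add: R_def[abs_def] y_def)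
  have y: "(y i \<longlongrightarrow> C i) strip_at_top" for i using leading_limit(1)[OF assms] by (simp add: y_def[abs_def])
  have "((\<lambda>t. (R i1 t * C ?n - C0 * R ?n t - C0 * B ?n) / (y ?n t * C ?n))
      \<longlongrightarrow> (0 * C ?n - C0 * 0 - C0 * B ?n) / (C ?n * C ?n)) strip_at_top"
    by (intro tendsto_intros R y) (use C_nxt_i1_nonzero in simp)
  moreover have "\<forall>\<^sub>F t in strip_at_top. (R i1 t * C ?n - C0 * R ?n t - C0 * B ?n) / (y ?n t * C ?n)
      = \<phi> t $ i1 / \<phi> t $ ?n - C0 / C ?n * u t"
    using eventually_log_time_nonzero[of \<alpha>] tendsto_imp_eventually_ne[OF y C_nxt_i1_nonzero]
  proof eventually_elim
    case (elim t)
    have ux: "u t * x t = 1" using elim(1) by (simp add: small_time_def)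
    have R1: "R i1 t = u t * y i1 t - u t * C0"
      by (simp add: R_def B_i1 C_i1 algebra_simps)
    have Rn: "R ?n t = u t * y ?n t - u t * C ?n - B ?n"
      using ux by (simp add: R_def algebra_simps)
    have "(R i1 t * C ?n - C0 * R ?n t - C0 * B ?n) / (y ?n t * C ?n) = u t * y i1 t / y ?n t - C0 / C ?n * u t"
      unfolding R1 Rn using elim(2) C_nxt_i1_nonzero by (simp add: field_simps)
    moreover have "u t * y i1 t / y ?n t = \<phi> t $ i1 / \<phi> t $ ?n"
      using elim by (simp add: y_def dn d_i1)
    ultimately show ?case by simp
  qed
  ultimately show ?thesis
    using Lim_transform_eventually[of _ "(0 * C ?n - C0 * 0 - C0 * B ?n) / (C ?n * C ?n)"]
    by (simp add: power2_eq_square)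
qed

text \<open>Points are separated by following their orbits to infinity, where the ratio of two coordinates
  determines the time.\<close>

lemma translation_curve_exists:
  "\<exists>R \<phi>. translation_curve F R \<phi> \<and> (\<forall>i. ((\<lambda>t. t ^ (m + d i) * \<phi> t $ i) \<longlongrightarrow> C i) strip_at_top)"
proof -
  obtain R \<phi> where *: "(\<forall>t\<in>right_strip R. good t) \<and> (\<forall>i. (\<lambda>t. \<phi> t $ i) holomorphic_on right_strip R)
    \<and> (\<forall>t\<in>right_strip R. \<forall>i. norm (\<phi> t $ i - \<psi> t $ i) \<le> \<omega> t i)
    \<and> (\<forall>t\<in>right_strip R. \<phi> (t + 1) = F (\<phi> t))"
    using curve_exists by (elim exE)
  have good: "good t" if "t \<in> right_strip R" for t using * that by simp
  have hol: "(\<lambda>t. \<phi> t $ i) holomorphic_on right_strip R" for i using * by simp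
  have box: "norm (\<phi> t $ i - \<psi> t $ i) \<le> \<omega> t i" if "t \<in> right_strip R" for t i using * that by simp
  have conj: "\<phi> (t + 1) = F (\<phi> t)" if "t \<in> right_strip R" for t using * that by simp
  have sl: "((\<lambda>t. u t * (u t ^ (m + d i) * \<phi> t $ i - C i - B i * x t)) \<longlongrightarrow> 0) strip_at_top" for i
    by (rule scaled_limit[OF good box])
  have iter: "\<phi> (t + of_nat k) = (F ^^ k) (\<phi> t)" if t: "t \<in> right_strip R" for t k
  proof (induction k)
    case (Suc k)
    have "\<phi> (t + of_nat (Suc k)) = \<phi> (t + of_nat k + 1)" by (simp add: add_ac)
    also have "\<dots> = F (\<phi> (t + of_nat k))" by (rule conj[OF right_strip_add_nat[OF t]])
    finally show ?case by (simp add: Suc.IH)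
  qed simp
  show ?thesis
  proof (intro exI conjI allI)
    have "\<phi> t \<noteq> 0" if t: "t \<in> right_strip R" for t
    proof
      assume "\<phi> t = 0"
      moreover have "(F ^^ k) 0 = 0" for k by (induction k) (auto simp: F_0)
      ultimately have "\<phi> (t + of_nat k) = 0" for k using iter[OF t] by simp
      moreover have "(\<lambda>k. u (t + of_nat k) ^ (m + d i1) * \<phi> (t + of_nat k) $ i1) \<longlonglongrightarrow> C i1"
        by (rule filterlim_compose[OF leading_limit(1)[OF sl] filterlim_right_strip[OF t]])
      ultimately have "(\<lambda>k::nat. 0) \<longlonglongrightarrow> C i1" using m by (simp add: power_0_left)
      then have "C i1 = 0" by (simp add: LIMSEQ_const_iff)
      then show False using C_i1 C0_nonzero by simp
    qed
    moreover have "inj_on \<phi> (right_strip R)"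
    proof (rule inj_onI)
      fix s t assume s: "s \<in> right_strip R" and t: "t \<in> right_strip R" and eq: "\<phi> s = \<phi> t"
      let ?c = "C0 / C (nxt i1)"
      let ?g = "\<lambda>t. \<phi> t $ i1 / \<phi> t $ nxt i1 - ?c * u t"
      note lim = filterlim_compose[OF ratio_of_components_limit[OF sl] filterlim_right_strip]
      have "(\<lambda>k. ?g (s + of_nat k) - ?g (t + of_nat k)) \<longlonglongrightarrow> 0"
        using tendsto_diff[OF lim[OF s] lim[OF t]] by simp
      moreover have "?g (s + of_nat k) - ?g (t + of_nat k) = ?c * (u (t + of_nat k) - u (s + of_nat k))" for k
        using iter[OF s, of k] iter[OF t, of k] eq by (simp add: algebra_simps diff_divide_distrib)
      ultimately have "(\<lambda>k. ?c * (u (t + of_nat k) - u (s + of_nat k))) \<longlonglongrightarrow> 0" by simp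
      moreover have "(\<lambda>k. ?c * (u (t + of_nat k) - u (s + of_nat k))) \<longlonglongrightarrow> ?c * (t - s)"
        by (intro tendsto_mult tendsto_const log_time_difference) (use s t in \<open>auto simp: right_strip_def\<close>)
      ultimately have "?c * (t - s) = 0" by (rule LIMSEQ_unique[rotated])
      then show "s = t" using C0_nonzero C_nxt_i1_nonzero by simp
    qed
    ultimately show "translation_curve F R \<phi>"
      using hol conj by (simp add: translation_curve_def)
    show "((\<lambda>t. t ^ (m + d i) * \<phi> t $ i) \<longlongrightarrow> C i) strip_at_top" for i by (rule leading_limit(2)[OF sl])
  qed
qed

end

lemma lipschitz_remainder_mono:
  assumes "lipschitz_remainder x0 Y K H" "x0' \<le> x0" "K \<le> K'"
  shows "lipschitz_remainder x0' Y K' H"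
  unfolding lipschitz_remainder_def
proof (intro allI impI conjI)
  fix x :: complex and y y' :: "'a \<Rightarrow> complex"
  assume *: "norm x \<le> x0' \<and> (\<forall>j. norm (y j) \<le> Y) \<and> (\<forall>j. norm (y' j) \<le> Y)"
  then have "norm x \<le> x0 \<and> (\<forall>j. norm (y j) \<le> Y) \<and> (\<forall>j. norm (y' j) \<le> Y)" using assms(2) by auto
  with assms(1) have 1: "norm (H x y - H x y') \<le> K * (\<Sum>j\<in>UNIV. norm (y j - y' j))"
    and 2: "norm (H x y - H 0 y) \<le> K * norm x"
    unfolding lipschitz_remainder_def by blast+
  show "norm (H x y - H x y') \<le> K' * (\<Sum>j\<in>UNIV. norm (y j - y' j))"
    using 1 mult_right_mono[OF assms(3), of "\<Sum>j\<in>UNIV. norm (y j - y' j)"] by (simp add: sum_nonneg)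
  show "norm (H x y - H 0 y) \<le> K' * norm x"
    using 2 mult_right_mono[OF assms(3), of "norm x"] by simp
qed

text \<open>The size \<open>Y\<close> of the weighted polydisc is dictated by the leading coefficients; with it the
  remainders \<open>H\<close> are fixed, and with these \<open>\<alpha>\<close> and \<open>B\<close>.\<close>

theorem (in jordan_chains) exists_translation_curve:
  fixes F :: "complex^'n \<Rightarrow> complex^'n"
  assumes F_0: "F 0 = 0" and r: "0 < r"
    and F_hol: "\<And>V \<phi> i. \<lbrakk>open V; \<And>j. (\<lambda>t. \<phi> t $ j) holomorphic_on V;
        \<And>t j. t \<in> V \<Longrightarrow> norm (\<phi> t $ j) \<le> r\<rbrakk> \<Longrightarrow> (\<lambda>t. F (\<phi> t) $ i) holomorphic_on V"
    and expansion: "\<And>i Y. 0 < Y \<Longrightarrow> \<exists>x0 K H. 0 < x0 \<and> 0 \<le> K \<and> lipschitz_remainder x0 Y K H \<and>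
        (\<forall>x y. norm x \<le> x0 \<and> (\<forall>j. norm (y j) \<le> Y) \<longrightarrow>
          F (\<chi> j. x ^ (m + d j) * y j) $ i = x ^ (m + d i) * y i
            + (if i \<in> ends then 0 else x ^ (m + d i + 1) * y (nxt i))
            + x ^ (2 * m) * (a i * (y i1)\<^sup>2 + x * H x y))"
  shows "\<exists>R \<phi>. translation_curve F R \<phi> \<and> (\<forall>i. ((\<lambda>t. t ^ (m + d i) * \<phi> t $ i) \<longlongrightarrow> C i) strip_at_top)"
proof -
  define Y where "Y = 1 + (\<Sum>j\<in>UNIV. norm (C j))"
  have Y: "norm (C j) < Y" for j
    using member_le_sum[of j UNIV "\<lambda>j. norm (C j)"] by (simp add: Y_def)
  have "0 < Y" using Y[of i1] norm_ge_zero[of "C i1"] by linarith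
  define E where "E i x0 K H \<longleftrightarrow> 0 < x0 \<and> 0 \<le> K \<and> lipschitz_remainder x0 Y K H \<and>
        (\<forall>x y. norm x \<le> x0 \<and> (\<forall>j. norm (y j) \<le> Y) \<longrightarrow>
          F (\<chi> j. x ^ (m + d j) * y j) $ i = x ^ (m + d i) * y i
            + (if i \<in> ends then 0 else x ^ (m + d i + 1) * y (nxt i))
            + x ^ (2 * m) * (a i * (y i1)\<^sup>2 + x * H x y))" for i x0 K H
  have "\<forall>i. \<exists>x0 K H. E i x0 K H" using expansion[OF \<open>0 < Y\<close>] by (simp only: E_def) blast
  from choice[OF this] obtain x0' where "\<forall>i. \<exists>K H. E i (x0' i) K H" ..
  from choice[OF this] obtain K' where "\<forall>i. \<exists>H. E i (x0' i) (K' i) H" ..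
  from choice[OF this] obtain H where E: "\<forall>i. E i (x0' i) (K' i) (H i)" ..
  note H = E[unfolded E_def]
  define x0 where "x0 = Min (range x0')"
  define K where "K = (\<Sum>i\<in>UNIV. K' i)"
  have x0: "0 < x0" "x0 \<le> x0' i" for i using H by (auto simp: x0_def)
  have K: "0 \<le> K" "K' i \<le> K" for i using H by (auto simp: K_def intro!: sum_nonneg member_le_sum)
  obtain \<alpha> B where B1: "B i1 = 0" and B: "\<And>i. of_nat (m + d i + 1) * B i
      = (of_nat ((m + d i) * (m + d i + 1)) / 2 * C i - (if d i = m - 1 then H i 0 C else 0)
          - (if d i + 2 = m then a i * C0\<^sup>2 else 0))
        - of_nat (m + d i) * \<alpha> * C i - (if i \<in> ends then 0 else B (nxt i))"
    using second_order_coefficients[of "\<lambda>i. of_nat ((m + d i) * (m + d i + 1)) / 2 * C i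
        - (if d i = m - 1 then H i 0 C else 0) - (if d i + 2 = m then a i * C0\<^sup>2 else 0)"] by blast
  obtain lam q where lam: "\<And>i. 0 < lam i" and q: "0 < q" "q < 1"
    and weights: "\<And>i. (if i \<in> ends then 0 else lam (nxt i))
        + (if d i = m - 1 then 2 * norm (a i * C0) * lam i1 else 0)
        \<le> q * (lam i * (real m + 5 / 4 + real (d i)))"
    using contracting_weights[of "real m + 5 / 4"] by auto
  interpret weighted_curve m d nxt ends last_of i1 a F H x0 Y K \<alpha> B lam q r
  proof unfold_locales
    show "lipschitz_remainder x0 Y K (H i)" for i using H x0 K lipschitz_remainder_mono by blast
    show "F (\<chi> j. x ^ (m + d j) * y j) $ i = x ^ (m + d i) * y i
        + (if i \<in> ends then 0 else x ^ (m + d i + 1) * y (nxt i))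
        + x ^ (2 * m) * (a i * (y i1)\<^sup>2 + x * H i x y)"
      if "norm x \<le> x0" "\<And>j. norm (y j) \<le> Y" for x y i
      using H[rule_format, of i] x0(2)[of i] that by auto
    show "(\<lambda>t. F (\<phi> t) $ i) holomorphic_on V"
      if "open V" "\<And>j. (\<lambda>t. \<phi> t $ j) holomorphic_on V" "\<And>t j. t \<in> V \<Longrightarrow> norm (\<phi> t $ j) \<le> r" for V \<phi> i
      using that by (rule F_hol)
    show "of_nat (m + d i + 1) * B i
      = (of_nat ((m + d i) * (m + d i + 1)) / 2 * C i - (if d i = m - 1 then H i 0 C else 0)
          - (if d i + 2 = m then a i * C0\<^sup>2 else 0))
        - of_nat (m + d i) * \<alpha> * C i - (if i \<in> ends then 0 else B (nxt i))" for i by (rule B)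
    show "(if i \<in> ends then 0 else lam (nxt i))
        + (if d i = m - 1 then 2 * norm (a i * C0) * lam i1 else 0)
        \<le> q * (lam i * (real m + 5 / 4 + real (d i)))" for i by (rule weights)
  qed (use x0 K Y B1 lam q r F_0 in auto)
  show ?thesis by (rule translation_curve_exists)
qed

section \<open>Positions and depths in Jordan blocks\<close>

lemma block_offset_Suc: "1 \<le> l \<Longrightarrow> block_offset \<mu> (Suc l) = block_offset \<mu> l + \<mu> l"
  by (simp add: block_offset_def atLeastLessThanSuc)

lemma block_offset_1: "block_offset \<mu> (Suc 0) = 0"
  by (simp add: block_offset_def)

lemma block_offset_mono: "l \<le> l' \<Longrightarrow> block_offset \<mu> l \<le> block_offset \<mu> l'"
  unfolding block_offset_def by (intro sum_mono2) auto

text \<open>The index type is enumerated by \<open>ix\<close>. The condition \<open>gap\<close> makes the first block the only longest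
  one.\<close>

locale jordan_blocks =
  fixes ix :: "nat \<Rightarrow> 'n::finite" and \<rho> :: nat and \<mu> :: "nat \<Rightarrow> nat"
  assumes ix: "bij_betw ix {1..CARD('n)} UNIV"
    and \<rho>: "1 \<le> \<rho>" and \<mu>_decreasing: "\<forall>l\<in>{1..<\<rho>}. \<mu> (l + 1) \<le> \<mu> l"
    and total: "(\<Sum>l\<in>{1..\<rho>}. \<mu> l) = CARD('n)"
    and gap: "\<rho> = 1 \<or> \<mu> 1 > \<mu> 2" and \<mu>_1: "2 \<le> \<mu> 1"
begin

abbreviation "\<nu> \<equiv> block_offset \<mu>"

definition pos :: "'n \<Rightarrow> nat" where "pos i = inv_into {1..CARD('n)} ix i"

definition in_block :: "nat \<Rightarrow> nat \<Rightarrow> bool" where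
  "in_block l j \<longleftrightarrow> l \<in> {1..\<rho>} \<and> \<nu> l < j \<and> j \<le> \<nu> l + \<mu> l"

definition blk :: "'n \<Rightarrow> nat" where "blk i = (THE l. in_block l (pos i))"

text \<open>Depths start at \<open>0\<close> in the first block and at \<open>1\<close> in every other one; as the other blocks are
  shorter than the first, all depths stay below \<open>\<mu> 1\<close>.\<close>

definition depth :: "'n \<Rightarrow> nat" where
  "depth i = (if blk i = 1 then pos i - 1 else pos i - \<nu> (blk i))"

definition nxt :: "'n \<Rightarrow> 'n" where "nxt i = ix (pos i + 1)"

definition last_of :: "'n \<Rightarrow> 'n" where "last_of i = ix (\<nu> (blk i) + \<mu> (blk i))"

definition ends :: "'n set" where "ends = {i. pos i = \<nu> (blk i) + \<mu> (blk i)}"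

lemma pos_range: "1 \<le> pos i" "pos i \<le> CARD('n)"
proof -
  have "pos i \<in> {1..CARD('n)}"
    unfolding pos_def by (rule inv_into_into) (use ix in \<open>simp add: bij_betw_def\<close>)
  then show "1 \<le> pos i" "pos i \<le> CARD('n)" by auto
qed

lemma ix_pos: "ix (pos i) = i"
  unfolding pos_def by (rule f_inv_into_f) (use ix in \<open>simp add: bij_betw_def\<close>)

lemma pos_ix: "1 \<le> j \<Longrightarrow> j \<le> CARD('n) \<Longrightarrow> pos (ix j) = j"
  unfolding pos_def by (rule inv_into_f_f) (use ix in \<open>auto simp: bij_betw_def\<close>)

lemma offset_total: "\<nu> (Suc \<rho>) = CARD('n)"
  using total by (simp add: block_offset_def atLeastLessThanSuc_atLeastAtMost)

lemma block_end_le: "l \<in> {1..\<rho>} \<Longrightarrow> \<nu> l + \<mu> l \<le> CARD('n)"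
  using block_offset_mono[of "Suc l" "Suc \<rho>" \<mu>] block_offset_Suc[of l \<mu>] offset_total by simp

lemma in_block_unique: "in_block l j \<Longrightarrow> in_block l' j \<Longrightarrow> l = l'"
proof (induction l l' rule: linorder_wlog)
  case (le l l')
  show ?case
  proof (rule ccontr)
    assume "l \<noteq> l'"
    then have "\<nu> (Suc l) \<le> \<nu> l'" using le by (intro block_offset_mono) simp
    then show False using le block_offset_Suc[of l \<mu>] by (simp add: in_block_def)
  qed
qed simp

lemma in_block_exists:
  assumes "1 \<le> j" "j \<le> CARD('n)"
  shows "\<exists>l. in_block l j"
proof -
  have "j \<le> \<nu> (Suc k) \<Longrightarrow> k \<le> \<rho> \<Longrightarrow> \<exists>l. in_block l j" for k
  proof (induction k)
    case 0
    then show ?case using assms(1) by (simp add: block_offset_1)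
  next
    case (Suc k)
    show ?case
    proof (cases "j \<le> \<nu> (Suc k)")
      case True
      then show ?thesis using Suc by simp
    next
      case False
      then have "in_block (Suc k) j"
        using Suc.prems block_offset_Suc[of "Suc k" \<mu>] by (simp add: in_block_def)
      then show ?thesis by blast
    qed
  qed
  from this[of \<rho>] show ?thesis using assms(2) offset_total by simp
qed

lemma blk_eq: "in_block l (pos i) \<Longrightarrow> blk i = l"
  unfolding blk_def using in_block_unique by blast

lemma in_block_blk: "in_block (blk i) (pos i)"
  using in_block_exists[OF pos_range] blk_eq by metis

lemma blk_ix: "in_block l j \<Longrightarrow> blk (ix j) = l \<and> pos (ix j) = j"
proof -
  assume l: "in_block l j"
  then have "pos (ix j) = j" using block_end_le[of l] by (intro pos_ix) (auto simp: in_block_def)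
  then show ?thesis using blk_eq[of l "ix j"] l by simp
qed

lemma in_block_1: "in_block 1 j \<longleftrightarrow> 1 \<le> j \<and> j \<le> \<mu> 1"
  using \<rho> by (auto simp: in_block_def block_offset_1)

lemma block_1_ix: "1 \<le> j \<Longrightarrow> j \<le> \<mu> 1 \<Longrightarrow> blk (ix j) = 1 \<and> pos (ix j) = j"
  using blk_ix in_block_1 by blast

lemma \<mu>_less: "2 \<le> l \<Longrightarrow> l \<le> \<rho> \<Longrightarrow> \<mu> l < \<mu> 1"
proof (induction l rule: dec_induct)
  case base
  then show ?case using gap by auto
next
  case (step l)
  then have "\<mu> (l + 1) \<le> \<mu> l" using \<mu>_decreasing by auto
  then show ?case using step by simp
qed

lemma same_block_nxt:
  assumes "i \<notin> ends"
  shows "blk (nxt i) = blk i \<and> pos (nxt i) = pos i + 1"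
proof -
  have "in_block (blk i) (pos i + 1)"
    using in_block_blk[of i] assms by (auto simp: in_block_def ends_def)
  then show ?thesis unfolding nxt_def by (rule blk_ix)
qed

lemma blk_range: "1 \<le> blk i" "blk i \<le> \<rho>" "\<nu> (blk i) < pos i" "pos i \<le> \<nu> (blk i) + \<mu> (blk i)"
  using in_block_blk[of i] by (auto simp: in_block_def)

lemma blocks_form_chains:
  assumes "a (ix (\<mu> 1)) \<noteq> 0"
  shows "jordan_chains (\<mu> 1) depth nxt ends last_of (ix 1) a"
proof
  show "2 \<le> \<mu> 1" by (rule \<mu>_1)
  have first: "blk (ix 1) = 1 \<and> pos (ix 1) = 1" using \<mu>_1 by (intro block_1_ix) auto
  then show "depth (ix 1) = 0" by (simp add: depth_def)
  show "0 < depth i" if "i \<noteq> ix 1" for i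
  proof -
    have "pos i \<noteq> 1" using that ix_pos[of i] by auto
    then show ?thesis using pos_range[of i] blk_range[of i] by (auto simp: depth_def)
  qed
  show "depth i < \<mu> 1" for i
  proof (cases "blk i = 1")
    case True
    then show ?thesis using blk_range[of i] pos_range[of i] by (simp add: depth_def block_offset_1)
  next
    case False
    then have "\<mu> (blk i) < \<mu> 1" using blk_range[of i] by (intro \<mu>_less) auto
    then show ?thesis using False blk_range[of i] by (simp add: depth_def)
  qed
  show "depth (nxt i) = depth i + 1" if "i \<notin> ends" for i
    using same_block_nxt[OF that] blk_range[of i] pos_range[of i] by (auto simp: depth_def Suc_diff_le)
  show "last_of (nxt i) = last_of i" if "i \<notin> ends" for i
    using same_block_nxt[OF that] by (simp add: last_of_def)
  show "last_of i = i" if "i \<in> ends" for i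
    using that ix_pos[of i] by (simp add: last_of_def ends_def)
  have last1: "last_of (ix 1) = ix (\<mu> 1)" using first by (simp add: last_of_def block_offset_1)
  show "a (last_of (ix 1)) \<noteq> 0" using assms last1 by simp
  show "depth (last_of (ix 1)) = \<mu> 1 - 1"
    unfolding last1 using block_1_ix[of "\<mu> 1"] \<mu>_1 by (simp add: depth_def)
qed

lemma jordan_form_apply:
  fixes A :: "complex^'n^'n"
  assumes "unipotent_jordan_form ix \<rho> \<mu> A"
  shows "(A *v z) $ i = z $ i + (if i \<in> ends then 0 else z $ nxt i)"
proof -
  have l: "blk i \<in> {1..\<rho>}" using blk_range[of i] by simp
  note jf = assms[unfolded unipotent_jordan_form_def, rule_format, OF l, of z]
  show ?thesis
  proof (cases "i \<in> ends")
    case True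
    then show ?thesis using jf ix_pos[of i] by (simp add: ends_def)
  next
    case False
    then have "pos i \<in> {\<nu> (blk i) + 1..<\<nu> (blk i) + \<mu> (blk i)}"
      using blk_range[of i] by (simp add: ends_def)
    then have "(A *v z) $ ix (pos i) = z $ ix (pos i) + z $ ix (pos i + 1)" using jf by blast
    then show ?thesis using False ix_pos[of i] by (simp add: nxt_def)
  qed
qed

end

section \<open>From translation curves to parabolic curves\<close>

text \<open>The shift by \<open>1\<close> compensates for \<open>Re (Ln \<zeta>) < ln 2\<close> on \<open>\<Delta>\<close>.\<close>

definition strip_chart :: "real \<Rightarrow> complex \<Rightarrow> complex" where
  "strip_chart R \<zeta> = of_real (R + 1) - Ln \<zeta>"

lemma Delta_Re_pos: "\<zeta> \<in> \<Delta> \<Longrightarrow> 0 < Re \<zeta>"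
  using abs_Re_le_cmod[of "1 - \<zeta>"] by (simp add: dist_norm)

lemma strip_chart_in_right_strip:
  assumes "\<zeta> \<in> \<Delta>"
  shows "strip_chart R \<zeta> \<in> right_strip R"
proof -
  have Re: "0 < Re \<zeta>" using assms by (rule Delta_Re_pos)
  then have "\<zeta> \<noteq> 0" by auto
  have "norm \<zeta> < 2" using assms norm_triangle_ineq2[of \<zeta> 1] by (simp add: dist_norm norm_minus_commute)
  then have "ln (norm \<zeta>) < ln 2" using \<open>\<zeta> \<noteq> 0\<close> by simp
  also have "\<dots> \<le> 1" using ln_add_one_self_le_self[of 1] by simp
  finally have "ln (norm \<zeta>) < 1" .
  moreover have "\<bar>Im (Ln \<zeta>)\<bar> < 2" using Re_Ln_pos_lt_imp[OF Re] pi_half_less_two by linarith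
  ultimately show ?thesis using \<open>\<zeta> \<noteq> 0\<close> by (simp add: strip_chart_def right_strip_def)
qed

lemma strip_chart_holomorphic: "strip_chart R holomorphic_on \<Delta>"
  unfolding strip_chart_def[abs_def]
  by (intro holomorphic_intros) (use Delta_Re_pos complex_nonpos_Reals_iff in force)

lemma strip_chart_inj: "inj_on (strip_chart R) \<Delta>"
proof (rule inj_onI)
  fix s t assume "s \<in> \<Delta>" "t \<in> \<Delta>" "strip_chart R s = strip_chart R t"
  then have "Ln s = Ln t" "s \<noteq> 0" "t \<noteq> 0" using Delta_Re_pos[of s] Delta_Re_pos[of t] by (auto simp: strip_chart_def)
  then show "s = t" by (metis exp_Ln)
qed

lemma Delta_scale:
  assumes "\<zeta> \<in> \<Delta>" "0 < c" "c \<le> 1"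
  shows "of_real c * \<zeta> \<in> \<Delta>"
proof -
  have "1 - of_real c * \<zeta> = of_real (1 - c) + of_real c * (1 - \<zeta>)" by (simp add: algebra_simps)
  then have "norm (1 - of_real c * \<zeta>) \<le> norm (of_real (1 - c) :: complex) + norm (of_real c * (1 - \<zeta>))"
    using norm_triangle_ineq by metis
  also have "\<dots> = (1 - c) + c * norm (1 - \<zeta>)"
    using assms(2,3) unfolding norm_mult norm_of_real by simp
  also have "c * norm (1 - \<zeta>) < c * 1"
    using assms(1,2) by (intro mult_strict_left_mono) (auto simp: dist_norm)
  finally show ?thesis by (simp add: dist_norm)
qed

text \<open>Adding \<open>1\<close> to the chart divides \<open>\<zeta>\<close> by \<open>e\<close>, and \<open>\<Delta>\<close> is stable under such contractions although it does
  not contain \<open>0\<close>.\<close>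

lemma strip_chart_add_1:
  assumes "\<zeta> \<in> \<Delta>"
  shows "\<exists>\<zeta>'\<in>\<Delta>. strip_chart R \<zeta>' = strip_chart R \<zeta> + 1"
proof
  define c :: real where "c = exp (- 1)"
  have c: "0 < c" "c \<le> 1" by (auto simp: c_def)
  show "of_real c * \<zeta> \<in> \<Delta>" using Delta_scale[OF assms c] .
  have Re: "0 < Re \<zeta>" using assms by (rule Delta_Re_pos)
  have "Ln (of_real c * \<zeta>) = Ln (\<zeta> / of_real (exp 1))"
    by (simp add: c_def exp_minus divide_inverse mult.commute)
  also have "\<dots> = Ln \<zeta> - Ln (of_real (exp 1))" by (rule Ln_diff_eq[OF Re]) simp
  also have "Ln (of_real (exp 1)) = 1" using Ln_of_real[of "exp 1"] by simp
  finally show "strip_chart R (of_real c * \<zeta>) = strip_chart R \<zeta> + 1" by (simp add: strip_chart_def)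
qed

lemma filterlim_strip_chart: "filterlim (strip_chart R) strip_at_top (at 0 within \<Delta>)"
  unfolding filterlim_strip_at_top_iff
proof
  have "eventually (\<lambda>\<zeta>. \<zeta> \<in> \<Delta>) (at 0 within \<Delta>)" by (simp add: eventually_at_filter)
  then show "\<forall>\<^sub>F \<zeta> in at 0 within \<Delta>. \<bar>Im (strip_chart R \<zeta>)\<bar> < 2"
    by eventually_elim (use strip_chart_in_right_strip[of _ R] in \<open>simp add: right_strip_def\<close>)
  have "filterlim (\<lambda>\<zeta>::complex. norm \<zeta>) (at_right 0) (at 0 within \<Delta>)"
    unfolding filterlim_at
    by (auto simp: eventually_at_filter intro!: tendsto_norm_zero tendsto_ident_at)
  then have "filterlim (\<lambda>\<zeta>::complex. ln (norm \<zeta>)) at_bot (at 0 within \<Delta>)"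
    by (rule filterlim_compose[OF ln_at_0])
  then have "filterlim (\<lambda>\<zeta>::complex. (R + 1) + - ln (norm \<zeta>)) at_top (at 0 within \<Delta>)"
    by (intro filterlim_tendsto_add_at_top[OF tendsto_const]) (simp add: filterlim_uminus_at_top)
  moreover have "\<forall>\<^sub>F \<zeta> in at 0 within \<Delta>. (R + 1) + - ln (norm \<zeta>) = Re (strip_chart R \<zeta>)"
    by (auto simp: eventually_at_filter strip_chart_def)
  ultimately show "filterlim (\<lambda>\<zeta>. Re (strip_chart R \<zeta>)) at_top (at 0 within \<Delta>)"
    by (rule filterlim_cong[OF refl refl, THEN iffD1, rotated])
qed

lemma translation_curve_iterate:
  assumes "translation_curve F R \<phi>" "t \<in> right_strip R"
  shows "(F ^^ k) (\<phi> t) = \<phi> (t + of_nat k)"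
proof (induction k)
  case (Suc k)
  have "\<phi> (t + of_nat (Suc k)) = \<phi> (t + of_nat k + 1)" by (simp add: add_ac)
  also have "\<dots> = F (\<phi> (t + of_nat k))"
    using assms right_strip_add_nat by (simp add: translation_curve_def)
  finally show ?case by (simp add: Suc.IH)
qed simp

lemma right_strip_subset: "R \<le> R' \<Longrightarrow> right_strip R' \<subseteq> right_strip R"
  by (auto simp: right_strip_def)

lemma translation_curve_restrict:
  assumes "translation_curve F R \<phi>" "R \<le> R'"
  shows "translation_curve F R' \<phi>"
  using assms(1) right_strip_subset[OF assms(2)]
  unfolding translation_curve_def
  by (meson holomorphic_on_subset inj_on_subset subsetD)

text \<open>As the real parts on the half-strip are bounded below, the iterates converge to \<open>0\<close> uniformly on the
  whole curve.\<close>

theorem parabolic_curve_of_translation_curve: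
  assumes \<phi>: "translation_curve F R \<phi>" and lim: "(\<phi> \<longlongrightarrow> 0) strip_at_top" and U: "\<phi> ` right_strip R \<subseteq> U"
  shows "parabolic_curve U F (\<phi> \<circ> strip_chart R)"
  unfolding parabolic_curve_def stable_curve_def invariant_curve_def holomorphic_curve_at_origin_def
proof (intro conjI allI impI)
  have chart: "strip_chart R ` \<Delta> \<subseteq> right_strip R" using strip_chart_in_right_strip by blast
  show "(\<lambda>\<zeta>. (\<phi> \<circ> strip_chart R) \<zeta> $ i) holomorphic_on \<Delta>" for i
    using holomorphic_on_compose_gen[OF strip_chart_holomorphic _ chart, of "\<lambda>t. \<phi> t $ i"] \<phi>
    by (simp add: translation_curve_def o_def)
  show "inj_on (\<phi> \<circ> strip_chart R) \<Delta>"
    by (intro comp_inj_on strip_chart_inj inj_on_subset[OF _ chart]) (use \<phi> in \<open>simp add: translation_curve_def\<close>)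
  show "0 \<notin> (\<phi> \<circ> strip_chart R) ` \<Delta>"
    using \<phi> chart by (fastforce simp: translation_curve_def)
  show "((\<phi> \<circ> strip_chart R) \<longlongrightarrow> 0) (at 0 within \<Delta>)"
    unfolding o_def by (rule filterlim_compose[OF lim filterlim_strip_chart])
  show "(\<phi> \<circ> strip_chart R) ` \<Delta> \<subseteq> U" using U chart by (auto simp: o_def)
  show "F ` (\<phi> \<circ> strip_chart R) ` \<Delta> \<subseteq> (\<phi> \<circ> strip_chart R) ` \<Delta>"
  proof (intro subsetI, elim imageE)
    fix z w \<zeta> assume z: "z = F w" "w = (\<phi> \<circ> strip_chart R) \<zeta>" "\<zeta> \<in> \<Delta>"
    obtain \<zeta>' where \<zeta>': "\<zeta>' \<in> \<Delta>" "strip_chart R \<zeta>' = strip_chart R \<zeta> + 1"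
      using strip_chart_add_1[OF z(3)] by blast
    have "z = (\<phi> \<circ> strip_chart R) \<zeta>'"
      using \<phi> strip_chart_in_right_strip[OF z(3)] \<zeta>'(2) z(1,2) by (simp add: translation_curve_def)
    then show "z \<in> (\<phi> \<circ> strip_chart R) ` \<Delta>" using \<zeta>'(1) by blast
  qed
  fix M assume M: "compact M \<and> M \<subseteq> (\<phi> \<circ> strip_chart R) ` \<Delta>"
  show "uniform_limit M (\<lambda>k. F ^^ k) (\<lambda>_. 0) sequentially"
  proof (rule uniform_limitI)
    fix e :: real assume "e > 0"
    then have "\<forall>\<^sub>F t in strip_at_top. dist (\<phi> t) 0 < e" using lim by (rule tendstoD[rotated])
    then obtain R' where R': "\<And>t. R' \<le> Re t \<Longrightarrow> \<bar>Im t\<bar> < 2 \<Longrightarrow> dist (\<phi> t) 0 < e"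
      unfolding eventually_strip_at_top by blast
    have "\<forall>\<^sub>F k in sequentially. R' - R \<le> real k"
      using filterlim_real_sequentially by (simp add: filterlim_at_top)
    then show "\<forall>\<^sub>F k in sequentially. \<forall>z\<in>M. dist ((F ^^ k) z) 0 < e"
    proof eventually_elim
      case (elim k)
      show ?case
      proof
        fix z assume "z \<in> M"
        then obtain \<zeta> where \<zeta>: "\<zeta> \<in> \<Delta>" "z = \<phi> (strip_chart R \<zeta>)" using M by auto
        define t where "t = strip_chart R \<zeta>"
        have t: "t \<in> right_strip R" "z = \<phi> t"
          using strip_chart_in_right_strip[OF \<zeta>(1)] \<zeta>(2) by (auto simp: t_def)
        have "(F ^^ k) z = \<phi> (t + of_nat k)" unfolding t(2) by (rule translation_curve_iterate[OF \<phi> t(1)])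
        moreover have "dist (\<phi> (t + of_nat k)) 0 < e"
          using t(1) elim by (intro R') (auto simp: right_strip_def)
        ultimately show "dist ((F ^^ k) z) 0 < e" by simp
      qed
    qed
  qed
qed

lemma proj_point_scale:
  assumes "c \<noteq> 0"
  shows "proj_point (c *s z) = proj_point z"
proof -
  have "b *s z = (b / c) *s (c *s z)" for b using assms by (simp add: vector_smult_assoc)
  moreover have "b / c \<noteq> 0" if "b \<noteq> 0" for b using that assms by simp
  ultimately have "proj_point z \<subseteq> proj_point (c *s z)" unfolding proj_point_def by blast
  moreover have "proj_point (c *s z) \<subseteq> proj_point z"
    using assms unfolding proj_point_def by (auto simp: vector_smult_assoc)
  ultimately show ?thesis by blast
qed

text \<open>An open set of the quotient topology has an open preimage, and this preimage is invariant under
  the scaling of representatives.\<close>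

lemma limitin_projective_space:
  fixes v :: "complex^'a::finite"
  assumes v: "v \<noteq> 0" and lim: "((\<lambda>t. c t *s \<phi> t) \<longlongrightarrow> v) L" and c: "\<forall>\<^sub>F t in L. c t \<noteq> 0"
  shows "limitin projective_space (\<lambda>t. proj_point (\<phi> t)) (proj_point v) L"
  unfolding limitin_def
proof (intro conjI allI impI)
  have *: "{z :: complex^'a. z \<noteq> 0 \<and> proj_point z \<in> proj_point ` (- {0})} = - {0}" by auto
  have "open {z :: complex^'a. z \<noteq> 0 \<and> proj_point z \<in> proj_point ` (- {0})}"
    unfolding * by (intro open_Compl) simp
  then have "openin projective_space (proj_point ` (- {0 :: complex^'a}))"
    unfolding openin_projective_space by blast
  then show "proj_point v \<in> topspace projective_space"
    using v openin_subset by blast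
  fix W assume W: "openin projective_space W \<and> proj_point v \<in> W"
  let ?S = "{z. z \<noteq> 0 \<and> proj_point z \<in> W}"
  have "open ?S" "v \<in> ?S" using W v by (auto simp: openin_projective_space)
  from topological_tendstoD[OF lim this] c
  show "\<forall>\<^sub>F t in L. proj_point (\<phi> t) \<in> W"
    by eventually_elim (simp add: proj_point_scale)
qed

lemma smallo_of_scaled_limit:
  fixes f :: "nat \<Rightarrow> complex"
  assumes "(\<lambda>k. of_nat k ^ p * f k) \<longlonglongrightarrow> c"
  shows "(\<lambda>k. f k - c * (1 / of_nat k ^ p)) \<in> o(\<lambda>k. 1 / of_nat k ^ p)"
proof (rule smalloI_tendsto)
  have "(\<lambda>k. of_nat k ^ p * f k - c) \<longlonglongrightarrow> c - c" by (intro tendsto_diff assms tendsto_const)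
  moreover have "\<forall>\<^sub>F k in sequentially. of_nat k ^ p * f k - c
      = (f k - c * (1 / of_nat k ^ p)) / (1 / of_nat k ^ p)"
    using eventually_gt_at_top[of 0] by eventually_elim (simp add: field_simps)
  ultimately show "(\<lambda>k. (f k - c * (1 / of_nat k ^ p)) / (1 / of_nat k ^ p)) \<longlonglongrightarrow> 0"
    using Lim_transform_eventually[of _ "c - c"] by simp
  show "\<forall>\<^sub>F k in sequentially. 1 / of_nat k ^ p \<noteq> (0 :: complex)"
    using eventually_gt_at_top[of 0] by eventually_elim simp
qed

lemma sequence_asymptotics:
  fixes g :: "complex \<Rightarrow> complex"
  assumes lim: "((\<lambda>t. t ^ p * g t) \<longlongrightarrow> c) strip_at_top" and t: "t \<in> right_strip R"
  shows "(\<lambda>k. g (t + of_nat k) - c * (1 / of_nat k ^ p)) \<in> o(\<lambda>k. 1 / of_nat k ^ p)"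
proof (rule smallo_of_scaled_limit)
  note l = filterlim_compose[OF lim filterlim_right_strip[OF t]]
  have "((\<lambda>s. 1 / s) \<longlongrightarrow> 0) strip_at_top"
    using tendsto_0_bigo[OF inverse_self_bigo_small_time[of 0] tendsto_small_time] .
  from filterlim_compose[OF this filterlim_right_strip[OF t]]
  have A: "(\<lambda>k. (1 - t * (1 / (t + of_nat k))) ^ p * ((t + of_nat k) ^ p * g (t + of_nat k))) \<longlonglongrightarrow> (1 - t * 0) ^ p * c"
    by (intro tendsto_mult tendsto_power tendsto_diff tendsto_const l)
  have B: "\<forall>\<^sub>F k in sequentially. (1 - t * (1 / (t + of_nat k))) ^ p * ((t + of_nat k) ^ p * g (t + of_nat k))
      = of_nat k ^ p * g (t + of_nat k)"
    using eventually_compose_filterlim[OF eventually_strip_Re_ge[of 1] filterlim_right_strip[OF t]]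
  proof eventually_elim
    case (elim k)
    then have "t + of_nat k \<noteq> 0" by (auto simp: complex_eq_iff)
    then have "1 - t * (1 / (t + of_nat k)) = of_nat k / (t + of_nat k)" by (simp add: divide_simps)
    then show ?case using \<open>t + of_nat k \<noteq> 0\<close> by (simp add: power_divide)
  qed
  from Lim_transform_eventually[OF A B]
  show "(\<lambda>k. of_nat k ^ p * g (t + of_nat k)) \<longlonglongrightarrow> c" by simp
qed

section \<open>Parabolic curves tangent to the first coordinate axis\<close>

theorem corollary3p2:
  fixes F :: "complex^'n::finite \<Rightarrow> complex^'n"
    and U :: "(complex^'n) set"
    and dF :: "complex^'n^'n"
    and ix :: "nat \<Rightarrow> 'n"
    and \<rho> :: nat
    and \<mu> \<nu> :: "nat \<Rightarrow> nat"
    and a11 :: "nat \<Rightarrow> complex"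
  defines "\<nu> \<equiv> block_offset \<mu>"
    and "a11 \<equiv> (\<lambda>j. power_series_coeff (\<lambda>z. F z $ ix j) 0 ((\<lambda>_. 0)(ix 1 := 2)))"
  assumes coordinates: "bij_betw ix {1..CARD('n)} UNIV"
    and germ: "0 \<in> U" "holomorphic_map_on F U" "F 0 = 0"
    and differential: "(F has_derivative (\<lambda>v. dF *v v)) (at 0)"
    and "\<not> diagonalizable dF"
    and "eigenvalues dF = {1}"
    and blocks: "\<rho> \<ge> 1" "\<forall>l\<in>{1..\<rho>}. \<mu> l \<ge> 1" "\<forall>l\<in>{1..<\<rho>}. \<mu> (l + 1) \<le> \<mu> l"
      "(\<Sum>l\<in>{1..\<rho>}. \<mu> l) = CARD('n)"
    and jordan: "unipotent_jordan_form ix \<rho> \<mu> dF"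
    and "\<rho> = 1 \<or> \<mu> 1 > \<mu> 2"
    and "a11 (\<mu> 1) \<noteq> 0"
  shows "\<exists>\<phi>. parabolic_curve U F \<phi> \<and> curve_tangent_to \<phi> (axis (ix 1) 1) \<and>
    (\<forall>z0\<in>\<phi> ` \<Delta>.
      (\<forall>j. 1 \<le> j \<and> j \<le> \<mu> 1 \<longrightarrow>
        (\<lambda>k. (F ^^ k) z0 $ ix j
           - (-1) ^ (\<mu> 1 + j - 1) * (of_nat (2 * \<mu> 1 - 1) / a11 (\<mu> 1))
             * of_nat ((2 * \<mu> 1 - 2) choose (\<mu> 1 - 1))
             * (fact (\<mu> 1 + j - 2) / of_nat k ^ (\<mu> 1 + j - 1)))
          \<in> o(\<lambda>k. 1 / of_nat k ^ (\<mu> 1 + j - 1))) \<and>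
      (\<forall>l j. 2 \<le> l \<and> l \<le> \<rho> \<and> \<nu> l + 1 \<le> j \<and> j \<le> \<nu> l + \<mu> l \<and> \<mu> l < \<mu> 1 - 1 \<longrightarrow>
        (\<lambda>k. (F ^^ k) z0 $ ix j) \<in> o(\<lambda>k. 1 / of_nat k ^ (\<mu> 1 + (j - \<nu> l)))) \<and>
      (\<forall>l j. 2 \<le> l \<and> l \<le> \<rho> \<and> \<nu> l + 1 \<le> j \<and> j \<le> \<nu> l + \<mu> l \<and> \<mu> l = \<mu> 1 - 1 \<longrightarrow>
        (\<lambda>k. (F ^^ k) z0 $ ix j
           - (-1) ^ (\<mu> 1 + (j - \<nu> l))
             * (a11 (\<mu> l + \<nu> l) * of_nat (2 * \<mu> 1 - 1) * of_nat (\<mu> l + (j - \<nu> l))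
                / (a11 (\<mu> 1))\<^sup>2)
             * of_nat ((2 * \<mu> 1 - 2) choose (\<mu> 1 - 1))
             * (fact (\<mu> 1 + (j - \<nu> l) - 2) / of_nat k ^ (\<mu> 1 + (j - \<nu> l))))
          \<in> o(\<lambda>k. 1 / of_nat k ^ (\<mu> 1 + (j - \<nu> l)))))"
proof -
  let ?n = "CARD('n)"
  \<comment> \<open>A matrix with one row is diagonalizable, and with several blocks \<open>\<mu> 1\<close> exceeds \<open>\<mu> 2\<close>.\<close>
  have \<mu>1: "2 \<le> \<mu> 1"
  proof (cases "\<rho> = 1")
    case True
    have "\<mu> 1 \<noteq> 1"
    proof
      assume "\<mu> 1 = 1"
      then have "?n = 1" using blocks(4) True by simp
      then have "i = j" for i j :: 'n by (metis UNIV_I card_1_singletonE singletonD)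
      then have "diagonalizable dF"
        unfolding diagonalizable_def by (intro exI[of _ "mat 1"]) (metis invertible_def matrix_mul_lid)
      with \<open>\<not> diagonalizable dF\<close> show False by simp
    qed
    moreover have "1 \<le> \<mu> 1" using blocks(1,2) by simp
    ultimately show ?thesis by simp
  next
    case False
    then have "2 \<in> {1..\<rho>}" using blocks(1) by simp
    then have "1 \<le> \<mu> 2" using blocks(2) by blast
    then show ?thesis using \<open>\<rho> = 1 \<or> \<mu> 1 > \<mu> 2\<close> False by simp
  qed
  interpret jordan_blocks ix \<rho> \<mu>
    by unfold_locales (fact coordinates blocks \<open>\<rho> = 1 \<or> \<mu> 1 > \<mu> 2\<close> \<mu>1)+
  let ?q = "(\<lambda>_. 0)(ix 1 := 2) :: 'n \<Rightarrow> nat"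
  define cf where "cf i = power_series_coeff (\<lambda>z. F z $ i) 0" for i
  define a where "a i = cf i ?q" for i
  have a_ix: "a (ix j) = a11 j" for j by (simp add: a_def cf_def a11_def)
  have cf: "has_power_series_at (\<lambda>z. F z $ i) (cf i) 0" for i
    unfolding cf_def power_series_coeff_def
    by (rule someI_ex[of "\<lambda>c. has_power_series_at (\<lambda>z. F z $ i) c 0"]) (use germ in \<open>simp add: holomorphic_map_on_def\<close>)
  interpret jordan_chains "\<mu> 1" depth nxt ends last_of "ix 1" a
    by (rule blocks_form_chains) (use \<open>a11 (\<mu> 1) \<noteq> 0\<close> in \<open>simp add: a_ix\<close>)
  have der: "((\<lambda>z. F z $ i) has_derivative (\<lambda>v. (dF *v v) $ i)) (at 0)" for i
    by (rule bounded_linear.has_derivative[OF bounded_linear_vec_nth differential])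
  have F0: "F 0 $ i = 0" for i using germ(3) by simp
  have "\<exists>r. \<forall>i. 0 < r i \<and> (\<lambda>\<alpha>. norm (cf i \<alpha>) * r i ^ sum \<alpha> UNIV) summable_on UNIV \<and>
      (\<forall>z. (\<forall>j. norm (z $ j) \<le> r i) \<longrightarrow> ((\<lambda>\<alpha>. cf i \<alpha> * (\<Prod>j\<in>UNIV. z $ j ^ \<alpha> j)) has_sum F z $ i) UNIV)"
  proof (rule choice, rule allI)
    fix i
    show "\<exists>r. 0 < r \<and> (\<lambda>\<alpha>. norm (cf i \<alpha>) * r ^ sum \<alpha> UNIV) summable_on UNIV \<and>
      (\<forall>z. (\<forall>j. norm (z $ j) \<le> r) \<longrightarrow> ((\<lambda>\<alpha>. cf i \<alpha> * (\<Prod>j\<in>UNIV. z $ j ^ \<alpha> j)) has_sum F z $ i) UNIV)"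
      by (rule power_series_abs_summable[OF cf[of i]]) (intro exI conjI; assumption)
  qed
  then obtain r' where r'_all: "\<forall>i. 0 < r' i \<and> (\<lambda>\<alpha>. norm (cf i \<alpha>) * r' i ^ sum \<alpha> UNIV) summable_on UNIV \<and>
      (\<forall>z. (\<forall>j. norm (z $ j) \<le> r' i) \<longrightarrow> ((\<lambda>\<alpha>. cf i \<alpha> * (\<Prod>j\<in>UNIV. z $ j ^ \<alpha> j)) has_sum F z $ i) UNIV)" ..
  have r': "0 < r' i" "(\<lambda>\<alpha>. norm (cf i \<alpha>) * r' i ^ sum \<alpha> UNIV) summable_on UNIV"
    "\<forall>z. (\<forall>j. norm (z $ j) \<le> r' i) \<longrightarrow> ((\<lambda>\<alpha>. cf i \<alpha> * (\<Prod>j\<in>UNIV. z $ j ^ \<alpha> j)) has_sum F z $ i) UNIV" for i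
    using r'_all by simp_all
  define r where "r = Min (range r')"
  have r: "0 < r" "r \<le> r' i" for i using r'(1) by (auto simp: r_def)
  have "\<exists>R \<phi>. translation_curve F R \<phi> \<and>
      (\<forall>i. ((\<lambda>t. t ^ (\<mu> 1 + depth i) * \<phi> t $ i) \<longlongrightarrow> C i) strip_at_top)"
  proof (rule exists_translation_curve[where F = F and r = r, OF germ(3) r(1)])
    fix V i and \<phi> :: "complex \<Rightarrow> complex^'n"
    assume V: "open V" and hol: "\<And>j. (\<lambda>t. \<phi> t $ j) holomorphic_on V"
      and small: "\<And>t j. t \<in> V \<Longrightarrow> norm (\<phi> t $ j) \<le> r"
    show "(\<lambda>t. F (\<phi> t) $ i) holomorphic_on V"
    proof (rule holomorphic_power_series_comp[where c = "cf i" and f = "\<lambda>z. F z $ i", OF r'(2) _ V hol])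
      show "((\<lambda>\<alpha>. cf i \<alpha> * (\<Prod>j\<in>UNIV. z $ j ^ \<alpha> j)) has_sum F z $ i) UNIV"
        if "\<And>j. norm (z $ j) \<le> r' i" for z using r'(3)[of i] that by simp
      show "norm (\<phi> t $ j) \<le> r' i" if "t \<in> V" for t j using small[OF that, of j] r(2)[of i] by simp
    qed
  next
    fix i and Y :: real assume Y: "0 < Y"
    have w: "\<mu> 1 < \<mu> 1 + depth j" if "j \<noteq> ix 1" for j using d_pos[OF that] by simp
    have 1: "1 \<le> \<mu> 1" using \<mu>1 by simp
    show "\<exists>x0 K H. 0 < x0 \<and> 0 \<le> K \<and> lipschitz_remainder x0 Y K H \<and>
        (\<forall>x y. norm x \<le> x0 \<and> (\<forall>j. norm (y j) \<le> Y) \<longrightarrow>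
          F (\<chi> j. x ^ (\<mu> 1 + depth j) * y j) $ i = x ^ (\<mu> 1 + depth i) * y i
            + (if i \<in> ends then 0 else x ^ (\<mu> 1 + depth i + 1) * y (nxt i))
            + x ^ (2 * \<mu> 1) * (a i * (y (ix 1))\<^sup>2 + x * H x y))"
    proof (rule quasi_homogeneous_expansion[where f = "\<lambda>z. F z $ i" and c = "cf i"
            and L = "\<lambda>v. (dF *v v) $ i" and w = "\<lambda>j. \<mu> 1 + depth j" and i = "ix 1"
            and m = "\<mu> 1" and Y = Y, OF cf[of i] der[of i] F0 1 _ _ Y])
      show "\<mu> 1 < \<mu> 1 + depth j" if "j \<noteq> ix 1" for j using that by (rule w)
      show "\<mu> 1 + depth (ix 1) = \<mu> 1" using d_i1 by simp
      fix x0 K H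
      assume A: "0 < x0" "0 \<le> K" "lipschitz_remainder x0 Y K H"
        and E: "\<forall>x y. norm x \<le> x0 \<and> (\<forall>j. norm (y j) \<le> Y) \<longrightarrow>
          F (\<chi> j. x ^ (\<mu> 1 + depth j) * y j) $ i = (dF *v (\<chi> j. x ^ (\<mu> 1 + depth j) * y j)) $ i
            + x ^ (2 * \<mu> 1) * (cf i ?q * (y (ix 1))\<^sup>2 + x * H x y)"
      have "(dF *v (\<chi> j. x ^ (\<mu> 1 + depth j) * y j)) $ i = x ^ (\<mu> 1 + depth i) * y i
            + (if i \<in> ends then 0 else x ^ (\<mu> 1 + depth i + 1) * y (nxt i))" for x y
        using jordan_form_apply[OF jordan, of _ i] d_nxt[of i] by simp
      with E have "\<forall>x y. norm x \<le> x0 \<and> (\<forall>j. norm (y j) \<le> Y) \<longrightarrow>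
          F (\<chi> j. x ^ (\<mu> 1 + depth j) * y j) $ i = x ^ (\<mu> 1 + depth i) * y i
            + (if i \<in> ends then 0 else x ^ (\<mu> 1 + depth i + 1) * y (nxt i))
            + x ^ (2 * \<mu> 1) * (a i * (y (ix 1))\<^sup>2 + x * H x y)" by (simp add: a_def)
      with A show ?thesis by blast
    qed
  qed
  then obtain R0 \<phi> where \<phi>0: "translation_curve F R0 \<phi>"
    and lim: "\<And>i. ((\<lambda>t. t ^ (\<mu> 1 + depth i) * \<phi> t $ i) \<longlongrightarrow> C i) strip_at_top" by blast
  have inv0: "((\<lambda>s. 1 / s) \<longlongrightarrow> 0) strip_at_top"
    using tendsto_0_bigo[OF inverse_self_bigo_small_time[of 0] tendsto_small_time] .
  have nz: "\<forall>\<^sub>F t :: complex in strip_at_top. t \<noteq> 0"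
    using eventually_strip_Re_ge[of 1] by eventually_elim auto
  have "((\<lambda>t. \<phi> t $ i) \<longlongrightarrow> 0) strip_at_top" for i
  proof -
    have A: "((\<lambda>t. (1 / t) ^ (\<mu> 1 + depth i) * (t ^ (\<mu> 1 + depth i) * \<phi> t $ i)) \<longlongrightarrow> 0 ^ (\<mu> 1 + depth i) * C i) strip_at_top"
      by (intro tendsto_mult tendsto_power inv0 lim)
    have B: "\<forall>\<^sub>F t in strip_at_top. (1 / t) ^ (\<mu> 1 + depth i) * (t ^ (\<mu> 1 + depth i) * \<phi> t $ i) = \<phi> t $ i"
      using nz by eventually_elim (simp add: power_divide)
    from Lim_transform_eventually[OF A B] \<mu>1 show ?thesis by (simp add: power_0_left)
  qed
  then have \<phi>_lim: "(\<phi> \<longlongrightarrow> 0) strip_at_top" by (intro vec_tendstoI) simp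
  have "open U" using germ(2) by (simp add: holomorphic_map_on_def)
  obtain R where R: "R0 \<le> R" "\<And>t. t \<in> right_strip R \<Longrightarrow> \<phi> t \<in> U"
    using eventually_strip_obtain[OF topological_tendstoD[OF \<phi>_lim \<open>open U\<close> germ(1)]] by blast
  have \<phi>: "translation_curve F R \<phi>" using \<phi>0 R(1) by (rule translation_curve_restrict)
  let ?\<phi> = "\<phi> \<circ> strip_chart R"
  have par: "parabolic_curve U F ?\<phi>"
    by (rule parabolic_curve_of_translation_curve[OF \<phi> \<phi>_lim]) (use R(2) in blast)
  have lim1: "((\<lambda>t. t ^ \<mu> 1 * \<phi> t $ ix 1) \<longlongrightarrow> C (ix 1)) strip_at_top"
    using lim[of "ix 1"] by (simp only: d_i1 add_0_right)
  have C1: "C (ix 1) \<noteq> 0" using C_i1 C0_nonzero by simp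
  have tangent: "limitin projective_space (\<lambda>t. proj_point (\<phi> t)) (proj_point (axis (ix 1) 1)) strip_at_top"
  proof (rule limitin_projective_space)
    show "axis (ix 1) 1 \<noteq> (0 :: complex^'n)" by (simp add: axis_eq_0_iff)
    have ne: "\<forall>\<^sub>F t in strip_at_top. \<phi> t $ ix 1 \<noteq> 0"
      using tendsto_imp_eventually_ne[OF lim C1] by eventually_elim auto
    then show "\<forall>\<^sub>F t in strip_at_top. inverse (\<phi> t $ ix 1) \<noteq> 0" by eventually_elim simp
    show "((\<lambda>t. inverse (\<phi> t $ ix 1) *s \<phi> t) \<longlongrightarrow> axis (ix 1) 1) strip_at_top"
    proof (rule vec_tendstoI)
      fix i
      show "((\<lambda>t. (inverse (\<phi> t $ ix 1) *s \<phi> t) $ i) \<longlongrightarrow> axis (ix 1) 1 $ i) strip_at_top"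
      proof (cases "i = ix 1")
        case True
        have "\<forall>\<^sub>F t in strip_at_top. 1 = (inverse (\<phi> t $ ix 1) *s \<phi> t) $ i"
          using ne by eventually_elim (simp add: True)
        from Lim_transform_eventually[OF tendsto_const this] show ?thesis by (simp add: True axis_def)
      next
        case False
        have A: "((\<lambda>t. (1 / t) ^ depth i * ((t ^ (\<mu> 1 + depth i) * \<phi> t $ i) / (t ^ \<mu> 1 * \<phi> t $ ix 1)))
            \<longlongrightarrow> 0 ^ depth i * (C i / C (ix 1))) strip_at_top"
          by (intro tendsto_mult tendsto_power tendsto_divide inv0 lim lim1 C1)
        have B: "\<forall>\<^sub>F t in strip_at_top. (1 / t) ^ depth i
            * ((t ^ (\<mu> 1 + depth i) * \<phi> t $ i) / (t ^ \<mu> 1 * \<phi> t $ ix 1))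
            = (inverse (\<phi> t $ ix 1) *s \<phi> t) $ i"
          using nz by eventually_elim (simp add: power_add power_one_over field_simps)
        from Lim_transform_eventually[OF A B] d_pos[OF False] False
        show ?thesis by (simp add: power_0_left axis_def)
      qed
    qed
  qed
  have tan: "curve_tangent_to ?\<phi> (axis (ix 1) 1)"
    unfolding curve_tangent_to_def o_def
  proof
    show "axis (ix 1) 1 \<noteq> (0 :: complex^'n)" by (simp add: axis_eq_0_iff)
    show "limitin projective_space (\<lambda>\<zeta>. proj_point (\<phi> (strip_chart R \<zeta>))) (proj_point (axis (ix 1) 1)) (at 0 within \<Delta>)"
      using tangent eventually_compose_filterlim[OF _ filterlim_strip_chart]
      unfolding limitin_def by blast
  qed
  have asymp: "(\<lambda>k. (F ^^ k) z0 $ i - C i * (1 / of_nat k ^ (\<mu> 1 + depth i))) \<in> o(\<lambda>k. 1 / of_nat k ^ (\<mu> 1 + depth i))"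
    if z0: "z0 \<in> ?\<phi> ` \<Delta>" for z0 i
  proof -
    obtain \<zeta> where \<zeta>: "\<zeta> \<in> \<Delta>" "z0 = \<phi> (strip_chart R \<zeta>)" using z0 by auto
    define t where "t = strip_chart R \<zeta>"
    have t: "t \<in> right_strip R" "z0 = \<phi> t"
      using strip_chart_in_right_strip[OF \<zeta>(1)] \<zeta>(2) by (auto simp: t_def)
    then show ?thesis
      using sequence_asymptotics[OF lim[of i] t(1)] translation_curve_iterate[OF \<phi> t(1)] by simp
  qed
  have first: "last_of (ix j) = ix (\<mu> 1)" "depth (ix j) = j - 1" if "1 \<le> j" "j \<le> \<mu> 1" for j
    using block_1_ix[OF that] by (auto simp: last_of_def depth_def block_offset_1)
  have later: "last_of (ix j) = ix (\<nu> l + \<mu> l)" "depth (ix j) = j - \<nu> l" "depth (ix (\<nu> l + \<mu> l)) = \<mu> l"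
    if "2 \<le> l" "l \<le> \<rho>" "\<nu> l + 1 \<le> j" "j \<le> \<nu> l + \<mu> l" for l j
  proof -
    have "in_block l j" "in_block l (\<nu> l + \<mu> l)" using that by (auto simp: in_block_def \<nu>_def)
    from blk_ix[OF this(1)] blk_ix[OF this(2)]
    show "last_of (ix j) = ix (\<nu> l + \<mu> l)" "depth (ix j) = j - \<nu> l" "depth (ix (\<nu> l + \<mu> l)) = \<mu> l"
      using that by (auto simp: last_of_def depth_def \<nu>_def)
  qed
  have top1: "last_of (ix 1) = ix (\<mu> 1)" using first(1)[of 1] \<mu>1 by simp
  show ?thesis
  proof (intro exI[of _ ?\<phi>] conjI ballI allI impI par tan; (elim conjE)?)
    fix z0 j assume z0: "z0 \<in> ?\<phi> ` \<Delta>" and j: "1 \<le> j" "j \<le> \<mu> 1"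
    have "depth (last_of (ix j)) = \<mu> 1 - 1" using first[OF j] first(2)[of "\<mu> 1"] \<mu>1 by simp
    from C_closed_form[OF this]
    have "C (ix j) = (-1) ^ (\<mu> 1 + (j - 1)) * (a11 (\<mu> 1) / (a11 (\<mu> 1))\<^sup>2) * of_nat (2 * \<mu> 1 - 1)
        * of_nat ((2 * \<mu> 1 - 2) choose (\<mu> 1 - 1)) * fact (\<mu> 1 + (j - 1) - 1)"
      by (simp only: first[OF j] top1 a_ix)
    moreover have "\<mu> 1 + (j - 1) = \<mu> 1 + j - 1" "\<mu> 1 + j - 1 - 1 = \<mu> 1 + j - 2" using j by auto
    moreover have "a11 (\<mu> 1) / (a11 (\<mu> 1))\<^sup>2 = 1 / a11 (\<mu> 1)" by (simp add: power2_eq_square)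
    ultimately have C: "C (ix j) = (-1) ^ (\<mu> 1 + j - 1) * (of_nat (2 * \<mu> 1 - 1) / a11 (\<mu> 1))
             * of_nat ((2 * \<mu> 1 - 2) choose (\<mu> 1 - 1)) * fact (\<mu> 1 + j - 2)"
      by (simp only:) simp
    have e: "\<mu> 1 + (j - 1) = \<mu> 1 + j - 1" using j by simp
    show "(\<lambda>k. (F ^^ k) z0 $ ix j
           - (-1) ^ (\<mu> 1 + j - 1) * (of_nat (2 * \<mu> 1 - 1) / a11 (\<mu> 1))
             * of_nat ((2 * \<mu> 1 - 2) choose (\<mu> 1 - 1))
             * (fact (\<mu> 1 + j - 2) / of_nat k ^ (\<mu> 1 + j - 1)))
          \<in> o(\<lambda>k. 1 / of_nat k ^ (\<mu> 1 + j - 1))"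
      using asymp[OF z0, of "ix j"] unfolding first(2)[OF j] e C by (simp del: of_nat_diff)
  next
    fix z0 l j
    assume z0: "z0 \<in> ?\<phi> ` \<Delta>" and l: "2 \<le> l" "l \<le> \<rho>" and j: "\<nu> l + 1 \<le> j" "j \<le> \<nu> l + \<mu> l"
      and \<mu>l: "\<mu> l < \<mu> 1 - 1"
    have "C (ix j) = 0" unfolding C_def later[OF l j] using \<mu>l by simp
    then show "(\<lambda>k. (F ^^ k) z0 $ ix j) \<in> o(\<lambda>k. 1 / of_nat k ^ (\<mu> 1 + (j - \<nu> l)))"
      using asymp[OF z0, of "ix j"] later(2)[OF l j] by simp
  next
    fix z0 l j
    assume z0: "z0 \<in> ?\<phi> ` \<Delta>" and l: "2 \<le> l" "l \<le> \<rho>" and j: "\<nu> l + 1 \<le> j" "j \<le> \<nu> l + \<mu> l"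
      and \<mu>l: "\<mu> l = \<mu> 1 - 1"
    define p where "p = j - \<nu> l"
    have p: "1 \<le> p" using j by (simp add: p_def)
    have "depth (last_of (ix j)) = \<mu> 1 - 1" using later[OF l j] \<mu>l by simp
    from C_closed_form[OF this]
    have "C (ix j) = (-1) ^ (\<mu> 1 + p) * (a11 (\<mu> l + \<nu> l) / (a11 (\<mu> 1))\<^sup>2) * of_nat (2 * \<mu> 1 - 1)
        * of_nat ((2 * \<mu> 1 - 2) choose (\<mu> 1 - 1)) * fact (\<mu> 1 + p - 1)"
      by (simp only: later[OF l j] top1 a_ix p_def[symmetric] add.commute[of "\<nu> l"])
    moreover have "fact (\<mu> 1 + p - 1) = of_nat (\<mu> l + p) * (fact (\<mu> 1 + p - 2) :: complex)"
    proof -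
      have e: "\<mu> 1 + p - 1 = Suc (\<mu> 1 + p - 2)" "Suc (\<mu> 1 + p - 2) = \<mu> l + p" using \<mu>1 p \<mu>l by auto
      have "fact (\<mu> 1 + p - 1) = of_nat (Suc (\<mu> 1 + p - 2)) * (fact (\<mu> 1 + p - 2) :: complex)"
        unfolding e(1) by (rule fact_Suc)
      then show ?thesis unfolding e(2) .
    qed
    ultimately have C: "C (ix j) = (-1) ^ (\<mu> 1 + p)
             * (a11 (\<mu> l + \<nu> l) * of_nat (2 * \<mu> 1 - 1) * of_nat (\<mu> l + p) / (a11 (\<mu> 1))\<^sup>2)
             * of_nat ((2 * \<mu> 1 - 2) choose (\<mu> 1 - 1)) * fact (\<mu> 1 + p - 2)"
      by (simp del: of_nat_diff of_nat_add)
    show "(\<lambda>k. (F ^^ k) z0 $ ix j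
           - (-1) ^ (\<mu> 1 + (j - \<nu> l))
             * (a11 (\<mu> l + \<nu> l) * of_nat (2 * \<mu> 1 - 1) * of_nat (\<mu> l + (j - \<nu> l))
                / (a11 (\<mu> 1))\<^sup>2)
             * of_nat ((2 * \<mu> 1 - 2) choose (\<mu> 1 - 1))
             * (fact (\<mu> 1 + (j - \<nu> l) - 2) / of_nat k ^ (\<mu> 1 + (j - \<nu> l))))
          \<in> o(\<lambda>k. 1 / of_nat k ^ (\<mu> 1 + (j - \<nu> l)))"
      using asymp[OF z0, of "ix j"] unfolding later(2)[OF l j] p_def[symmetric] C
      by (simp del: of_nat_diff of_nat_add)
  qed
qed

end
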